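(* As formal power series in $q$ (equivalently, for $|q|<1$), $$\sum_{n=0}^\infty\mathrm{spt}_\omega(10n+3)q^n=5\left(E_1^2E_5+6q\frac{E_2E_{10}^3}{E_1}+25q\frac{E_2^8E_5^5}{E_1^{10}}\right)$$ and $$\begin{aligned}\sum_{n=0}^\infty\mathrm{spt}_\omega(50n+23)q^n &=25\Bigg(E_1E_5^2+6q\frac{E_2E_5E_{10}^3}{E_1^2}+25\left(2q\frac{E_1^3E_{10}^4}{E_2^4}+25q^3\frac{E_1^3E_{10}^{10}}{E_2^{10}}\right)\\ &\quad+50 \Bigg(\frac{E_1^{16}E_{10}^{3}}{E_2^{15}E_5}+150q\frac{E_1^{13}E_{10}^{6}}{E_2^{14}E_5^2}+5650q^2\frac{E_1^{10}E_{10}^{9}}{E_2^{13}E_5^3}+101825q^3\frac{E_1^{7}E_{10}^{12}}{E_2^{12}E_5^4}\\ &\qquad+1068125q^4\frac{E_1^{4}E_{10}^{15}}{E_2^{11}E_5^5}+7042500q^5\frac{E_1E_{10}^{18}}{E_2^{10}E_5^6}+29800000q^6\frac{E_{10}^{21}}{E_1^{2}E_2^{9}E_5^7}\\ &\qquad+79000000q^7\frac{E_{10}^{24}}{E_1^{5}E_2^{8}E_5^8}+120000000q^8\frac{E_{10}^{27}}{E_1^{8}E_2^{7}E_5^9}+80000000q^9\frac{E_{10}^{30}}{E_1^{11}E_2^{6}E_5^{10}}\Bigg)\\ &\quad+ 625q \Bigg(63\frac{E_2^8E_5^6}{E_1^{11}}+6500q\frac{E_2^8E_5^{12}}{E_1^{17}}+196875q^2\frac{E_2^8E_5^{18}}{E_1^{23}}+2343750q^3\frac{E_2^8E_5^{24}}{E_1^{29}}\\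 &\qquad+9765625q^4\frac{E_2^8E_5^{30}}{E_1^{35}}\Bigg)\Bigg).\end{aligned}$$
   Context: For a positive integer $j$, $E_j:=(q^j;q^j)_\infty=\prod_{k\ge1}(1-q^{jk})$. $\mathrm{spt}_\omega(n)$ denotes the total number of appearances of the smallest part (counted with multiplicity), summed over all partitions of $n$ (into positive parts) in which each odd part is less than twice the smallest part. For example, $\mathrm{spt}_\omega(3)=5$. *)

theory Defs
  imports "HOL-Analysis.Analysis" "HOL-Library.Multiset"
begin

definition partitions_of :: "nat \<Rightarrow> nat multiset set" where
  "partitions_of n = {P. 0 \<notin># P \<and> sum_mset P = n}"

definition smallest_part :: "nat multiset \<Rightarrow> nat" where
  "smallest_part P = Min (set_mset P)"

(* For n = 0 the only partition is the empty one; it has no parts and contributes count 0,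
   whatever value smallest_part has there. *)
definition spt_omega :: "nat \<Rightarrow> nat" where
  "spt_omega n =
    (\<Sum>P | P \<in> partitions_of n \<and> (\<forall>p\<in>#P. odd p \<longrightarrow> p < 2 * smallest_part P).
       count P (smallest_part P))"

abbreviation q :: "complex fps" where
  "q \<equiv> fps_X"

(* (q^j; q^j)_infinity for j \<ge> 1, an infinite product in the X-adic topology of the type fps;
   the product index starts at 0, hence Suc k. *)
definition E :: "nat \<Rightarrow> complex fps" where
  "E j = (\<Prod>k. 1 - q ^ (j * Suc k))"


text \<open>The sum defining \<^const>\<open>spt_omega\<close> is over a finite set.\<close>

lemma finite_partitions_of: "finite (partitions_of n)"
proof -
  have "partitions_of n \<subseteq> mset ` {xs. set xs \<subseteq> {..n} \<and> length xs \<le> n}"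
  proof
    fix P assume "P \<in> partitions_of n"
    then have P: "0 \<notin># P" "sum_mset P = n" by (auto simp: partitions_of_def)
    obtain xs where xs: "mset xs = P" using ex_mset by blast
    have "sum_list xs = n" using P(2) xs by (metis sum_mset_sum_list)
    moreover have "x \<le> sum_list xs" if "x \<in> set xs" for x
      using that by (simp add: member_le_sum_list)
    moreover have "length xs \<le> sum_list xs" if "0 \<notin> set xs" for xs :: "nat list"
      using that by (induction xs) auto
    moreover have "0 \<notin> set xs" using P(1) xs by auto
    ultimately show "P \<in> mset ` {xs. set xs \<subseteq> {..n} \<and> length xs \<le> n}"
      using xs by blast
  qed
  then show ?thesis
    by (rule finite_subset) (simp add: finite_lists_length_le)
qed


text \<open>The infinite product defining \<^const>\<open>E\<close> converges, and its value is invertible.\<close>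

lemma
  assumes "j \<ge> 1"
  shows has_prod_E: "(\<lambda>k. 1 - q ^ (j * Suc k)) has_prod E j"
    and fps_nth_E_0: "fps_nth (E j) 0 = 1"
proof -
  define F where "F m = (\<Prod>k\<le>m. 1 - q ^ (j * Suc k))" for m
  define L where "L = Abs_fps (\<lambda>n. fps_nth (F n) n)"
  have step: "fps_nth (F (Suc m)) n = fps_nth (F m) n" if "n \<le> m" for m n
  proof -
    have lt: "n < j * Suc (Suc m)"
      using that assms by (metis Suc_le_mono le_SucI less_Suc_eq_le mult.commute mult_le_mono2 mult.right_neutral order_less_le_trans)
    have "F (Suc m) = F m - F m * q ^ (j * Suc (Suc m))"
      by (simp add: F_def algebra_simps)
    then show ?thesis using lt by (simp add: fps_mult_fps_X_power_nonzero fps_X_power_mult_right_nth)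
  qed
  have stable: "fps_nth (F m) n = fps_nth (F n) n" if "n \<le> m" for m n
    using that by (induction m rule: dec_induct) (auto simp: step)
  have "F \<longlonglongrightarrow> L"
    by (rule tendsto_fpsI) (auto simp: L_def eventually_at_top_linorder intro!: stable exI)
  moreover have "fps_nth L 0 = 1"
    using assms by (simp add: L_def F_def)
  then have "L \<noteq> 0" by auto
  ultimately have hp: "(\<lambda>k. 1 - q ^ (j * Suc k)) has_prod L"
    unfolding has_prod_def raw_has_prod_def F_def[abs_def] by simp
  have "E j = L"
    unfolding E_def prodinf_def
  proof (rule the_equality)
    show "(\<lambda>k. 1 - q ^ (j * Suc k)) has_prod L" by (fact hp)
    fix p assume "(\<lambda>k. 1 - q ^ (j * Suc k)) has_prod p"
    moreover have "1 - q ^ (j * Suc k) \<noteq> 0" for k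
    proof
      assume "1 - q ^ (j * Suc k) = 0"
      then have "fps_nth (1 - q ^ (j * Suc k)) 0 = fps_nth 0 0" by (rule arg_cong)
      then show False using assms by simp
    qed
    ultimately have "F \<longlonglongrightarrow> p"
      unfolding has_prod_def raw_has_prod_def F_def[abs_def] by simp
    with \<open>F \<longlonglongrightarrow> L\<close> show "p = L" by (blast intro: LIMSEQ_unique)
  qed
  then show "(\<lambda>k. 1 - q ^ (j * Suc k)) has_prod E j" "fps_nth (E j) 0 = 1"
    using hp \<open>fps_nth L 0 = 1\<close> by simp_all
qed

end

(*
Sorting partitions by the smallest part m turns E_2 * sum spt_omega(n) q^n into
sum_m q^m (q;q)_{m-1}^2 beta_m with beta_m = (q^2;q^2)_m / ((q;q)_m (q;q)_{2m}).
Inserting the Bailey pair of beta_m, the inner sums telescope and only a series in q^2 is added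
to sum sigma(n) q^n.  Since sum sigma(2n+1) q^n = E_2^8 / E_1^4 by a theta function identity,
sum spt_omega(2n+1) q^n = E_2^8 / E_1^5 = psi^4 / E_1, where psi = E_2^2 / E_1.

Write E_1(q) = E_25 (X - q - q^2 / X) with X a series in q^5, let Y be X with q^2 in place of q, and pass from
q^5 to q.  The dissection of E_2^2 = psi E_1 expresses everything through k = q / (X Y^2); with a = (1 - k^2) / k,
  a = E_2 E_5^5 / (q E_1 E_10^5),  a + 1 = E_2^4 E_5^2 / (q E_1^2 E_10^4),  a - 4 = E_1^3 E_5 / (q E_2 E_10^3).
The function eta = E_1 / (q E_25) satisfies eta^5 + 5 eta^4 + 15 eta^3 + 25 eta^2 + 25 eta = T(q^5) with
T = E_1^6 / (q E_5^6) = (a + 1) (a - 4)^2 / a^2.  Hence, up to a common factor, the parts of psi^4 eta^j with exponents in a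
fixed class modulo 5 are rational functions of a, computed directly for 0 <= j <= 4 and recursively for j < 0.
The first formula is the case j = -1.  Applying the same procedure to it requires j = -6, and the
partial fraction expansion of the result consists of eta quotients.
*)
theory Submission
  imports Defs "HOL-Computational_Algebra.Formal_Laurent_Series"
begin

section \<open>Truncation and infinite products\<close>

text \<open>Both progressions are odd, 10 n + 3 = 2 (5 n + 1) + 1 and 50 n + 23 = 10 (5 n + 2) + 3,
  so the even part of the generating function may stay unknown. The parameters are Ramanujan's: with
  R the Rogers-Ramanujan continued fraction, k = R(q) R(q^2)^2, and a = 1/k - k is the invariant of
  k -> -1/k. The coordinates of psi^4 in the dissection involve k itself; it is the class extracted
  from psi^4 eta^j that is rational in a. Ramanujan's quintic identity at q and at q^2 yields only
  the cubes of the eta quotients for a + 1 and a - 4. The cube roots are settled by clearing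
  denominators and comparing constant coefficients. Since eta has a pole at q = 0 and must be
  divided by, the dissection is carried out in the field of Laurent series. Combinatorics and theta
  series stay among power series, where infinite sums and products can be truncated modulo q^N. The
  exponent j = -6 comes from the last term of the first formula, as E_2^8 / E_1^10 = psi^4 /
  E_1^6.\<close>

text \<open>Identities of infinite products and theta series reduce to finite identities that hold modulo \<open>q\<^sup>N\<close> for every \<open>N\<close>.\<close>

definition eqm :: "nat \<Rightarrow> complex fps \<Rightarrow> complex fps \<Rightarrow> bool" where
  "eqm N f g \<longleftrightarrow> (\<forall>n<N. fps_nth f n = fps_nth g n)"

lemma eqm_refl [simp]: "eqm N f f"
  and eqm_sym: "eqm N f g \<Longrightarrow> eqm N g f"
  and eqm_trans [trans]: "eqm N f g \<Longrightarrow> eqm N g h \<Longrightarrow> eqm N f h"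
  and eqm_mono: "eqm N f g \<Longrightarrow> M \<le> N \<Longrightarrow> eqm M f g"
  by (auto simp: eqm_def)

lemma eqm_eqI: "(\<And>N. eqm N f g) \<Longrightarrow> f = g"
  unfolding eqm_def by (intro fps_ext) blast

lemma eqm_add: "eqm N f g \<Longrightarrow> eqm N h i \<Longrightarrow> eqm N (f + h) (g + i)"
  and eqm_diff: "eqm N f g \<Longrightarrow> eqm N h i \<Longrightarrow> eqm N (f - h) (g - i)"
  by (auto simp: eqm_def)

lemma eqm_mult: "eqm N f g \<Longrightarrow> eqm N h i \<Longrightarrow> eqm N (f * h) (g * i)"
  by (auto simp: eqm_def fps_mult_nth intro!: sum.cong)

lemma eqm_power: "eqm N f g \<Longrightarrow> eqm N (f ^ k) (g ^ k)"
  by (induction k) (auto intro: eqm_mult)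

lemma eqm_sum: "(\<And>i. i \<in> A \<Longrightarrow> eqm N (f i) (g i)) \<Longrightarrow> eqm N (sum f A) (sum g A)"
  by (induction A rule: infinite_finite_induct) (auto intro: eqm_add)

lemma eqm_prod: "(\<And>i. i \<in> A \<Longrightarrow> eqm N (f i) (g i)) \<Longrightarrow> eqm N (prod f A) (prod g A)"
  by (induction A rule: infinite_finite_induct) (auto intro: eqm_mult)

lemma eqm_X_power_mult: "eqm N f g \<Longrightarrow> eqm (k + N) (q ^ k * f) (q ^ k * g)"
  by (auto simp: eqm_def fps_X_power_mult_nth)

lemma eqm_X_power_0: "N \<le> k \<Longrightarrow> eqm N (q ^ k * f) 0"
  by (auto simp: eqm_def fps_X_power_mult_nth)

lemma eqm_inverse:
  assumes "eqm N f g" "fps_nth f 0 \<noteq> 0" "fps_nth g 0 \<noteq> 0"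
  shows "eqm N (inverse f) (inverse g)"
proof -
  have "eqm N (inverse f * (inverse g * g)) (inverse f * (inverse g * f))"
    by (intro eqm_mult eqm_refl eqm_sym[OF assms(1)])
  moreover have "inverse f * (inverse g * g) = inverse f" "inverse f * (inverse g * f) = inverse g"
    using inverse_mult_eq_1[OF assms(2)] inverse_mult_eq_1[OF assms(3)] by (simp_all add: ac_simps)
  ultimately show ?thesis by simp
qed

section \<open>Infinite q-products as stabilising truncations\<close>

text \<open>\<open>qp s c b\<close> is \<open>(s q\<^sup>c; q\<^sup>b)\<close> with infinitely many factors; its \<open>n\<close>-th coefficient is already that of the product of the first \<open>n + 1\<close> factors.\<close>

definition qpn :: "complex \<Rightarrow> nat \<Rightarrow> nat \<Rightarrow> nat \<Rightarrow> complex fps" where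
  "qpn s c b N = (\<Prod>k<N. 1 - fps_const s * q ^ (c + b * k))"

definition qp :: "complex \<Rightarrow> nat \<Rightarrow> nat \<Rightarrow> complex fps" where
  "qp s c b = Abs_fps (\<lambda>n. fps_nth (qpn s c b (Suc n)) n)"

lemma qpn_Suc: "qpn s c b (Suc N) = qpn s c b N * (1 - fps_const s * q ^ (c + b * N))"
  by (simp add: qpn_def)

lemma qpn_nth_0: "c > 0 \<Longrightarrow> fps_nth (qpn s c b N) 0 = 1"
  by (simp add: qpn_def fps_prod_nth')

lemma eqm_factor: "N \<le> k \<Longrightarrow> eqm N (1 - fps_const s * q ^ k) 1"
  by (auto simp: eqm_def fps_X_power_mult_right_nth)

lemma le_mult_self: "(b::nat) \<ge> 1 \<Longrightarrow> n \<le> b * n"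
  by (cases b) auto

lemma eqm_qpn:
  assumes "b \<ge> 1" "N \<le> c + b * M" "M \<le> M'"
  shows "eqm N (qpn s c b M') (qpn s c b M)"
  using assms(3)
proof (induction M' rule: dec_induct)
  case (step m)
  have "N \<le> c + b * m" using assms step by (meson add_left_mono le_trans mult_le_mono2)
  then have "eqm N (qpn s c b m * (1 - fps_const s * q ^ (c + b * m))) (qpn s c b M * 1)"
    by (intro eqm_mult step eqm_factor)
  then show ?case by (simp add: qpn_Suc)
qed simp

lemma eqm_qp:
  assumes "b \<ge> 1" "N \<le> c + b * M"
  shows "eqm N (qp s c b) (qpn s c b M)"
  unfolding eqm_def
proof (intro allI impI)
  fix n assume "n < N"
  have "b * Suc n \<ge> Suc n" using assms(1) by (rule le_mult_self)
  \<comment> \<open>Either of the products with \<open>Suc n\<close> and with \<open>M\<close>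
    factors may be the longer one; the longer is compared with both.\<close>
  then have "eqm (Suc n) (qpn s c b (max (Suc n) M)) (qpn s c b (Suc n))"
    by (intro eqm_qpn assms le_max_iff_disj[THEN iffD2] disjI1) auto
  moreover have "eqm N (qpn s c b (max (Suc n) M)) (qpn s c b M)"
    by (intro eqm_qpn assms) auto
  ultimately show "fps_nth (qp s c b) n = fps_nth (qpn s c b M) n"
    using \<open>n < N\<close> by (simp add: qp_def eqm_def)
qed

lemma qp_eqI:
  assumes "b \<ge> 1" "\<And>N. N \<ge> 1 \<Longrightarrow> eqm N f (qpn s c b N)"
  shows "f = qp s c b"
proof (rule eqm_eqI)
  fix N
  have "N \<le> b * N" using assms(1) by (rule le_mult_self)
  then have "eqm N (qp s c b) (qpn s c b N)" by (intro eqm_qp assms trans_le_add2)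
  then show "eqm N f (qp s c b)"
    using assms(2)[of N] by (cases "N = 0") (auto intro: eqm_trans eqm_sym simp: eqm_def)
qed

text \<open>The bridge from the topological product defining \<open>E\<close> to truncations; the
  remaining proofs need no limits.\<close>

lemma E_eq_qp:
  assumes "j \<ge> 1"
  shows "E j = qp 1 j j"
proof -
  let ?f = "\<lambda>k. 1 - q ^ (j * Suc k)"
  \<comment> \<open>\<open>has_prod\<close> permits finitely many vanishing factors to be split off;
    as none vanishes here, the plain partial products converge to \<open>E j\<close>.\<close>
  have "?f k \<noteq> 0" for k
  proof
    assume "?f k = 0"
    then have "fps_nth (?f k) 0 = fps_nth 0 0" by (rule arg_cong)
    then show False using assms by simp
  qed
  then have lim: "(\<lambda>n. \<Prod>k\<le>n. ?f k) \<longlonglongrightarrow> E j"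
    using has_prod_E[OF assms] by (auto simp: has_prod_def raw_has_prod_def)
  have eq: "(\<Prod>k\<le>n. ?f k) = qpn 1 j j (Suc n)" for n
    by (simp add: qpn_def lessThan_Suc_atMost)
  have "(\<lambda>n. qpn 1 j j (Suc n)) \<longlonglongrightarrow> qp 1 j j"
  proof (rule tendsto_fpsI)
    fix n
    show "\<forall>\<^sub>F m in sequentially. fps_nth (qpn 1 j j (Suc m)) n = fps_nth (qp 1 j j) n"
      unfolding eventually_at_top_linorder
    proof (intro exI allI impI)
      fix m assume "n \<le> m"
      have "Suc m \<le> j * Suc m" using assms by (rule le_mult_self)
      then have "eqm (Suc n) (qp 1 j j) (qpn 1 j j (Suc m))"
        using assms \<open>n \<le> m\<close> by (intro eqm_qp) linarith+
      then show "fps_nth (qpn 1 j j (Suc m)) n = fps_nth (qp 1 j j) n"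
        by (simp add: eqm_def)
    qed
  qed
  then show ?thesis by (rule LIMSEQ_unique[OF lim[unfolded eq]])
qed

lemma qp_nth_0: "c > 0 \<Longrightarrow> fps_nth (qp s c b) 0 = 1"
  by (simp add: qp_def qpn_nth_0)

lemma qp_split:
  assumes "b \<ge> 1" "m \<ge> 1"
  shows "qp s c b = (\<Prod>i<m. qp s (c + b * i) (m * b))"
proof (rule sym, rule eqm_eqI)
  fix N
  have "N \<le> b * (N * m)" "N \<le> m * b * N" using assms by auto
  then have "eqm N (qp s c b) (qpn s c b (N * m))"
    and *: "eqm N (\<Prod>i<m. qp s (c + b * i) (m * b)) (\<Prod>i<m. qpn s (c + b * i) (m * b) N)"
    using assms by (auto intro!: eqm_qp eqm_prod simp: trans_le_add2)
  moreover have "qpn s c b (N * m) = (\<Prod>k<N. \<Prod>i<m. 1 - fps_const s * q ^ (c + b * i + m * b * k))"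
  proof -
    have "qpn s c b (N * m) = (\<Prod>k<N. \<Prod>i\<in>{k * m..<k * m + m}. 1 - fps_const s * q ^ (c + b * i))"
      unfolding qpn_def by (rule prod.nat_group [symmetric])
    also have "\<dots> = (\<Prod>k<N. \<Prod>i<m. 1 - fps_const s * q ^ (c + b * (k * m + i)))"
    proof (rule prod.cong)
      fix k
      show "(\<Prod>i\<in>{k * m..<k * m + m}. 1 - fps_const s * q ^ (c + b * i)) =
            (\<Prod>i<m. 1 - fps_const s * q ^ (c + b * (k * m + i)))"
        using prod.shift_bounds_nat_ivl[of "\<lambda>i. 1 - fps_const s * q ^ (c + b * i)" 0 "k * m" m]
        by (simp add: atLeast0LessThan add.commute)
    qed simp
    finally show ?thesis by (simp add: algebra_simps)
  qed
  moreover have "\<dots> = (\<Prod>i<m. qpn s (c + b * i) (m * b) N)"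
    unfolding qpn_def by (rule prod.swap)
  ultimately show "eqm N (\<Prod>i<m. qp s (c + b * i) (m * b)) (qp s c b)"
    by (metis eqm_trans eqm_sym)
qed

lemma qp_minus:
  assumes "b \<ge> 1"
  shows "qp (-1) c b * qp 1 c b = qp 1 (2 * c) (2 * b)"
proof (rule qp_eqI)
  fix N :: nat
  have "N \<le> b * N" using assms by (rule le_mult_self)
  then have "eqm N (qp (-1) c b * qp 1 c b) (qpn (-1) c b N * qpn 1 c b N)"
    using assms by (intro eqm_mult eqm_qp trans_le_add2)
  also have "qpn (-1) c b N * qpn 1 c b N = qpn 1 (2 * c) (2 * b) N"
    unfolding qpn_def prod.distrib [symmetric]
  proof (rule prod.cong)
    fix k
    have "2 * c + 2 * b * k = (c + b * k) + (c + b * k)" by simp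
    then show "(1 - fps_const (-1) * q ^ (c + b * k)) * (1 - fps_const 1 * q ^ (c + b * k)) =
        1 - fps_const 1 * q ^ (2 * c + 2 * b * k)"
      by (simp only: power_add) (simp add: algebra_simps)
  qed simp
  finally show "eqm N (qp (-1) c b * qp 1 c b) (qpn 1 (2 * c) (2 * b) N)" .
qed (use assms in simp)

section \<open>Substituting a power of q\<close>

lemma compose_X_power_nth:
  "d \<ge> 1 \<Longrightarrow> fps_nth (fps_compose f (q ^ d)) n = (if d dvd n then fps_nth f (n div d) else 0)"
  by (simp add: fps_nth_compose_X_power)

lemma compose_X_power_hom:
  assumes "d \<ge> 1"
  shows "fps_compose (f * g) (q ^ d) = fps_compose f (q ^ d) * fps_compose g (q ^ d)"
    and "fps_compose (f ^ n) (q ^ d) = fps_compose f (q ^ d) ^ n"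
  using assms by (simp_all add: fps_compose_mult_distrib fps_compose_power)

lemma qp_compose:
  assumes "d \<ge> 1" "b \<ge> 1"
  shows "fps_compose (qp s c b) (q ^ d) = qp s (d * c) (d * b)"
proof (rule qp_eqI)
  fix N :: nat
  have "N \<le> b * N" using assms(2) by (rule le_mult_self)
  then have *: "eqm N (qp s c b) (qpn s c b N)" using assms by (intro eqm_qp trans_le_add2)
  have "eqm N (fps_compose (qp s c b) (q ^ d)) (fps_compose (qpn s c b N) (q ^ d))"
    unfolding eqm_def
  proof (intro allI impI)
    fix n assume "n < N"
    then have "n div d < N" using div_le_dividend le_less_trans by blast
    with * show "fps_nth (fps_compose (qp s c b) (q ^ d)) n = fps_nth (fps_compose (qpn s c b N) (q ^ d)) n"
      using assms by (simp add: compose_X_power_nth eqm_def)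
  qed
  also have "fps_compose (qpn s c b N) (q ^ d) = qpn s (d * c) (d * b) N"
    unfolding qpn_def using assms
    by (subst fps_compose_prod_distrib)
       (auto simp: fps_compose_sub_distrib compose_X_power_hom fps_compose_mult_distrib power_mult [symmetric] power_add [symmetric]
          fps_X_power_compose algebra_simps)
  finally show "eqm N (fps_compose (qp s c b) (q ^ d)) (qpn s (d * c) (d * b) N)" .
qed (use assms in simp)

lemma E_compose: "d \<ge> 1 \<Longrightarrow> j \<ge> 1 \<Longrightarrow> fps_compose (E j) (q ^ d) = E (d * j)"
  by (simp add: E_eq_qp qp_compose)

section \<open>Series given by coefficients and exponents over an index set\<close>

text \<open>The series \<open>\<Sum>j\<in>A. c j * q ^ e j\<close>; it is meaningful only if every \<open>e j = n\<close> has finitely many solutions, since an infinite sum counts as \<open>0\<close>.\<close>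

definition gs :: "'i set \<Rightarrow> ('i \<Rightarrow> complex) \<Rightarrow> ('i \<Rightarrow> nat) \<Rightarrow> complex fps" where
  "gs A c e = Abs_fps (\<lambda>n. \<Sum>j | j \<in> A \<and> e j = n. c j)"

text \<open>Local finiteness: every coefficient of \<open>gs A c e\<close> is then a finite sum, so
  that such series can be split along disjoint index sets and multiplied.\<close>

definition fin_below :: "'i set \<Rightarrow> ('i \<Rightarrow> nat) \<Rightarrow> bool" where
  "fin_below A e \<longleftrightarrow> (\<forall>N. finite {j \<in> A. e j < N})"

lemma fin_below_fiber: "fin_below A e \<Longrightarrow> finite {j \<in> A. e j = n}"
  unfolding fin_below_def by (rule finite_subset[of _ "{j \<in> A. e j < Suc n}"]) auto

lemma fin_below_subset: "fin_below A e \<Longrightarrow> B \<subseteq> A \<Longrightarrow> fin_below B e"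
  unfolding fin_below_def
proof
  fix N assume *: "\<forall>N. finite {j \<in> A. e j < N}" "B \<subseteq> A"
  show "finite {j \<in> B. e j < N}" by (rule finite_subset[of _ "{j \<in> A. e j < N}"]) (use * in auto)
qed

lemma gs_nth: "fps_nth (gs A c e) n = (\<Sum>j | j \<in> A \<and> e j = n. c j)"
  by (simp add: gs_def)

lemma eqm_gs:
  assumes "finite S" "S \<subseteq> A" "\<And>j. j \<in> A \<Longrightarrow> j \<notin> S \<Longrightarrow> e j \<ge> N"
  shows "eqm N (gs A c e) (\<Sum>j\<in>S. fps_const (c j) * q ^ e j)"
  unfolding eqm_def
proof (intro allI impI)
  fix n assume "n < N"
  then have "{j. j \<in> A \<and> e j = n} = {j \<in> S. e j = n}" using assms by force
  then have "fps_nth (gs A c e) n = (\<Sum>j\<in>S. if e j = n then c j else 0)"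
    using assms(1) by (simp add: gs_nth sum.If_cases Int_def)
  also have "\<dots> = fps_nth (\<Sum>j\<in>S. fps_const (c j) * q ^ e j) n"
    by (auto simp: fps_sum_nth fps_X_power_mult_right_nth intro!: sum.cong)
  finally show "fps_nth (gs A c e) n = fps_nth (\<Sum>j\<in>S. fps_const (c j) * q ^ e j) n" .
qed

lemma gs_reindex:
  assumes "bij_betw h A B"
  shows "gs B c e = gs A (\<lambda>j. c (h j)) (\<lambda>j. e (h j))"
proof (rule fps_ext)
  fix n
  have "bij_betw h {j. j \<in> A \<and> e (h j) = n} {j. j \<in> B \<and> e j = n}"
    using assms unfolding bij_betw_def inj_on_def by auto
  then show "fps_nth (gs B c e) n = fps_nth (gs A (\<lambda>j. c (h j)) (\<lambda>j. e (h j))) n"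
    by (simp add: gs_nth sum.reindex_bij_betw)
qed

lemma gs_Un:
  assumes "fin_below (A \<union> B) e" "A \<inter> B = {}"
  shows "gs (A \<union> B) c e = gs A c e + gs B c e"
proof (rule fps_ext)
  fix n
  have "finite {j. j \<in> A \<and> e j = n}" "finite {j. j \<in> B \<and> e j = n}"
    by (rule finite_subset[OF _ fin_below_fiber[OF assms(1), of n]]; blast)+
  moreover have "{j. j \<in> A \<union> B \<and> e j = n} = {j. j \<in> A \<and> e j = n} \<union> {j. j \<in> B \<and> e j = n}" by auto
  ultimately show "fps_nth (gs (A \<union> B) c e) n = fps_nth (gs A c e + gs B c e) n"
    using assms(2) by (simp add: gs_nth sum.union_disjoint disjoint_iff)
qed

lemma gs_shift: "gs A c (\<lambda>j. e j + k) = q ^ k * gs A c e"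
proof (rule fps_ext)
  fix n
  have "{j. j \<in> A \<and> e j + k = n} = (if n < k then {} else {j. j \<in> A \<and> e j = n - k})" by auto
  then show "fps_nth (gs A c (\<lambda>j. e j + k)) n = fps_nth (q ^ k * gs A c e) n"
    by (simp add: gs_nth fps_X_power_mult_nth)
qed

lemma gs_scale: "d \<ge> 1 \<Longrightarrow> gs A c (\<lambda>j. d * e j) = fps_compose (gs A c e) (q ^ d)"
proof (rule fps_ext)
  fix n assume "d \<ge> 1"
  then have "{j. j \<in> A \<and> d * e j = n} = (if d dvd n then {j. j \<in> A \<and> e j = n div d} else {})" by auto
  then show "fps_nth (gs A c (\<lambda>j. d * e j)) n = fps_nth (fps_compose (gs A c e) (q ^ d)) n"
    using \<open>d \<ge> 1\<close> by (simp add: gs_nth compose_X_power_nth)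
qed

lemma gs_cmult: "gs A (\<lambda>j. s * c j) e = fps_const s * gs A c e"
  by (rule fps_ext) (simp add: gs_nth sum_distrib_left)

lemma gs_cong: "(\<And>j. j \<in> A \<Longrightarrow> c j = c' j) \<Longrightarrow> (\<And>j. j \<in> A \<Longrightarrow> e j = e' j) \<Longrightarrow> gs A c e = gs A c' e'"
  by (rule fps_ext) (auto simp: gs_nth intro!: sum.cong)

lemma gs_diff: "gs A (\<lambda>j. c j - c' j) e = gs A c e - gs A c' e"
  by (rule fps_ext) (simp add: gs_nth sum_subtractf)

lemma fin_below_Times:
  assumes "fin_below A e" "fin_below B e'"
  shows "fin_below (A \<times> B) (\<lambda>(i, j). e i + e' j)"
  unfolding fin_below_def
proof
  fix N
  have "{ij \<in> A \<times> B. (case ij of (i, j) \<Rightarrow> e i + e' j) < N} \<subseteq> {i \<in> A. e i < N} \<times> {j \<in> B. e' j < N}"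
    by auto
  then show "finite {ij \<in> A \<times> B. (case ij of (i, j) \<Rightarrow> e i + e' j) < N}"
    by (rule finite_subset) (use assms in \<open>auto simp: fin_below_def\<close>)
qed

lemma gs_mult:
  assumes "fin_below A e" "fin_below B e'"
  shows "gs A c e * gs B c' e' = gs (A \<times> B) (\<lambda>(i, j). c i * c' j) (\<lambda>(i, j). e i + e' j)"
proof (rule fps_ext)
  fix n
  have fin: "finite {j. j \<in> A \<and> e j = k}" "finite {j. j \<in> B \<and> e' j = k}" for k
    using fin_below_fiber assms by blast+
  have "fps_nth (gs A c e * gs B c' e') n =
      (\<Sum>k=0..n. \<Sum>ij\<in>{i. i \<in> A \<and> e i = k} \<times> {j. j \<in> B \<and> e' j = n - k}. c (fst ij) * c' (snd ij))"
    by (simp add: fps_mult_nth gs_nth sum_product sum.cartesian_product case_prod_unfold)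
  also have "\<dots> = (\<Sum>ij\<in>(\<Union>k\<in>{0..n}. {i. i \<in> A \<and> e i = k} \<times> {j. j \<in> B \<and> e' j = n - k}). c (fst ij) * c' (snd ij))"
    using fin by (subst sum.UNION_disjoint) (auto intro!: sum.cong)
  also have "(\<Union>k\<in>{0..n}. {i. i \<in> A \<and> e i = k} \<times> {j. j \<in> B \<and> e' j = n - k}) =
      {ij. ij \<in> A \<times> B \<and> (case ij of (i, j) \<Rightarrow> e i + e' j) = n}" by auto
  finally show "fps_nth (gs A c e * gs B c' e') n =
      fps_nth (gs (A \<times> B) (\<lambda>(i, j). c i * c' j) (\<lambda>(i, j). e i + e' j)) n"
    by (simp add: gs_nth case_prod_unfold)
qed

lemma gs_theta: "q * fps_deriv (gs A c e) = gs A (\<lambda>j. of_nat (e j) * c j) e"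
proof (rule fps_ext)
  fix n
  have "fps_nth (q * fps_deriv (gs A c e)) n = of_nat n * fps_nth (gs A c e) n"
    by (cases n) auto
  then show "fps_nth (q * fps_deriv (gs A c e)) n = fps_nth (gs A (\<lambda>j. of_nat (e j) * c j) e) n"
    by (simp add: gs_nth sum_distrib_left)
qed

lemma fin_below_int:
  assumes "\<And>j::int. \<bar>j\<bar> \<le> int (e j) + 1"
  shows "fin_below A e"
  unfolding fin_below_def
proof
  fix N
  have "{j \<in> A. e j < N} \<subseteq> {- int N - 1..int N + 1}"
  proof
    fix j assume "j \<in> {j \<in> A. e j < N}"
    then show "j \<in> {- int N - 1..int N + 1}" using assms[of j] by auto
  qed
  then show "finite {j \<in> A. e j < N}" by (rule finite_subset) simp
qed

section \<open>The Jacobi triple product\<close>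

definition tri :: "nat \<Rightarrow> nat" where "tri k = k * (k - 1) div 2"

lemma tri_0 [simp]: "tri 0 = 0" and tri_Suc: "tri (Suc k) = tri k + k"
proof -
  show "tri (Suc k) = tri k + k"
  proof (cases k)
    case (Suc m)
    have "Suc k * (Suc k - 1) = k * (k - 1) + k * 2" using Suc by (simp add: algebra_simps)
    then show ?thesis unfolding tri_def by (metis div_mult_self1 mult.commute add.commute zero_neq_numeral)
  qed (simp add: tri_def)
qed (simp add: tri_def)

lemma tri_int: "2 * int (tri k) = int k * (int k - 1)"
  by (induction k) (auto simp: tri_Suc algebra_simps)

lemma qpn_unit: "c > 0 \<Longrightarrow> inverse (qpn s c b N) * qpn s c b N = 1"
  by (simp add: inverse_mult_eq_1 qpn_nth_0)

text \<open>The Gaussian binomial in base \<open>q ^ b\<close>. The value 0 for \<open>k > M\<close>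
  makes the Pascal rule hold at the boundary \<open>k = M\<close>.\<close>

definition gauss_binom :: "nat \<Rightarrow> nat \<Rightarrow> nat \<Rightarrow> complex fps" where
  "gauss_binom b M k = (if k \<le> M then qpn 1 b b M * inverse (qpn 1 b b k) * inverse (qpn 1 b b (M - k)) else 0)"

lemma inverse_qpn_Suc:
  assumes "b > 0"
  shows "inverse (qpn 1 b b k) = (1 - q ^ (b * Suc k)) * inverse (qpn 1 b b (Suc k))"
proof -
  have "inverse (qpn 1 b b k) * (inverse (qpn 1 b b (Suc k)) * qpn 1 b b (Suc k)) =
     (inverse (qpn 1 b b k) * qpn 1 b b k) * ((1 - q ^ (b * Suc k)) * inverse (qpn 1 b b (Suc k)))"
    by (simp add: qpn_Suc ac_simps)
  then show ?thesis using assms by (simp add: qpn_unit)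
qed

lemma gauss_binom_0: "b > 0 \<Longrightarrow> gauss_binom b M 0 = 1"
  and gauss_binom_self: "b > 0 \<Longrightarrow> gauss_binom b M M = 1"
  using qpn_unit[of b 1 b M] by (auto simp: gauss_binom_def qpn_def mult.commute)

lemma gauss_binom_sym: "k \<le> M \<Longrightarrow> gauss_binom b M (M - k) = gauss_binom b M k"
  by (simp add: gauss_binom_def ac_simps)

text \<open>Over a common denominator the q-Pascal rule is
  \<open>1 - A * B = (1 - A) + A * (1 - B)\<close> with \<open>A = q ^ (b * Suc m)\<close> and
  \<open>B = q ^ (b * Suc k)\<close>, where \<open>m = M - Suc k\<close>.\<close>

lemma gauss_binom_Suc:
  assumes "b > 0" "k \<le> M"
  shows "gauss_binom b (Suc M) (Suc k) = gauss_binom b M (Suc k) + q ^ (b * (M - k)) * gauss_binom b M k"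
proof (cases "k = M")
  case True
  then show ?thesis using assms by (simp add: gauss_binom_self) (simp add: gauss_binom_def)
next
  case False
  define m where "m = M - Suc k"
  have M: "M = Suc (m + k)" using False assms m_def by simp
  let ?p = "\<lambda>n. qpn 1 b b n"
  define i where "i = inverse (?p (Suc k)) * inverse (?p (Suc m))"
  have diff: "Suc M - Suc k = Suc m" "M - Suc k = m" "M - k = Suc m" "k \<le> M" "Suc k \<le> M"
    using M by simp_all
  have "gauss_binom b (Suc M) (Suc k) = ?p M * (1 - q ^ (b * Suc M)) * i"
    using diff unfolding gauss_binom_def i_def
    by (simp only: qpn_Suc[of _ _ _ M] diff if_True Suc_le_mono ac_simps fps_const_1_eq_1 mult_1_left mult_Suc_right)
  moreover have "gauss_binom b M (Suc k) = ?p M * (1 - q ^ (b * Suc m)) * i"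
    using diff unfolding gauss_binom_def i_def
    by (simp only: inverse_qpn_Suc[OF assms(1), of m] diff if_True ac_simps)
  moreover have "gauss_binom b M k = ?p M * (1 - q ^ (b * Suc k)) * i"
    using diff unfolding gauss_binom_def i_def
    by (simp only: inverse_qpn_Suc[OF assms(1), of k] diff if_True ac_simps)
  moreover have "q ^ (b * Suc M) = q ^ (b * Suc m) * q ^ (b * Suc k)"
    unfolding power_add [symmetric] M by (simp add: algebra_simps)
  moreover have "P * (1 - A * B) * i = P * (1 - A) * i + A * (P * (1 - B) * i)" for A B P i :: "complex fps"
    by (simp add: algebra_simps)
  ultimately show ?thesis unfolding diff(3) by (simp only:)
qed

text \<open>The q-binomial theorem for the product of z + w q^(b i), with z the variable of
  polynomials over power series. Evaluating at a high power of q later replaces the negative powers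
  of q that the triple product would ask for.\<close>

lemma coeff_q_binomial:
  assumes "b > 0"
  shows "coeff (\<Prod>i<M. [:w * q ^ (b * i), 1:]) n =
    (if n \<le> M then gauss_binom b M (M - n) * q ^ (b * tri (M - n)) * w ^ (M - n) else 0)"
proof (induction M arbitrary: n)
  case 0
  then show ?case using assms by (simp add: gauss_binom_0)
next
  case (Suc M)
  let ?P = "\<Prod>i<M. [:w * q ^ (b * i), 1:]"
  have eq: "(\<Prod>i<Suc M. [:w * q ^ (b * i), 1:]) = smult (w * q ^ (b * M)) ?P + pCons 0 ?P"
    by (simp add: mult.commute[of ?P])
  show ?case
  proof (cases n)
    case 0
    have "coeff ?P 0 = q ^ (b * tri M) * w ^ M"
      using Suc.IH[of 0] assms by (simp add: gauss_binom_self)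
    moreover have "q ^ (b * M) * q ^ (b * tri M) = q ^ (b * tri (Suc M))"
      unfolding power_add [symmetric] by (simp add: tri_Suc algebra_simps)
    ultimately show ?thesis unfolding eq using assms 0
      by (simp add: gauss_binom_self)
  next
    case n: (Suc m)
    consider "m > M" | "m = M" | k where "M = Suc (m + k)"
      by (metis less_imp_Suc_add linorder_neqE_nat)
    then show ?thesis
    proof cases
      case (3 k)
      have "coeff (smult (w * q ^ (b * M)) ?P + pCons 0 ?P) n =
         (gauss_binom b M (Suc k) + q ^ (b * (M - k)) * gauss_binom b M k) * (q ^ (b * tri (Suc k)) * w ^ Suc k)"
      proof -
        have "q ^ (b * M) * q ^ (b * tri k) = q ^ (b * (M - k)) * q ^ (b * tri (Suc k))"
          unfolding power_add [symmetric] using 3 by (simp add: tri_Suc algebra_simps)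
        moreover have "coeff ?P (Suc m) = gauss_binom b M k * q ^ (b * tri k) * w ^ k"
          using 3 by (subst Suc.IH) simp
        moreover have "coeff ?P m = gauss_binom b M (Suc k) * q ^ (b * tri (Suc k)) * w ^ Suc k"
          using 3 by (subst Suc.IH) simp
        moreover have "w * A * (G * B * W) + H * D * (w * W) = (H + C * G) * (D * (w * W))"
          if "A * B = C * D" for A B C D G H W :: "complex fps"
        proof -
          have "w * A * (G * B * W) + H * D * (w * W) = w * G * W * (A * B) + H * D * (w * W)" by (simp add: ac_simps)
          then show ?thesis unfolding that by (simp add: algebra_simps)
        qed
        ultimately show ?thesis
          unfolding n coeff_add coeff_smult coeff_pCons_Suc power_Suc by (simp only:)
      qed
      also have "\<dots> = gauss_binom b (Suc M) (Suc k) * (q ^ (b * tri (Suc k)) * w ^ Suc k)"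
        using assms 3 by (simp add: gauss_binom_Suc)
      finally show ?thesis unfolding eq using 3 n by (simp add: ac_simps)
    qed (use n assms in \<open>auto simp: eq Suc.IH gauss_binom_0 simp del: prod.lessThan_Suc\<close>)
  qed
qed

lemma poly_eq_sum:
  fixes P :: "'a :: comm_semiring_1 poly"
  assumes "\<And>n. n > M \<Longrightarrow> coeff P n = 0"
  shows "poly P y = (\<Sum>n\<le>M. coeff P n * y ^ n)"
proof -
  have "degree P \<le> M" using assms by (meson degree_le)
  then have "(\<Sum>n\<le>M. coeff P n * y ^ n) = (\<Sum>n\<le>degree P. coeff P n * y ^ n)"
    by (intro sum.mono_neutral_right) (auto simp: coeff_eq_0)
  then show ?thesis by (simp add: poly_altdef)
qed

section \<open>Exponents and signs of the triple product\<close>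

text \<open>For \<open>s = 1\<close> and \<open>s = - 1\<close>, \<open>sg s j\<close> is \<open>(- s)\<^sup>j\<close>; \<open>te b c j\<close> is the exponent \<open>b j (j - 1) / 2 + c j\<close> of the triple product, nonnegative as soon as \<open>c \<le> b\<close>.\<close>

definition sg :: "complex \<Rightarrow> int \<Rightarrow> complex" where
  "sg s j = (if even j then 1 else - s)"

definition te :: "nat \<Rightarrow> nat \<Rightarrow> int \<Rightarrow> nat" where
  "te b c j = nat (int b * (j * (j - 1) div 2) + int c * j)"

text \<open>A linear lower bound is enough for local finiteness and for truncation. For j = -i with
  i > 0 the term c j costs at most b i, and j (j - 1) / 2 - i = i (i - 1) / 2 is still at least i -
  1.\<close>

lemma te_bound:
  assumes "c \<le> b"
  shows "int b * (\<bar>j\<bar> - 1) \<le> int b * (j * (j - 1) div 2) + int c * j"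
    and "0 \<le> int b * (j * (j - 1) div 2) + int c * j"
proof -
  define t where "t = j * (j - 1) div 2"
  have t: "2 * t = j * (j - 1)" unfolding t_def by simp
  show "int b * (\<bar>j\<bar> - 1) \<le> int b * (j * (j - 1) div 2) + int c * j"
    unfolding t_def [symmetric]
  proof (cases "j \<ge> 0")
    case True
    have "0 \<le> (j - 1) * (j - 2)"
    proof (cases "j \<ge> 2")
      case False
      then have "j = 0 \<or> j = 1" using True by auto
      then show ?thesis by auto
    qed simp
    then have "j - 1 \<le> t" using t by (simp add: algebra_simps)
    then have "int b * (j - 1) \<le> int b * t" by (intro mult_left_mono) auto
    then show "int b * (\<bar>j\<bar> - 1) \<le> int b * t + int c * j" using True by (simp add: trans_le_add1 add_increasing2)
  next
    case False
    define i where "i = - j"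
    have i: "i \<ge> 1" "j = - i" using False by (auto simp: i_def)
    have "0 \<le> (i - 1) * (i - 2)"
    proof (cases "i \<ge> 2")
      case False
      then have "i = 1" using i by auto
      then show ?thesis by auto
    qed simp
    then have "i - 1 \<le> t - i" using t i by (simp add: algebra_simps)
    then have "int b * (i - 1) \<le> int b * (t - i)" by (intro mult_left_mono) auto
    moreover have "int c * i \<le> int b * i" using assms i by (intro mult_right_mono) auto
    moreover have "\<bar>j\<bar> = i" "int c * j = - (int c * i)" using i by auto
    ultimately show "int b * (\<bar>j\<bar> - 1) \<le> int b * t + int c * j"
      by (simp only: right_diff_distrib)
  qed
  show "0 \<le> int b * (j * (j - 1) div 2) + int c * j"
  proof (cases "j = 0")
    case False
    then have "0 \<le> int b * (\<bar>j\<bar> - 1)" by simp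
    then show ?thesis using \<open>int b * (\<bar>j\<bar> - 1) \<le> _\<close> by linarith
  qed simp
qed

lemma int_te: "c \<le> b \<Longrightarrow> int (te b c j) = int b * (j * (j - 1) div 2) + int c * j"
  using te_bound(2) by (simp add: te_def)

lemma two_te: "c \<le> b \<Longrightarrow> 2 * int (te b c j) = int b * (j * (j - 1)) + 2 * int c * j"
proof -
  assume "c \<le> b"
  have "2 * (j * (j - 1) div 2) = j * (j - 1)" by simp
  then have "int b * (j * (j - 1)) = 2 * (int b * (j * (j - 1) div 2))" by (metis mult.left_commute)
  then show ?thesis using \<open>c \<le> b\<close> by (simp add: int_te)
qed

lemma te_ge: "c \<le> b \<Longrightarrow> int b * (\<bar>j\<bar> - 1) \<le> int (te b c j)"
  using te_bound(1) by (simp add: int_te)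

lemma te_ge': "c \<le> b \<Longrightarrow> b \<ge> 1 \<Longrightarrow> \<bar>j\<bar> - 1 \<le> int (te b c j)"
proof -
  assume a: "c \<le> b" "b \<ge> 1"
  show ?thesis
  proof (cases "j = 0")
    case False
    then have "1 * (\<bar>j\<bar> - 1) \<le> int b * (\<bar>j\<bar> - 1)" using a by (intro mult_right_mono) auto
    also note te_ge[OF a(1)]
    finally show ?thesis by simp
  qed simp
qed

lemma fin_below_te: "c \<le> b \<Longrightarrow> b \<ge> 1 \<Longrightarrow> fin_below A (te b c)"
  using te_ge' by (intro fin_below_int) (simp add: algebra_simps)

lemma power_sg:
  assumes "s * s = 1" "int k = int N + j"
  shows "(- s) ^ k = (- s) ^ N * sg s j"
proof -
  have p: "(- s) ^ n = (if even n then 1 else - s)" for n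
    using assms(1) by (induction n) auto
  have "even k \<longleftrightarrow> (even N \<longleftrightarrow> even j)" using assms(2) by (metis even_add even_of_nat_iff)
  then show ?thesis using assms(1) by (auto simp: p sg_def)
qed

text \<open>Completing the square: at index k = N + j the exponents of the q-binomial theorem,
  evaluated at z = q^(b N), differ from \<open>te b c j\<close> by a quantity independent of j,
  which can be cancelled.\<close>

lemma tri_shift:
  assumes "int k = int N + j" "k \<le> M" "c \<le> b"
  shows "b * tri k + c * k + b * N * (M - k) + b * N * N = b * (tri N + N * M) + c * N + te b c j"
proof -
  have "int (b * tri k + c * k + b * N * (M - k) + b * N * N) = int (b * (tri N + N * M) + c * N + te b c j)"
  proof -
  have "2 * int (tri k) = (int N + j) * (int N + j - 1)" "2 * int (tri N) = int N * (int N - 1)"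
    using tri_int[of k] tri_int[of N] assms(1) by auto
  then have "int b * (2 * int (tri k)) = int b * ((int N + j) * (int N + j - 1))"
      "int b * (2 * int (tri N)) = int b * (int N * (int N - 1))" by auto
  moreover have "int (M - k) = int M - (int N + j)" using assms by simp
  moreover have "int c * int k = int c * int N + int c * j" using assms by (simp add: algebra_simps)
  ultimately show ?thesis using two_te[OF assms(3), of j]
    by (simp only: of_nat_add of_nat_mult) (simp add: algebra_simps)
  qed
  then show ?thesis by linarith
qed

lemma sum_tri: "(\<Sum>i<N. c + b * i) = c * N + b * tri N"
  by (induction N) (auto simp: tri_Suc algebra_simps)

text \<open>The q-binomial theorem with 2 N factors at z = q^(b N) and w = -s q^c. The upper N
  factors produce the first product, the lower N the second, and the monomial \<open>K\<close>
  cancels.\<close>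

lemma finite_jacobi_triple:
  assumes s: "s * s = 1" and "c \<le> b" "b \<ge> 1"
  shows "(\<Sum>j=- int N..int N. fps_const (sg s j) * q ^ te b c j * gauss_binom b (2 * N) (nat (int N + j)))
    = qpn s c b N * qpn s (b - c) b N"
proof -
  define w where "w = fps_const (- s) * q ^ c"
  define P where "P = (\<Prod>i<2 * N. [:w * q ^ (b * i), 1:])"
  define z where "z = q ^ (b * N)"
  define K where "K = fps_const ((- s) ^ N) * q ^ (b * (tri N + N * N) + c * N)"
  have "K \<noteq> 0"
  proof -
    have "s \<noteq> 0" using s by auto
    then show ?thesis by (simp add: K_def fps_const_eq_0_iff)
  qed
  have L: "poly P z = K * (qpn s c b N * qpn s (b - c) b N)"
  proof -
    have "poly P z = (\<Prod>i<N + N. z + w * q ^ (b * i))"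
      by (simp add: P_def poly_prod mult_2 add.commute)
    also have "\<dots> = (\<Prod>i<N. z + w * q ^ (b * i)) * (\<Prod>i<N. z + w * q ^ (b * (N + i)))"
      using prod.atLeastLessThan_concat[of 0 N "N + N" "\<lambda>i. z + w * q ^ (b * i)"]
        prod.shift_bounds_nat_ivl[of "\<lambda>i. z + w * q ^ (b * i)" 0 N N]
      by (simp add: atLeast0LessThan add.commute)
    also have "(\<Prod>i<N. z + w * q ^ (b * (N + i))) = (\<Prod>i<N. z * (1 - fps_const s * q ^ (c + b * i)))"
    proof (rule prod.cong)
      fix i
      have "q ^ (b * (N + i)) = z * q ^ (b * i)" by (simp add: z_def power_add [symmetric] algebra_simps)
      then show "z + w * q ^ (b * (N + i)) = z * (1 - fps_const s * q ^ (c + b * i))"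
        by (simp only: w_def power_add) (simp add: fps_const_neg [symmetric] algebra_simps del: fps_const_neg)
    qed simp
    also have "\<dots> = z ^ N * qpn s c b N"
      by (simp add: qpn_def prod.distrib)
    \<comment> \<open>For i < N the second summand has the smaller exponent, so it is pulled out
      instead of z. This reverses the order of the factors and uses
      \<open>s * s = 1\<close>.\<close>
    also have "(\<Prod>i<N. z + w * q ^ (b * i)) =
        (\<Prod>i<N. fps_const (- s) * q ^ (c + b * i) * (1 - fps_const s * q ^ (b - c + b * (N - Suc i))))"
    proof (rule prod.cong)
      fix i assume "i \<in> {..<N}"
      then have "c + b * i + (b - c + b * (N - Suc i)) = b * Suc (N - Suc i) + b * i" using assms by simp
      also have "\<dots> = b * N" using \<open>i \<in> {..<N}\<close> by (subst distrib_left [symmetric]) simp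
      finally have z: "z = q ^ (c + b * i) * q ^ (b - c + b * (N - Suc i))"
        unfolding z_def power_add [symmetric] by simp
      have eq: "(fps_const (- s) * A) * (1 - fps_const s * B) = fps_const (s * s) * (A * B) + fps_const (- s) * A" for A B
        unfolding fps_const_neg [symmetric] fps_const_mult [symmetric] by (simp add: algebra_simps del: fps_const_neg fps_const_mult)
      show "z + w * q ^ (b * i) =
          fps_const (- s) * q ^ (c + b * i) * (1 - fps_const s * q ^ (b - c + b * (N - Suc i)))"
        unfolding eq
        unfolding s by (simp only: z w_def fps_const_1_eq_1 mult_1_left power_add mult.assoc)
    qed simp
    also have "\<dots> = fps_const ((- s) ^ N) * q ^ (c * N + b * tri N) * qpn s (b - c) b N"
    proof -
      have "(\<Prod>i<N. 1 - fps_const s * q ^ (b - c + b * (N - Suc i))) = qpn s (b - c) b N"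
        unfolding qpn_def by (rule prod.nat_diff_reindex)
      moreover have "(\<Prod>i<N. q ^ (c + b * i)) = q ^ (c * N + b * tri N)"
        unfolding power_sum [symmetric] sum_tri ..
      ultimately show ?thesis by (simp add: prod.distrib fps_const_power)
    qed
    finally show ?thesis
      by (simp add: K_def z_def power_mult [symmetric] power_add algebra_simps)
  qed
  have "poly P z = (\<Sum>n\<le>2 * N. gauss_binom b (2 * N) (2 * N - n) * q ^ (b * tri (2 * N - n)) * w ^ (2 * N - n) * z ^ n)"
    using assms by (subst poly_eq_sum[of "2 * N"]) (auto simp: P_def coeff_q_binomial)
  also have "\<dots> = (\<Sum>j=- int N..int N. K * (fps_const (sg s j) * q ^ te b c j * gauss_binom b (2 * N) (nat (int N + j))))"
  proof (rule sum.reindex_bij_witness[of _ "\<lambda>j. nat (int N - j)" "\<lambda>n. int N - int n"])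
    fix n assume "n \<in> {..2 * N}"
    then have n: "n \<le> 2 * N" by simp
    define j where "j = int N - int n"
    define k where "k = 2 * N - n"
    have k: "int k = int N + j" "k \<le> 2 * N" "2 * N - k = n" using n by (auto simp: k_def j_def)
    have "b * tri k + c * k + b * N * n = b * (tri N + N * N) + c * N + te b c j"
      using tri_shift[OF k(1,2) assms(2)] unfolding k(3) by (simp add: algebra_simps)
    then have "q ^ (b * tri k) * q ^ (c * k) * q ^ (b * N * n) = q ^ (b * (tri N + N * N) + c * N) * q ^ te b c j"
      unfolding power_add [symmetric] by simp
    moreover have "w ^ k = fps_const ((- s) ^ N * sg s j) * q ^ (c * k)"
      unfolding power_sg[OF s k(1), symmetric] w_def by (simp add: power_mult_distrib power_mult fps_const_power)
    moreover have "nat (int N + j) = k" using k by simp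
    moreover have "z ^ n = q ^ (b * N * n)" by (simp add: z_def power_mult)
    moreover have "G * A * (fps_const (x * y) * B) * C = fps_const x * D * (fps_const y * F * G)"
      if "A * B * C = D * F" for A B C D F G :: "complex fps" and x y
    proof -
      have "G * A * (fps_const (x * y) * B) * C = G * fps_const (x * y) * (A * B * C)" by (simp add: ac_simps)
      then show ?thesis unfolding that by (simp add: fps_const_mult [symmetric] ac_simps del: fps_const_mult)
    qed
    ultimately show "K * (fps_const (sg s (int N - int n)) * q ^ te b c (int N - int n) *
        gauss_binom b (2 * N) (nat (int N + (int N - int n)))) =
      gauss_binom b (2 * N) (2 * N - n) * q ^ (b * tri (2 * N - n)) * w ^ (2 * N - n) * z ^ n"
      unfolding j_def [symmetric] k_def [symmetric] K_def by metis
  qed auto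
  finally show ?thesis using L \<open>K \<noteq> 0\<close> by (simp add: sum_distrib_left [symmetric])
qed

text \<open>Each of the three products in the binomial has at least \<open>min k (M - k)\<close>
  factors, so to this order the binomial is E_b / (E_b E_b).\<close>

lemma eqm_gauss_binom_E:
  assumes "k \<le> M" "b \<ge> 1"
  shows "eqm (b * (min k (M - k) + 1)) (gauss_binom b M k * E b) 1"
proof -
  let ?N = "b * (min k (M - k) + 1)"
  have u: "fps_nth (qpn 1 b b n) 0 = 1" "fps_nth (E b) 0 = 1" for n
    using assms by (simp_all add: qpn_nth_0 E_eq_qp qp_nth_0)
  have *: "eqm ?N (qpn 1 b b n) (E b)" if "min k (M - k) \<le> n" for n
    unfolding E_eq_qp[OF assms(2)] using assms that
    by (intro eqm_sym[OF eqm_qp]) (auto simp: algebra_simps intro: mult_le_mono)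
  have "eqm ?N (gauss_binom b M k * E b) (E b * inverse (E b) * inverse (E b) * E b)"
    unfolding gauss_binom_def if_P[OF assms(1)] using assms u
    by (intro eqm_mult eqm_inverse * eqm_refl) auto
  also have "E b * inverse (E b) * inverse (E b) * E b = 1"
    using inverse_mult_eq_1[of "E b"] u by (simp add: ac_simps)
  finally show ?thesis .
qed

text \<open>The binomial at j is accurate to order b (N - |j| + 1) and is multiplied by a power of q
  with exponent at least b (|j| - 1). Together this is b N, uniformly in j.\<close>

theorem jacobi_triple_product:
  assumes s: "s * s = 1" and "c \<le> b" "b \<ge> 1"
  shows "gs UNIV (sg s) (te b c) = qp s c b * qp s (b - c) b * E b"
proof (rule eqm_eqI)
  fix N
  let ?S = "{- int N..int N}"
  have "eqm N (gs UNIV (sg s) (te b c)) (\<Sum>j\<in>?S. fps_const (sg s j) * q ^ te b c j)"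
  proof (rule eqm_gs)
    fix j assume "j \<notin> ?S"
    then show "N \<le> te b c j" using te_ge'[OF assms(2,3), of j] by auto
  qed auto
  also have "eqm N \<dots> (\<Sum>j\<in>?S. fps_const (sg s j) * q ^ te b c j * gauss_binom b (2 * N) (nat (int N + j)) * E b)"
  proof (rule eqm_sum)
    fix j assume j: "j \<in> ?S"
    define k where "k = nat (int N + j)"
    define m where "m = min k (2 * N - k)"
    have k: "k \<le> 2 * N" "int m = int N - \<bar>j\<bar>" using j by (auto simp: k_def m_def)
    have "int b * (\<bar>j\<bar> - 1) \<le> int (te b c j)" using te_ge assms by blast
    moreover have "int b * int N = int b * (\<bar>j\<bar> - 1) + int b * (int m + 1)"
      unfolding k(2) by (simp add: algebra_simps)
    ultimately have "int b * int N \<le> int (te b c j) + int b * (int m + 1)" by linarith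
    then have "int (b * N) \<le> int (te b c j + b * (m + 1))" by (simp add: algebra_simps)
    then have le: "N \<le> te b c j + b * (m + 1)" using le_mult_self[OF assms(3), of N] by linarith
    have "eqm (te b c j + b * (m + 1)) (q ^ te b c j * 1) (q ^ te b c j * (gauss_binom b (2 * N) k * E b))"
      unfolding m_def using k assms by (intro eqm_X_power_mult eqm_sym[OF eqm_gauss_binom_E]) auto
    then have "eqm N (fps_const (sg s j) * (q ^ te b c j * 1)) (fps_const (sg s j) * (q ^ te b c j * (gauss_binom b (2 * N) k * E b)))"
      by (rule eqm_mult[OF eqm_refl eqm_mono[OF _ le]])
    then show "eqm N (fps_const (sg s j) * q ^ te b c j) (fps_const (sg s j) * q ^ te b c j * gauss_binom b (2 * N) (nat (int N + j)) * E b)"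
      by (simp add: k_def ac_simps)
  qed
  also have "\<dots> = qpn s c b N * qpn s (b - c) b N * E b"
    unfolding finite_jacobi_triple[OF assms, symmetric] sum_distrib_right by simp
  also have "eqm N \<dots> (qp s c b * qp s (b - c) b * E b)"
    using le_mult_self[OF assms(3), of N]
    by (intro eqm_mult eqm_refl eqm_sym[OF eqm_qp] assms trans_le_add2)
  finally show "eqm N (gs UNIV (sg s) (te b c)) (qp s c b * qp s (b - c) b * E b)" .
qed

section \<open>Jacobi's identity for the cube of Euler's product\<close>

text \<open>The derivative of the finite triple product at its zero \<open>z = q ^ N\<close>.\<close>

lemma finite_jacobi_cube:
  "(\<Sum>j=- int N..int N + 1. of_int (int N + 1 - j) * fps_const (sg 1 j) * q ^ te 1 0 j * gauss_binom 1 (2 * N + 1) (nat (int N + j)))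
    = qpn 1 1 1 N * qpn 1 1 1 N"
proof -
  let ?g = "\<lambda>j. of_int (int N + 1 - j) * fps_const (sg 1 j) * q ^ te 1 0 j * gauss_binom 1 (2 * N + 1) (nat (int N + j))"
  define P :: "complex fps poly" where "P = (\<Prod>i<2 * N + 1. [:- 1 * q ^ (1 * i), 1:])"
  define z where "z = q ^ N"
  define K where "K = (- 1) ^ N * q ^ (tri N + N * N)"
  have "K \<noteq> 0" by (simp add: K_def)
  define R :: "complex fps poly" where "R = (\<Prod>i<N. [:- 1 * q ^ (1 * i), 1:]) * (\<Prod>i<N. [:- 1 * q ^ (1 * (N + Suc i)), 1:])"
  have "P = [:- z, 1:] * R"
  proof -
    have "P = (\<Prod>i<N. [:- 1 * q ^ (1 * i), 1:]) * (\<Prod>i=N..<2*N+1. [:- 1 * q ^ (1 * i), 1:])"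
      unfolding P_def atLeast0LessThan [symmetric]
      by (rule prod.atLeastLessThan_concat [symmetric]) auto
    also have "(\<Prod>i=N..<2*N+1. [:- 1 * q ^ (1 * i), 1:]) = (\<Prod>i<Suc N. [:- 1 * q ^ (1 * (N + i)), 1:])"
      using prod.shift_bounds_nat_ivl[of "\<lambda>i. [:- 1 * q ^ (1 * i), 1:]" 0 N "Suc N"]
      by (simp add: atLeast0LessThan add.commute mult_2)
    also have "\<dots> = [:- z, 1:] * (\<Prod>i<N. [:- 1 * q ^ (1 * (N + Suc i)), 1:])"
      by (subst prod.lessThan_Suc_shift) (simp add: z_def)
    finally show ?thesis by (simp only: R_def ac_simps)
  qed
  \<comment> \<open>\<open>R\<close> is \<open>P\<close> without its linear factor vanishing at z,
    so the product rule leaves only this term.\<close>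
  then have "poly (pderiv P) z = poly R z"
    by (simp only: pderiv_mult poly_add poly_mult) (simp add: pderiv_pCons)
  also have "\<dots> = K * (qpn 1 1 1 N * qpn 1 1 1 N)"
  proof -
    have "(\<Prod>i<N. z - q ^ (N + Suc i)) = (\<Prod>i<N. z * (1 - q ^ Suc i))"
      by (simp add: z_def power_add algebra_simps)
    also have "\<dots> = q ^ (N * N) * qpn 1 1 1 N"
      by (simp add: prod.distrib qpn_def z_def power_mult)
    finally have 1: "(\<Prod>i<N. z - q ^ (N + Suc i)) = q ^ (N * N) * qpn 1 1 1 N" .
    have "(\<Prod>i<N. z - q ^ i) = (\<Prod>i<N. - 1 * q ^ i * (1 - q ^ Suc (N - Suc i)))"
    proof (rule prod.cong)
      fix i assume "i \<in> {..<N}"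
      then have "z = q ^ i * q ^ Suc (N - Suc i)" by (simp add: z_def power_add [symmetric] del: power_Suc)
      then show "z - q ^ i = - 1 * q ^ i * (1 - q ^ Suc (N - Suc i))"
        by (simp only:) (simp add: algebra_simps)
    qed simp
    also have "\<dots> = (- 1) ^ N * q ^ tri N * (\<Prod>i<N. 1 - q ^ Suc (N - Suc i))"
      using sum_tri[of 0 1 N] by (simp only: prod.distrib power_sum [symmetric]) simp
    also have "(\<Prod>i<N. 1 - q ^ Suc (N - Suc i)) = qpn 1 1 1 N"
      using prod.nat_diff_reindex[of "\<lambda>i. 1 - q ^ Suc i" N] by (simp add: qpn_def)
    finally show ?thesis using 1 by (simp add: R_def poly_prod K_def power_add ac_simps)
  qed
  finally have L: "poly (pderiv P) z = K * (qpn 1 1 1 N * qpn 1 1 1 N)" .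
  have co: "coeff P n = (if n \<le> 2 * N + 1 then gauss_binom 1 (2 * N + 1) (2 * N + 1 - n) * q ^ tri (2 * N + 1 - n) * (- 1) ^ (2 * N + 1 - n) else 0)" for n
    unfolding P_def by (subst coeff_q_binomial) auto
  have "poly (pderiv P) z = (\<Sum>n\<le>2 * N. coeff (pderiv P) n * z ^ n)"
    by (rule poly_eq_sum) (simp add: coeff_pderiv co)
  also have "\<dots> = (\<Sum>j=- int N..int N. K * ?g j)"
  proof (rule sum.reindex_bij_witness[of _ "\<lambda>j. nat (int N - j)" "\<lambda>n. int N - int n"])
    fix n assume "n \<in> {..2 * N}"
    then have n: "n \<le> 2 * N" by simp
    define j where "j = int N - int n"
    define k where "k = 2 * N - n"
    have k: "int k = int N + j" "k \<le> 2 * N" "2 * N - k = n" "2 * N + 1 - Suc n = k" "int N + 1 - j = int (Suc n)"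
      using n by (auto simp: k_def j_def)
    have "tri k + N * n = tri N + N * N + te 1 0 j"
      using tri_shift[OF k(1,2), of 0 1] unfolding k(3) by (simp add: algebra_simps)
    then have e: "q ^ tri k * q ^ (N * n) = q ^ (tri N + N * N) * q ^ te 1 0 j"
      unfolding power_add [symmetric] by simp
    have sgk: "(- 1) ^ k = (- 1) ^ N * fps_const (sg 1 j)"
      using arg_cong[OF power_sg[OF _ k(1), of 1], of fps_const]
      by (simp add: fps_const_mult [symmetric] fps_const_power [symmetric] del: fps_const_mult fps_const_power fps_const_neg)
    have nk: "nat (int N + j) = k" using k by simp
    have zn: "z ^ n = q ^ (N * n)" by (simp add: z_def power_mult)
    have cn: "coeff P (Suc n) = gauss_binom 1 (2 * N + 1) k * q ^ tri k * (- 1) ^ k"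
      using n k(4) by (subst co) auto
    have H: "of_nat (Suc n) * (G * A * (x * y)) * C = x * D * (of_int (int (Suc n)) * y * F * G)"
      if "A * C = D * F" for A C D F G x y :: "complex fps"
    proof -
      have "of_nat (Suc n) * (G * A * (x * y)) * C = of_nat (Suc n) * (G * (x * y) * (A * C))" by (simp only: ac_simps)
      then show ?thesis unfolding that by (simp only: ac_simps of_int_of_nat_eq)
    qed
    show "K * ?g (int N - int n) = coeff (pderiv P) n * z ^ n"
      unfolding j_def[symmetric] K_def coeff_pderiv cn k(5) nk zn sgk by (rule H [OF e, symmetric])
  qed auto
  also have "\<dots> = K * (\<Sum>j=- int N..int N. ?g j)"
    by (simp add: sum_distrib_left)
  \<comment> \<open>The weight N + 1 - j vanishes at the added index, which makes the range
    invariant under j -> 1 - j.\<close>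
  also have "(\<Sum>j=- int N..int N. ?g j) =
     (\<Sum>j=- int N..int N + 1. ?g j)"
  proof (intro sum.mono_neutral_left ballI)
    fix i assume "i \<in> {- int N..int N + 1} - {- int N..int N}"
    then have "i = int N + 1" by auto
    then show "?g i = 0"
      by simp
  qed auto
  finally show ?thesis using L \<open>K \<noteq> 0\<close> by simp
qed

text \<open>The weight N + 1 - j does not survive N -> infinity. Adding the reflection j -> 1 - j,
  which flips the sign and keeps exponent and binomial, replaces it by 1 - 2 j.\<close>

lemma finite_jacobi_cube':
  "(\<Sum>j=- int N..int N + 1. fps_const (of_int (1 - 2 * j) * sg 1 j) * q ^ te 1 0 j * gauss_binom 1 (2 * N + 1) (nat (int N + j)))
    = 2 * (qpn 1 1 1 N * qpn 1 1 1 N)"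
proof -
  let ?t = "\<lambda>j. fps_const (sg 1 j) * q ^ te 1 0 j * gauss_binom 1 (2 * N + 1) (nat (int N + j))"
  let ?S = "\<Sum>j=- int N..int N + 1. of_int (int N + 1 - j) * ?t j"
  have S: "?S = qpn 1 1 1 N * qpn 1 1 1 N" using finite_jacobi_cube[of N] by (simp only: mult.assoc)
  have "?S = (\<Sum>j=- int N..int N + 1. - of_int (int N + j) * ?t j)"
  proof (rule sum.reindex_bij_witness[of _ "\<lambda>j. 1 - j" "\<lambda>j. 1 - j"])
    fix j assume j: "j \<in> {- int N..int N + 1}"
    define k where "k = nat (int N + j)"
    have "sg 1 (1 - j) = - sg 1 j" by (simp add: sg_def)
    moreover have "te 1 0 (1 - j) = te 1 0 j" unfolding te_def by (simp add: algebra_simps)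
    moreover have "nat (int N + (1 - j)) = 2 * N + 1 - k" "k \<le> 2 * N + 1" using j by (auto simp: k_def)
    moreover have "gauss_binom 1 (2 * N + 1) (2 * N + 1 - k) = gauss_binom 1 (2 * N + 1) k"
      by (rule gauss_binom_sym) fact
    moreover have "int N + 1 - j = int N + (1 - j)" by simp
    ultimately show "- of_int (int N + (1 - j)) * ?t (1 - j) = of_int (int N + 1 - j) * ?t j"
      unfolding k_def [symmetric] by (simp only:) (simp add: fps_const_neg [symmetric] algebra_simps del: fps_const_neg)
  qed auto
  then have "2 * ?S = ?S + (\<Sum>j=- int N..int N + 1. - of_int (int N + j) * ?t j)" by simp
  also have "\<dots> = (\<Sum>j=- int N..int N + 1. of_int (1 - 2 * j) * ?t j)"
    by (simp only: sum.distrib [symmetric] distrib_right [symmetric]) (simp add: algebra_simps)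
  also have "\<dots> = (\<Sum>j=- int N..int N + 1. fps_const (of_int (1 - 2 * j) * sg 1 j) * q ^ te 1 0 j * gauss_binom 1 (2 * N + 1) (nat (int N + j)))"
    by (simp only: fps_const_mult [symmetric] mult.assoc fps_of_int)
  finally show ?thesis unfolding S by simp
qed

text \<open>The factor 2 is due to the bilateral sum: j and 1 - j give the same term.\<close>

theorem jacobi_cube: "gs UNIV (\<lambda>j. of_int (1 - 2 * j) * sg 1 j) (te 1 0) = 2 * E 1 ^ 3"
proof (rule eqm_eqI)
  fix N
  let ?G = "gs UNIV (\<lambda>j. of_int (1 - 2 * j) * sg 1 j) (te 1 0)" and ?c = "\<lambda>j. fps_const (of_int (1 - 2 * j) * sg 1 j)"
  let ?S = "{- int N..int N + 1}"
  have "eqm N (?G) (\<Sum>j\<in>?S. ?c j * q ^ te 1 0 j)"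
  proof (rule eqm_gs)
    fix j assume "j \<notin> ?S"
    then show "N \<le> te 1 0 j" using te_ge'[of 0 1 j] by auto
  qed auto
  also have "eqm N \<dots> (\<Sum>j\<in>?S. ?c j * q ^ te 1 0 j * gauss_binom 1 (2 * N + 1) (nat (int N + j)) * E 1)"
  proof (rule eqm_sum)
    fix j assume j: "j \<in> ?S"
    define k where "k = nat (int N + j)"
    define m where "m = min k (2 * N + 1 - k)"
    have k: "k \<le> 2 * N + 1" "int m \<ge> int N - \<bar>j\<bar>" using j by (auto simp: k_def m_def)
    have "\<bar>j\<bar> - 1 \<le> int (te 1 0 j)" by (rule te_ge') auto
    then have "int N \<le> int (te 1 0 j) + int m + 1" using k(2) by simp
    then have le: "N \<le> te 1 0 j + 1 * (m + 1)" by simp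
    have "eqm (te 1 0 j + 1 * (m + 1)) (q ^ te 1 0 j * 1) (q ^ te 1 0 j * (gauss_binom 1 (2 * N + 1) k * E 1))"
      unfolding m_def using k by (intro eqm_X_power_mult eqm_sym[OF eqm_gauss_binom_E]) auto
    then have "eqm N (?c j * (q ^ te 1 0 j * 1)) (?c j * (q ^ te 1 0 j * (gauss_binom 1 (2 * N + 1) k * E 1)))"
      by (rule eqm_mult[OF eqm_refl eqm_mono[OF _ le]])
    then show "eqm N (?c j * q ^ te 1 0 j) (?c j * q ^ te 1 0 j * gauss_binom 1 (2 * N + 1) (nat (int N + j)) * E 1)"
      by (simp add: k_def ac_simps)
  qed
  also have "\<dots> = 2 * (qpn 1 1 1 N * qpn 1 1 1 N) * E 1"
    unfolding finite_jacobi_cube' [symmetric] sum_distrib_right by simp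
  also have "eqm N \<dots> (2 * (E 1 * E 1) * E 1)"
    by (intro eqm_mult eqm_refl eqm_sym[OF eqm_qp] trans_le_add2) (auto simp: E_eq_qp intro!: eqm_sym[OF eqm_qp])
  finally show "eqm N (?G) (2 * E 1 ^ 3)"
    by (simp add: power3_eq_cube ac_simps)
qed

lemma E_nonzero: "j \<ge> 1 \<Longrightarrow> E j \<noteq> 0"
  using fps_nth_E_0[of j] by (metis fps_zero_nth zero_neq_one)

lemma int_te_2_1: "int (te 2 1 j) = j * j"
proof -
  have "2 * int (te 2 1 j) = 2 * (j * j)" using two_te[of 1 2 j] by (simp add: algebra_simps)
  then show ?thesis by simp
qed

section \<open>Theta functions and sums of divisors\<close>

text \<open>In Ramanujan's notation these are \<open>\<phi>(- q)\<close>, \<open>\<phi>(q)\<close>, \<open>\<psi>(q)\<close>, \<open>f(q\<^sup>2, q\<^sup>3)\<close> and \<open>f(q, q\<^sup>4)\<close>.\<close>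

definition phim :: "complex fps" where "phim = gs UNIV (sg 1) (te 2 1)"
definition phip :: "complex fps" where "phip = gs UNIV (sg (-1)) (te 2 1)"
definition psi :: "complex fps" where "psi = qp (-1) 1 1 ^ 2 * E 1"
definition f23 :: "complex fps" where "f23 = gs UNIV (sg (-1)) (te 5 2)"
definition f14 :: "complex fps" where "f14 = gs UNIV (sg (-1)) (te 5 1)"

lemma phim_prod: "phim * E 2 = E 1 ^ 2"
proof -
  have "qp 1 1 1 = qp 1 1 2 * qp 1 2 2"
    using qp_split[of 1 2 1 1] by (simp add: numeral_2_eq_2)
  moreover have "phim = qp 1 1 2 * qp 1 1 2 * E 2"
    unfolding phim_def using jacobi_triple_product[of 1 1 2] by simp
  ultimately show ?thesis by (simp add: E_eq_qp power2_eq_square ac_simps)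
qed

lemma phip_prod: "phip * (E 1 ^ 2 * E 4 ^ 2) = E 2 ^ 5"
proof -
  have "qp 1 1 1 = qp 1 1 2 * qp 1 2 2" "qp 1 2 2 = qp 1 2 4 * qp 1 4 4"
    using qp_split[of 1 2 1 1] qp_split[of 2 2 1 2] by (simp_all add: numeral_2_eq_2 eval_nat_numeral)
  then have 1: "E 1 = qp 1 1 2 * E 2" "E 2 = qp 1 2 4 * E 4" by (simp_all add: E_eq_qp)
  have 2: "qp (-1) 1 2 * qp 1 1 2 = qp 1 2 4"
    using qp_minus[of 2 1] by simp
  have 3: "phip = qp (-1) 1 2 * qp (-1) 1 2 * E 2"
    unfolding phip_def using jacobi_triple_product[of "-1" 1 2] by simp
  have "phip * (E 1 ^ 2 * E 4 ^ 2) = ((qp (-1) 1 2 * qp 1 1 2) * E 4) ^ 2 * E 2 ^ 3"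
    unfolding 3 1(1) by (simp add: power2_eq_square power3_eq_cube ac_simps)
  also have "\<dots> = E 2 ^ 5" unfolding 2 1(2)[symmetric] by (simp add: power_add [symmetric])
  finally show ?thesis .
qed

lemma qp_0: "b \<ge> 1 \<Longrightarrow> qp s 0 b = fps_const (1 - s) * qp s b b"
proof (rule sym, rule qp_eqI)
  fix N :: nat
  assume b: "b \<ge> 1" and "N \<ge> 1"
  then obtain n where N: "N = Suc n" by (cases N) auto
  have "eqm N (fps_const (1 - s) * qp s b b) (fps_const (1 - s) * qpn s b b n)"
    using b le_mult_self[OF b, of N] N by (intro eqm_mult eqm_refl eqm_qp) (auto simp: algebra_simps)
  also have "fps_const (1 - s) * qpn s b b n = qpn s 0 b N"
    unfolding qpn_def N by (subst prod.lessThan_Suc_shift) (simp add: fps_const_sub [symmetric] del: fps_const_sub)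
  finally show "eqm N (fps_const (1 - s) * qp s b b) (qpn s 0 b N)" .
qed simp

lemma psi_prod: "psi * E 1 = E 2 ^ 2"
proof -
  have "qp (-1) 1 1 * E 1 = E 2" using qp_minus[of 1 1] by (simp add: E_eq_qp)
  then have "(qp (-1) 1 1 * E 1) ^ 2 = E 2 ^ 2" by simp
  then show ?thesis by (simp add: psi_def power2_eq_square ac_simps)
qed

text \<open>The bilateral series meets every triangular number twice; on the product side the factor
  2 is \<open>1 + q ^ 0\<close>.\<close>

lemma psi_sum: "gs UNIV (sg (-1)) (te 1 0) = 2 * psi"
  using jacobi_triple_product[of "-1" 0 1] qp_0[of 1 "-1"]
  by (simp add: psi_def power2_eq_square ac_simps numeral_fps_const)

lemma euler_pentagonal: "gs UNIV (sg 1) (te 3 1) = E 1"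
proof -
  have "E 1 = (\<Prod>i<3. qp 1 (1 + i) 3)" using qp_split[of 1 3 1 1] by (simp add: E_eq_qp)
  also have "\<dots> = qp 1 1 3 * qp 1 2 3 * E 3" by (simp add: eval_nat_numeral E_eq_qp)
  finally show ?thesis using jacobi_triple_product[of 1 1 3] by simp
qed

text \<open>Splitting (-q; q) by residues modulo 5, the two theta functions share the residues 1 to
  4 and the residue 0 is E_10 / E_5.\<close>

lemma f23_f14_prod: "f23 * f14 * (E 1 * E 10) = E 2 * E 5 ^ 3"
proof -
  have "qp (-1) 1 1 = (\<Prod>i<5. qp (-1) (1 + i) 5)" using qp_split[of 1 5 "-1" 1] by simp
  also have "\<dots> = qp (-1) 1 5 * qp (-1) 2 5 * qp (-1) 3 5 * qp (-1) 4 5 * qp (-1) 5 5"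
    by (simp add: eval_nat_numeral)
  finally have 1: "qp (-1) 1 1 = qp (-1) 1 5 * qp (-1) 2 5 * qp (-1) 3 5 * qp (-1) 4 5 * qp (-1) 5 5" .
  have f: "f23 = qp (-1) 2 5 * qp (-1) 3 5 * E 5" "f14 = qp (-1) 1 5 * qp (-1) 4 5 * E 5"
    unfolding f23_def f14_def using jacobi_triple_product[of "-1" 2 5] jacobi_triple_product[of "-1" 1 5] by simp_all
  have "E 2 = qp (-1) 1 1 * E 1" and E10: "E 10 = qp (-1) 5 5 * E 5"
    using qp_minus[of 1 1] qp_minus[of 5 5] by (simp_all add: E_eq_qp)
  then have E2: "E 2 = qp (-1) 1 5 * qp (-1) 2 5 * qp (-1) 3 5 * qp (-1) 4 5 * qp (-1) 5 5 * E 1"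
    unfolding 1 by simp
  show ?thesis unfolding E2 E10 f by (simp only: power3_eq_cube ac_simps)
qed

section \<open>Logarithmic derivatives and Lambert series\<close>

text \<open>Logarithmic derivatives; \<open>Lam j\<close> below is minus that of \<open>E j\<close>.\<close>

definition ld :: "complex fps \<Rightarrow> complex fps \<Rightarrow> bool" where
  "ld f l \<longleftrightarrow> q * fps_deriv f = f * l"

lemma ld_mult: "ld f l \<Longrightarrow> ld g m \<Longrightarrow> ld (f * g) (l + m)"
proof -
  assume "ld f l" "ld g m"
  have "q * fps_deriv (f * g) = f * (q * fps_deriv g) + (q * fps_deriv f) * g" by (simp add: algebra_simps)
  also have "\<dots> = f * (g * m) + (f * l) * g" using \<open>ld f l\<close> \<open>ld g m\<close> by (simp only: ld_def)
  finally show ?thesis by (simp add: ld_def algebra_simps)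
qed

lemma ld_power: "ld f l \<Longrightarrow> ld (f ^ n) (of_nat n * l)"
proof (induction n)
  case (Suc n)
  then show ?case using ld_mult[of f l "f ^ n" "of_nat n * l"] by (simp add: algebra_simps)
qed (simp add: ld_def)

lemma ld_divide:
  assumes "ld (f * g) l" "ld g m" "g \<noteq> 0"
  shows "ld f (l - m)"
proof -
  have "q * fps_deriv (f * g) = f * (q * fps_deriv g) + (q * fps_deriv f) * g" by (simp add: algebra_simps)
  then have "(q * fps_deriv f) * g = q * fps_deriv (f * g) - f * (q * fps_deriv g)" by (simp only: add_diff_cancel_left')
  also have "\<dots> = (f * g) * l - f * (g * m)" using assms(1,2) by (simp only: ld_def)
  finally have "g * (q * fps_deriv f) = g * (f * (l - m))" by (simp add: algebra_simps)
  then show ?thesis using assms(3) by (simp add: ld_def)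
qed

definition Lam :: "nat \<Rightarrow> complex fps" where
  "Lam j = Abs_fps (\<lambda>n. if n = 0 then 0 else \<Sum>d | d dvd n \<and> j dvd d. of_nat d)"

definition geo :: "nat \<Rightarrow> complex fps" where
  "geo m = Abs_fps (\<lambda>n. if m dvd n then 1 else 0)"

lemma geo_inverse:
  assumes "m \<ge> 1"
  shows "(1 - q ^ m) * geo m = 1"
proof (rule fps_ext)
  fix n
  have "m dvd n \<longleftrightarrow> m dvd n - m" if "n \<ge> m"
    using that by (simp add: dvd_minus_self)
  moreover have "m dvd n \<longleftrightarrow> n = 0" if "n < m"
    using that by (auto dest: dvd_imp_le)
  ultimately show "fps_nth ((1 - q ^ m) * geo m) n = fps_nth 1 n"
    using assms by (auto simp: geo_def algebra_simps fps_X_power_mult_nth)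
qed

lemma lambert_nth:
  assumes "m \<ge> 1"
  shows "fps_nth (of_nat m * q ^ m * geo m) n = (if n > 0 \<and> m dvd n then of_nat m else 0)"
proof -
  have "of_nat m * q ^ m * geo m = fps_const (of_nat m) * (q ^ m * geo m)"
    by (simp only: fps_of_nat mult.assoc)
  then have "fps_nth (of_nat m * q ^ m * geo m) n = of_nat m * fps_nth (q ^ m * geo m) n"
    by (simp only: fps_mult_left_const_nth)
  moreover have "m dvd n \<longleftrightarrow> m dvd n - m" if "n \<ge> m"
    using that by (simp add: dvd_minus_self)
  moreover have "m dvd n \<longleftrightarrow> n = 0" if "n < m"
    using that by (auto dest: dvd_imp_le)
  ultimately show ?thesis using assms by (auto simp: geo_def fps_X_power_mult_nth)
qed

lemma eqm_theta: "eqm N f g \<Longrightarrow> eqm N (q * fps_deriv f) (q * fps_deriv g)"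
  unfolding eqm_def
proof (intro allI impI)
  fix n assume "\<forall>n<N. fps_nth f n = fps_nth g n" "n < N"
  then show "fps_nth (q * fps_deriv f) n = fps_nth (q * fps_deriv g) n"
    by (cases n) auto
qed

text \<open>The factor 1 - q^m has logarithmic derivative -m q^m / (1 - q^m). In degree n > 0 it
  contributes -m exactly when m divides n.\<close>

lemma ld_E:
  assumes "j \<ge> 1"
  shows "ld (E j) (- Lam j)"
  unfolding ld_def
proof (rule eqm_eqI)
  fix N
  define lam where "lam k = of_nat (j + j * k) * q ^ (j + j * k) * geo (j + j * k)" for k
  have *: "ld (1 - q ^ m) (- (of_nat m * q ^ m * geo m))" if "m \<ge> 1" for m
  proof -
    have "q * fps_deriv (1 - q ^ m) = - (of_nat m * (q * q ^ (m - 1)))"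
      by (simp add: fps_deriv_power fps_of_nat)
    also have "q * q ^ (m - 1) = q ^ m" using that by (cases m) auto
    finally have "q * fps_deriv (1 - q ^ m) = - (of_nat m * q ^ m) * ((1 - q ^ m) * geo m)"
      unfolding geo_inverse[OF that] by simp
    then show ?thesis unfolding ld_def by (simp only: ac_simps mult_minus_left mult_minus_right)
  qed
  have l: "ld (1 - q ^ (j + j * k)) (- lam k)" for k
    unfolding lam_def by (rule *) (use assms in simp)
  have "ld (qpn 1 j j N) (- (\<Sum>k<N. lam k))" for N
  proof (induction N)
    case 0
    then show ?case by (simp add: ld_def qpn_def)
  next
    case (Suc N)
    then show ?case using ld_mult[OF Suc l[of N]] by (simp add: qpn_Suc)
  qed
  moreover have "eqm N (\<Sum>k<N. lam k) (Lam j)"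
    unfolding eqm_def
  proof (intro allI impI)
    fix n assume n: "n < N"
    have "fps_nth (\<Sum>k<N. lam k) n = (\<Sum>k<N. if n > 0 \<and> (j + j * k) dvd n then of_nat (j + j * k) else 0)"
      unfolding fps_sum_nth lam_def using assms by (intro sum.cong lambert_nth) auto
    also have "\<dots> = (\<Sum>k\<in>{k \<in> {..<N}. n > 0 \<and> (j + j * k) dvd n}. of_nat (j + j * k))"
      by (simp add: sum.If_cases Int_def)
    also have "\<dots> = fps_nth (Lam j) n"
    proof (cases "n = 0")
      case False
      have "(\<Sum>k\<in>{k \<in> {..<N}. n > 0 \<and> (j + j * k) dvd n}. of_nat (j + j * k)) = (\<Sum>d | d dvd n \<and> j dvd d. (of_nat d :: complex))"
      proof (rule sum.reindex_bij_witness[of _ "\<lambda>d. d div j - 1" "\<lambda>k. j + j * k"])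
        fix d assume d: "d \<in> {d. d dvd n \<and> j dvd d}"
        then obtain m where m: "d = j * m" by auto
        have "d > 0" "d \<le> n" using d False by (auto intro: dvd_imp_le simp: dvd_pos_nat)
        then obtain i where i: "m = Suc i" using m by (cases m) auto
        have "i < N"
          using \<open>d \<le> n\<close> n le_mult_self[OF assms, of m] unfolding m i by simp
        then show "d div j - 1 \<in> {k \<in> {..<N}. n > 0 \<and> (j + j * k) dvd n}" "j + j * (d div j - 1) = d"
          using d False assms unfolding m i by auto
      qed (use assms in auto)
      then show ?thesis using False by (simp add: Lam_def)
    qed (simp add: Lam_def)
    finally show "fps_nth (\<Sum>k<N. lam k) n = fps_nth (Lam j) n" .
  qed
  moreover have E: "eqm N (E j) (qpn 1 j j N)"
    unfolding E_eq_qp[OF assms] using assms le_mult_self[OF assms, of N] by (intro eqm_qp trans_le_add2)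
  ultimately show "eqm N (q * fps_deriv (E j)) (E j * - Lam j)"
  proof -
    assume l: "\<And>N. ld (qpn 1 j j N) (- (\<Sum>k<N. lam k))" and s: "eqm N (\<Sum>k<N. lam k) (Lam j)"
    have "eqm N (q * fps_deriv (E j)) (q * fps_deriv (qpn 1 j j N))" by (rule eqm_theta[OF E])
    also have "q * fps_deriv (qpn 1 j j N) = qpn 1 j j N * (0 - (\<Sum>k<N. lam k))" using l by (simp add: ld_def)
    also have "eqm N \<dots> (E j * (0 - Lam j))" by (intro eqm_mult eqm_diff eqm_refl s eqm_sym[OF E])
    finally show ?thesis by simp
  qed
qed

text \<open>The left-hand side is a sum over pairs \<open>(i, j)\<close>. Those with \<open>i + j\<close> even cancel under \<open>(i, j) \<mapsto> (j, i)\<close>; for the others \<open>i = u + v + 1\<close>, \<open>j = u - v\<close> factors the sum into two copies of Jacobi's cube series.\<close>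

lemma phi_theta_diff: "q * fps_deriv phip * phim - phip * (q * fps_deriv phim) = 4 * q * E 4 ^ 6"
proof -
  let ?U = "UNIV \<times> UNIV :: (int \<times> int) set"
  define e where "e = (\<lambda>(i, j). te 2 1 i + te 2 1 j)"
  define D where "D = (\<lambda>(i, j). (of_int (i * i - j * j) * sg 1 j))"
  have fin: "fin_below A (te 2 1)" for A by (rule fin_below_te) auto
  have te: "of_nat (te 2 1 i) = (of_int (i * i) :: complex)" for i
    unfolding int_te_2_1 [symmetric] by simp
  have "q * fps_deriv phip * phim - phip * (q * fps_deriv phim) = gs ?U D e"
    unfolding phip_def phim_def gs_theta
    by (subst (1 2) gs_mult[OF fin fin], subst gs_diff [symmetric])
       (auto intro!: gs_cong simp: D_def e_def te[unfolded One_nat_def] sg_def algebra_simps simp del: of_int_mult)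
  also have "?U = {(i, j). even (i + j)} \<union> {(i, j). odd (i + j)}" by auto
  also have "gs \<dots> D e = gs {(i, j). even (i + j)} D e + gs {(i, j). odd (i + j)} D e"
  proof (rule gs_Un)
    have "fin_below ?U e" unfolding e_def by (intro fin_below_Times fin)
    then show "fin_below ({(i, j). even (i + j)} \<union> {(i, j). odd (i + j)}) e"
      by (rule fin_below_subset) auto
  qed auto
  also have "gs {(i, j). even (i + j)} D e = 0"
  proof -
    let ?A = "{(i, j). even (i + j)} :: (int \<times> int) set"
    have "gs ?A D e = gs ?A (\<lambda>x. D (prod.swap x)) (\<lambda>x. e (prod.swap x))"
      by (rule gs_reindex) (auto simp: bij_betw_def inj_on_def image_def add.commute)
    also have "\<dots> = gs ?A (\<lambda>x. - 1 * D x) e"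
      by (rule gs_cong) (auto simp: D_def e_def sg_def algebra_simps)
    also have "\<dots> = - gs ?A D e" unfolding gs_cmult by (simp add: fps_const_neg [symmetric] del: fps_const_neg)
    finally have "2 * gs ?A D e = 0" by simp
    then show ?thesis by simp
  qed
  \<comment> \<open>With i = u + v + 1 and j = u - v one has i^2 + j^2 = 2 u (u + 1) + 2 v (v + 1) +
    1 and i^2 - j^2 = (2 u + 1) (2 v + 1), so exponent and weight both separate.\<close>
  also have "gs {(i, j). odd (i + j)} D e = q * (gs UNIV (\<lambda>u. of_int (2 * u + 1) * sg 1 u) (\<lambda>u. 4 * te 1 0 (- u))) ^ 2"
  proof -
    let ?h = "\<lambda>(u, v). (u + v + 1, u - v) :: int \<times> int"
    let ?c = "\<lambda>u. of_int (2 * u + 1) * sg 1 u" and ?e = "\<lambda>u. 4 * te 1 0 (- u)"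
    have bij: "bij_betw ?h ?U {(i, j). odd (i + j)}"
    proof (rule bij_betw_byWitness[of _ "\<lambda>(i, j). ((i + j - 1) div 2, (i - j - 1) div 2)"])
      show "\<forall>a'\<in>{(i, j). odd (i + j)}. ?h (case a' of (i, j) \<Rightarrow> ((i + j - 1) div 2, (i - j - 1) div 2)) = a'"
      proof
        fix x :: "int \<times> int" assume "x \<in> {(i, j). odd (i + j)}"
        then obtain i j where x: "x = (i, j)" and "odd (i + j)" by blast
        then obtain m where m: "i + j = 2 * m + 1" using oddE by blast
        then have "i + j - 1 = 2 * m" "i - j - 1 = 2 * (m - j)" "i = 2 * m + 1 - j" by simp_all
        then show "?h (case x of (i, j) \<Rightarrow> ((i + j - 1) div 2, (i - j - 1) div 2)) = x"
          unfolding x prod.case by (simp only: nonzero_mult_div_cancel_left) simp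
      qed
    qed auto
    have int_e: "int (te 1 0 (- u)) * 2 = u * (u + 1)" for u
      using two_te[of 0 1 "- u"] by (simp add: algebra_simps)
    have "gs {(i, j). odd (i + j)} D e = gs ?U (\<lambda>x. D (?h x)) (\<lambda>x. e (?h x))"
      by (rule gs_reindex[OF bij])
    also have "\<dots> = gs ?U (\<lambda>(u, v). ?c u * ?c v) (\<lambda>x. (case x of (u, v) \<Rightarrow> ?e u + ?e v) + 1)"
    proof (rule gs_cong; clarify)
      fix u v :: int
      have "sg 1 (u - v) = sg 1 u * sg 1 v" by (simp add: sg_def)
      moreover have "(u + v + 1) * (u + v + 1) - (u - v) * (u - v) = (2 * u + 1) * (2 * v + 1)" by (simp add: algebra_simps)
      ultimately show "D (u + v + 1, u - v) = ?c u * ?c v"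
        unfolding D_def by (simp only: prod.case of_int_mult) simp
      have "int (e (u + v + 1, u - v)) = int (?e u + ?e v + 1)"
        using int_e[of u] int_e[of v] by (simp add: e_def int_te_2_1[unfolded One_nat_def] algebra_simps)
      then show "e (u + v + 1, u - v) = ?e u + ?e v + 1" by linarith
    qed
    also have "\<dots> = q ^ 1 * gs ?U (\<lambda>(u, v). ?c u * ?c v) (\<lambda>(u, v). ?e u + ?e v)"
      by (rule gs_shift)
    also have "gs ?U (\<lambda>(u, v). ?c u * ?c v) (\<lambda>(u, v). ?e u + ?e v) = gs UNIV ?c ?e * gs UNIV ?c ?e"
    proof (rule gs_mult [symmetric])
      have *: "\<bar>u\<bar> \<le> int (?e u) + 1" for u using te_ge'[of 0 1 "- u"] by simp
      show "fin_below UNIV ?e" by (rule fin_below_int) (rule *)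
      then show "fin_below UNIV ?e" .
    qed
    finally show ?thesis by (simp add: power2_eq_square)
  qed
  also have "gs UNIV (\<lambda>u. of_int (2 * u + 1) * sg 1 u) (\<lambda>u. 4 * te 1 0 (- u)) = 2 * E 4 ^ 3"
  proof -
    have "gs UNIV (\<lambda>u. of_int (1 - 2 * u) * sg 1 u) (\<lambda>u. 4 * te 1 0 u) =
        gs UNIV (\<lambda>u. of_int (1 - 2 * (- u)) * sg 1 (- u)) (\<lambda>u. 4 * te 1 0 (- u))"
      by (rule gs_reindex) (auto intro: bij_uminus)
    also have "\<dots> = gs UNIV (\<lambda>u. of_int (2 * u + 1) * sg 1 u) (\<lambda>u. 4 * te 1 0 (- u))"
      by (rule gs_cong) (auto simp: sg_def)
    finally have "gs UNIV (\<lambda>u. of_int (2 * u + 1) * sg 1 u) (\<lambda>u. 4 * te 1 0 (- u)) =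
        gs UNIV (\<lambda>u. of_int (1 - 2 * u) * sg 1 u) (\<lambda>u. 4 * te 1 0 u)" by (rule sym)
    also have "\<dots> = fps_compose (2 * E 1 ^ 3) (q ^ 4)"
      unfolding jacobi_cube [symmetric] by (rule gs_scale) simp
    finally have "gs UNIV (\<lambda>u. of_int (2 * u + 1) * sg 1 u) (\<lambda>u. 4 * te 1 0 (- u)) = fps_compose (2 * E 1 ^ 3) (q ^ 4)" .
    then show ?thesis using E_compose[of 4 1]
      by (simp add: fps_compose_mult_distrib compose_X_power_hom)
  qed
  finally show ?thesis by (simp add: power_mult_distrib power_mult [symmetric] algebra_simps)
qed

section \<open>Sections modulo m, and divisor sums of odd numbers\<close>

definition sec :: "nat \<Rightarrow> nat \<Rightarrow> complex fps \<Rightarrow> complex fps" where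
  "sec m i f = Abs_fps (\<lambda>n. fps_nth f (m * n + i))"

lemma sec_add: "sec m i (f + g) = sec m i f + sec m i g"
  by (rule fps_ext) (simp add: sec_def)

lemma sec_mult:
  assumes "m \<ge> 1" "i < m"
  shows "sec m i (fps_compose f (q ^ m) * g) = f * sec m i g"
proof (rule fps_ext)
  fix n
  have "fps_nth (sec m i (fps_compose f (q ^ m) * g)) n =
      (\<Sum>k\<in>{0..m * n + i}. if m dvd k then fps_nth f (k div m) * fps_nth g (m * n + i - k) else 0)"
    using assms by (auto simp: sec_def fps_mult_nth compose_X_power_nth intro!: sum.cong)
  also have "\<dots> = (\<Sum>k\<in>{k \<in> {0..m * n + i}. m dvd k}. fps_nth f (k div m) * fps_nth g (m * n + i - k))"
    by (subst sum.If_cases) (auto simp: Int_def intro!: sum.cong)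
  also have "\<dots> = (\<Sum>k=0..n. fps_nth f k * fps_nth g (m * (n - k) + i))"
  proof (rule sum.reindex_bij_witness[of _ "\<lambda>k. m * k" "\<lambda>k. k div m"])
    fix k assume k: "k \<in> {k \<in> {0..m * n + i}. m dvd k}"
    then obtain l where l: "k = m * l" by auto
    have "m * l < m * Suc n" using k l assms by simp
    then have "l \<le> n" unfolding mult_less_cancel1 by simp
    then show "k div m \<in> {0..n}" using l assms by simp
    show "fps_nth f (k div m) * fps_nth g (m * (n - k div m) + i) = fps_nth f (k div m) * fps_nth g (m * n + i - k)"
      using \<open>l \<le> n\<close> l assms by (simp add: diff_mult_distrib2)
  qed (use assms in \<open>auto intro: trans_le_add1\<close>)
  also have "\<dots> = fps_nth (f * sec m i g) n" by (simp add: fps_mult_nth sec_def)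
  finally show "fps_nth (sec m i (fps_compose f (q ^ m) * g)) n = fps_nth (f * sec m i g) n" .
qed

text \<open>\<open>M\<close> is the logarithmic derivative of \<open>phip / phim\<close>, hence an
  eta quotient by \<open>phi_theta_diff\<close>. In odd degrees \<open>Lam 2\<close> and
  \<open>Lam 4\<close> vanish, and \<open>M\<close> is four times the sum of divisors.\<close>

theorem divisor_sum_odd:
  "E 1 ^ 4 * Abs_fps (\<lambda>n. \<Sum>d | d dvd 2 * n + 1. of_nat d) = E 2 ^ 8"
proof -
  define M where "M = 4 * Lam 1 - 6 * Lam 2 + 2 * Lam 4"
  have ldE: "ld (E 1) (- Lam 1)" "ld (E 2) (- Lam 2)" "ld (E 4) (- Lam 4)" by (simp_all add: ld_E)
  have nz: "E 1 \<noteq> 0" "E 2 \<noteq> 0" "E 4 \<noteq> 0" by (simp_all add: E_nonzero)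
  have "ld (phim * E 2) (of_nat 2 * - Lam 1)" unfolding phim_prod by (intro ld_power ldE)
  from ld_divide[OF this ldE(2) nz(2)] have m: "ld phim (of_nat 2 * - Lam 1 - - Lam 2)" .
  have "ld (phip * (E 1 ^ 2 * E 4 ^ 2)) (of_nat 5 * - Lam 2)" unfolding phip_prod by (intro ld_power ldE)
  moreover have "ld (E 1 ^ 2 * E 4 ^ 2) (of_nat 2 * - Lam 1 + of_nat 2 * - Lam 4)" by (intro ld_mult ld_power ldE)
  ultimately have "ld phip (of_nat 5 * - Lam 2 - (of_nat 2 * - Lam 1 + of_nat 2 * - Lam 4))"
    by (rule ld_divide) (use nz in simp)
  then have "q * fps_deriv phip * phim - phip * (q * fps_deriv phim) = phip * phim * M"
    using m by (simp only: ld_def M_def) (simp add: algebra_simps)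
  then have 1: "phip * phim * M = 4 * q * E 4 ^ 6" unfolding phi_theta_diff by simp
  \<comment> \<open>This is phi(q) phi(-q) = phi(-q^2)^2 in terms of products.\<close>
  have 2: "phip * phim * E 4 ^ 2 = E 2 ^ 4"
  proof -
    have "E 2 * (phip * phim * E 4 ^ 2) = phip * (phim * E 2) * E 4 ^ 2" by (simp only: ac_simps)
    also have "\<dots> = phip * (E 1 ^ 2 * E 4 ^ 2)" unfolding phim_prod by (simp only: ac_simps)
    also have "\<dots> = E 2 * E 2 ^ 4" unfolding phip_prod by (simp flip: power_Suc)
    finally show ?thesis using nz by simp
  qed
  have "E 2 ^ 4 * M = E 4 ^ 2 * (phip * phim * M)" unfolding 2 [symmetric] by (simp only: ac_simps)
  also have "\<dots> = E 4 ^ 8 * (4 * q)" unfolding 1 by (simp add: power_add [symmetric] ac_simps)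
  finally have "sec 2 1 (E 2 ^ 4 * M) = sec 2 1 (E 4 ^ 8 * (4 * q))" by simp
  moreover have "E 2 ^ 4 = fps_compose (E 1 ^ 4) (q ^ 2)" "E 4 ^ 8 = fps_compose (E 2 ^ 8) (q ^ 2)"
    using E_compose[of 2 1] E_compose[of 2 2] by (simp_all add: compose_X_power_hom)
  ultimately have "E 1 ^ 4 * sec 2 1 M = E 2 ^ 8 * sec 2 1 (4 * q)" by (simp add: sec_mult)
  moreover have "sec 2 1 (4 * q) = 4"
    by (rule fps_ext) (auto simp: sec_def numeral_fps_const)
  moreover have "sec 2 1 M = 4 * Abs_fps (\<lambda>n. \<Sum>d | d dvd 2 * n + 1. of_nat d)"
  proof (rule fps_ext)
    fix n :: nat
    have "odd d" if "d dvd 2 * n + 1" for d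
      using that dvd_trans[of 2 d "2 * n + 1"] by auto
    then have 2: "{d. d dvd 2 * n + 1 \<and> 2 dvd d} = {}" by blast
    moreover have "2 dvd d" if "4 dvd d" for d :: nat using that by presburger
    ultimately have 4: "{d. d dvd 2 * n + 1 \<and> 4 dvd d} = {}" by auto
    have "fps_nth (Lam 4) (2 * n + 1) = 0" "fps_nth (Lam 2) (2 * n + 1) = 0"
      unfolding Lam_def fps_nth_Abs_fps 2 4 by simp_all
    moreover have "fps_nth (Lam 1) (2 * n + 1) = (\<Sum>d | d dvd 2 * n + 1. of_nat d)"
      by (simp add: Lam_def)
    ultimately show "fps_nth (sec 2 1 M) n = fps_nth (4 * Abs_fps (\<lambda>n. \<Sum>d | d dvd 2 * n + 1. of_nat d)) n"
      unfolding sec_def M_def by (simp only: fps_nth_Abs_fps fps_add_nth fps_sub_nth numeral_fps_const fps_mult_left_const_nth) simp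
  qed
  ultimately have "4 * (E 1 ^ 4 * Abs_fps (\<lambda>n. \<Sum>d | d dvd 2 * n + 1. of_nat d)) = 4 * E 2 ^ 8"
    by (simp add: ac_simps)
  then show ?thesis by (simp only: mult_cancel_left) simp
qed

section \<open>The generating function on odd arguments\<close>

definition bounded_parts :: "nat set \<Rightarrow> nat \<Rightarrow> nat multiset set" where
  "bounded_parts S n = {P. set_mset P \<subseteq> S \<and> sum_mset P = n}"

lemma finite_bounded_parts: "0 \<notin> S \<Longrightarrow> finite (bounded_parts S n)"
  by (rule finite_subset[OF _ finite_partitions_of[of n]]) (auto simp: bounded_parts_def partitions_of_def)

text \<open>Partitions are classified by the multiplicity c of m; removing the c copies is a
  bijection onto partitions with parts in S.\<close>

lemma sum_bounded_parts_insert: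
  fixes w :: "nat \<Rightarrow> complex"
  assumes "0 \<notin> S" "m \<notin> S" "m > 0"
  shows "(\<Sum>P\<in>bounded_parts (insert m S) n. w (count P m)) =
    (\<Sum>c\<in>{c \<in> {..n}. m * c \<le> n}. w c * of_nat (card (bounded_parts S (n - m * c))))"
proof -
  let ?C = "{c \<in> {..n}. m * c \<le> n}"
  let ?B = "bounded_parts (insert m S) n"
  have "(\<Sum>P\<in>?B. w (count P m)) = (\<Sum>c\<in>?C. \<Sum>P\<in>{P \<in> ?B. count P m = c}. w (count P m))"
  proof (rule sum.group [symmetric])
    show "finite ?B" using assms by (intro finite_bounded_parts) auto
    show "(\<lambda>P. count P m) ` ?B \<subseteq> ?C"
    proof safe
      fix P assume P: "P \<in> ?B"
      have "replicate_mset (count P m) m \<subseteq># P" by (simp add: count_le_replicate_mset_subset_eq [symmetric])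
      then obtain P' where "P = replicate_mset (count P m) m + P'" by (metis subset_mset.le_iff_add)
      then have "sum_mset P = count P m * m + sum_mset P'"
        by (metis sum_mset.union sum_mset_replicate_mset of_nat_id)
      then show "m * count P m \<le> n" using P by (simp add: bounded_parts_def mult.commute)
      moreover have "count P m \<le> m * count P m" using assms(3) by simp
      ultimately show "count P m \<le> n" by linarith
    qed
  qed simp
  also have "\<dots> = (\<Sum>c\<in>?C. w c * of_nat (card (bounded_parts S (n - m * c))))"
  proof (rule sum.cong)
    fix c assume c: "c \<in> ?C"
    have "bij_betw (\<lambda>P. P + replicate_mset c m) (bounded_parts S (n - m * c)) {P \<in> ?B. count P m = c}"
    proof (rule bij_betw_byWitness[of _ "\<lambda>P. P - replicate_mset c m"])
      show "\<forall>P\<in>{P \<in> ?B. count P m = c}. P - replicate_mset c m + replicate_mset c m = P"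
        by (auto intro!: subset_mset.diff_add simp: count_le_replicate_mset_subset_eq [symmetric])
      show "(\<lambda>P. P + replicate_mset c m) ` bounded_parts S (n - m * c) \<subseteq> {P \<in> ?B. count P m = c}"
      proof safe
        fix P assume P: "P \<in> bounded_parts S (n - m * c)"
        then have "m \<notin># P" using assms by (auto simp: bounded_parts_def)
        then show "count (P + replicate_mset c m) m = c" by (simp add: not_in_iff)
        show "P + replicate_mset c m \<in> ?B" using P c
          by (auto simp: bounded_parts_def mult.commute split: if_splits)
      qed
      show "(\<lambda>P. P - replicate_mset c m) ` {P \<in> ?B. count P m = c} \<subseteq> bounded_parts S (n - m * c)"
      proof safe
        fix P assume P: "P \<in> ?B" "c = count P m"
        define P' where "P' = P - replicate_mset c m"
        have "P = P' + replicate_mset c m"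
          unfolding P'_def using P(2) by (auto intro!: subset_mset.diff_add[symmetric] simp: count_le_replicate_mset_subset_eq [symmetric])
        moreover have "m \<notin># P'" unfolding P'_def using P(2) by (simp add: not_in_iff)
        ultimately have "P' \<in> bounded_parts S (n - m * c)"
          using P(1) by (auto simp: bounded_parts_def mult.commute)
        then show "P - replicate_mset (count P m) m \<in> bounded_parts S (n - m * count P m)"
          unfolding P'_def P(2) .
      qed
    qed simp
    then have "card {P \<in> ?B. count P m = c} = card (bounded_parts S (n - m * c))"
      by (rule bij_betw_same_card [symmetric])
    then show "(\<Sum>P\<in>{P \<in> ?B. count P m = c}. w (count P m)) = w c * of_nat (card (bounded_parts S (n - m * c)))"
      by simp
  qed simp
  finally show ?thesis .
qed

text \<open>The factor of a generating function contributed by the part \<open>m\<close> when \<open>c\<close> copies of it have weight \<open>w c\<close>.\<close>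

definition wgen :: "(nat \<Rightarrow> complex) \<Rightarrow> nat \<Rightarrow> complex fps" where
  "wgen w m = Abs_fps (\<lambda>n. if m dvd n then w (n div m) else 0)"

definition parts_gf :: "nat set \<Rightarrow> complex fps" where
  "parts_gf S = Abs_fps (\<lambda>n. of_nat (card (bounded_parts S n)))"

lemma wgen_parts_gf_nth:
  assumes "0 \<notin> S" "m \<notin> S" "m > 0"
  shows "fps_nth (wgen w m * parts_gf S) n = (\<Sum>P\<in>bounded_parts (insert m S) n. w (count P m))"
proof -
  have "fps_nth (wgen w m * parts_gf S) n =
      (\<Sum>k\<in>{0..n}. if m dvd k then w (k div m) * of_nat (card (bounded_parts S (n - k))) else 0)"
    by (auto simp: fps_mult_nth wgen_def parts_gf_def intro!: sum.cong)
  also have "\<dots> = (\<Sum>k\<in>{k \<in> {0..n}. m dvd k}. w (k div m) * of_nat (card (bounded_parts S (n - k))))"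
    by (subst sum.If_cases) (auto simp: Int_def intro!: sum.cong)
  also have "\<dots> = (\<Sum>c\<in>{c \<in> {..n}. m * c \<le> n}. w c * of_nat (card (bounded_parts S (n - m * c))))"
    by (rule sum.reindex_bij_witness[of _ "\<lambda>c. m * c" "\<lambda>k. k div m"])
       (use assms(3) in \<open>auto intro: order_trans[OF div_le_dividend]\<close>)
  finally show ?thesis using sum_bounded_parts_insert[OF assms] by simp
qed

lemma parts_gf_eq_prod:
  assumes "finite S" "0 \<notin> S"
  shows "parts_gf S = (\<Prod>j\<in>S. geo j)"
  using assms
proof (induction S rule: finite_induct)
  case empty
  have "bounded_parts {} n = (if n = 0 then {{#}} else {})" for n
    by (auto simp: bounded_parts_def)
  then show ?case by (intro fps_ext) (simp add: parts_gf_def)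
next
  case (insert m S)
  have "parts_gf (insert m S) = wgen (\<lambda>_. 1) m * parts_gf S"
    by (rule fps_ext, subst wgen_parts_gf_nth) (use insert in \<open>auto simp: parts_gf_def\<close>)
  then show ?case using insert by (simp add: wgen_def geo_def)
qed

lemma wgen_of_nat:
  assumes "m \<ge> 1"
  shows "(1 - q ^ m) ^ 2 * wgen of_nat m = q ^ m"
proof -
  have "(1 - q ^ m) * wgen of_nat m = q ^ m * geo m"
  proof (rule fps_ext)
    fix n
    show "fps_nth ((1 - q ^ m) * wgen of_nat m) n = fps_nth (q ^ m * geo m) n"
    proof (cases "n < m")
      case True
      then have "m dvd n \<longleftrightarrow> n = 0" by (auto dest: dvd_imp_le)
      then show ?thesis using True by (simp add: wgen_def geo_def algebra_simps fps_X_power_mult_nth)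
    next
      case False
      then have "m dvd n - m \<longleftrightarrow> m dvd n" by (simp add: dvd_minus_self)
      moreover have "n div m = Suc ((n - m) div m)" using False assms by (simp add: le_div_geq)
      ultimately show ?thesis using False by (simp add: wgen_def geo_def algebra_simps fps_X_power_mult_nth)
    qed
  qed
  then have "(1 - q ^ m) * ((1 - q ^ m) * wgen of_nat m) = q ^ m * ((1 - q ^ m) * geo m)" by (simp only: ac_simps)
  then show ?thesis unfolding geo_inverse[OF assms] by (simp add: power2_eq_square ac_simps)
qed

text \<open>The parts other than the smallest part \<open>m\<close>, cut off at \<open>K\<close> to make the set finite.\<close>

definition spt_parts :: "nat \<Rightarrow> nat \<Rightarrow> nat set" where
  "spt_parts K m = {j. m < j \<and> j \<le> K \<and> (odd j \<longrightarrow> j < 2 * m)}"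

text \<open>For fixed m the sum may run over all partitions into parts from
  \<open>insert m (spt_parts K m)\<close>: those without m have weight 0, and the others have
  smallest part m. The cutoff \<open>K\<close> is invisible in degrees up to
  \<open>K\<close>.\<close>

lemma spt_omega_eq_sum:
  assumes "n \<le> N" "n \<le> K"
  shows "of_nat (spt_omega n) = (\<Sum>m=1..N. fps_nth (wgen of_nat m * parts_gf (spt_parts K m)) n)"
proof -
  let ?A = "{P. P \<in> partitions_of n \<and> (\<forall>p\<in>#P. odd p \<longrightarrow> p < 2 * smallest_part P)}"
  let ?A' = "{P \<in> ?A. P \<noteq> {#}}"
  have fin: "finite ?A" "finite ?A'"
    using finite_partitions_of[of n] by (auto intro: finite_subset)
  have le: "p \<le> n" if "p \<in># P" "sum_mset P = n" for p :: nat and P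
    using that by (metis insert_DiffM le_add1 sum_mset.add_mset)
  have smallest: "smallest_part P \<in># P" "p \<in># P \<Longrightarrow> smallest_part P \<le> p" if "P \<noteq> {#}" for P p
    using that unfolding smallest_part_def by (auto intro: Min_in)
  have "spt_omega n = (\<Sum>P\<in>?A'. count P (smallest_part P))"
    unfolding spt_omega_def using fin(1) by (intro sum.mono_neutral_right) auto
  also have "\<dots> = (\<Sum>m=1..N. \<Sum>P\<in>{P \<in> ?A'. smallest_part P = m}. count P (smallest_part P))"
  proof (rule sum.group [symmetric])
    show "smallest_part ` ?A' \<subseteq> {1..N}"
    proof safe
      fix P assume P: "P \<in> partitions_of n" "P \<noteq> {#}"
      then have "smallest_part P \<in># P" using smallest by blast
      then have "smallest_part P \<noteq> 0" "smallest_part P \<le> n" using P le by (auto simp: partitions_of_def intro!: gr0I)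
      then show "smallest_part P \<in> {1..N}" using assms by simp
    qed
  qed (use fin in simp_all)
  finally have "of_nat (spt_omega n) = (\<Sum>m=1..N. \<Sum>P\<in>{P \<in> ?A'. smallest_part P = m}. (of_nat (count P (smallest_part P)) :: complex))"
    by simp
  also have "\<dots> = (\<Sum>m=1..N. fps_nth (wgen of_nat m * parts_gf (spt_parts K m)) n)"
  proof (rule sum.cong)
    fix m assume m: "m \<in> {1..N}"
    let ?B = "bounded_parts (insert m (spt_parts K m)) n"
    have "fps_nth (wgen of_nat m * parts_gf (spt_parts K m)) n = (\<Sum>P\<in>?B. of_nat (count P m))"
      using m by (intro wgen_parts_gf_nth) (auto simp: spt_parts_def)
    also have "\<dots> = (\<Sum>P\<in>{P \<in> ?A'. smallest_part P = m}. of_nat (count P m))"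
    proof (rule sum.mono_neutral_right)
      show "finite ?B" using m by (intro finite_bounded_parts) (auto simp: spt_parts_def)
      show "{P \<in> ?A'. smallest_part P = m} \<subseteq> ?B"
      proof
        fix P assume P: "P \<in> {P \<in> ?A'. smallest_part P = m}"
        have "p \<in> insert m (spt_parts K m)" if p: "p \<in># P" for p
        proof -
          have "m \<le> p" "p \<le> n" "odd p \<longrightarrow> p < 2 * m"
            using P p smallest(2)[of P p] le[of p P] by (auto simp: partitions_of_def)
          then show ?thesis using assms by (auto simp: spt_parts_def)
        qed
        then show "P \<in> ?B" using P by (auto simp: bounded_parts_def partitions_of_def)
      qed
      show "\<forall>P\<in>?B - {P \<in> ?A'. smallest_part P = m}. of_nat (count P m) = (0 :: complex)"
      proof (rule ballI, rule ccontr)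
        fix P assume P: "P \<in> ?B - {P \<in> ?A'. smallest_part P = m}" and "of_nat (count P m) \<noteq> (0 :: complex)"
        then have "m \<in># P" by (auto simp: not_in_iff)
        moreover have sub: "set_mset P \<subseteq> insert m (spt_parts K m)" "sum_mset P = n" using P by (auto simp: bounded_parts_def)
        ultimately have "smallest_part P = m"
          unfolding smallest_part_def by (intro Min_eqI) (auto simp: spt_parts_def)
        moreover have "\<forall>p\<in>#P. odd p \<longrightarrow> p < 2 * m" using sub m by (auto simp: spt_parts_def)
        moreover have "P \<in> partitions_of n" using sub m by (auto simp: partitions_of_def spt_parts_def)
        ultimately show False using P \<open>m \<in># P\<close> by auto
      qed
    qed
    also have "\<dots> = (\<Sum>P\<in>{P \<in> ?A'. smallest_part P = m}. of_nat (count P (smallest_part P)))"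
      by (rule sum.cong) auto
    finally show "(\<Sum>P\<in>{P \<in> ?A'. smallest_part P = m}. of_nat (count P (smallest_part P))) =
        fps_nth (wgen of_nat m * parts_gf (spt_parts K m)) n" by simp
  qed simp
  finally show ?thesis .
qed

section \<open>The Bailey pair of the smallest-part sums\<close>

abbreviation Q :: "nat \<Rightarrow> complex fps" where "Q n \<equiv> qpn 1 1 1 n"

lemma Q_Suc: "Q (Suc n) = Q n * (1 - q ^ Suc n)"
  by (simp add: qpn_Suc)

text \<open>\<open>(alpha, beta)\<close> is a Bailey pair relative to \<open>1\<close> in which only the even-indexed \<open>alpha\<close> occur, see \<open>beta_eq_sum\<close>.\<close>

definition beta :: "nat \<Rightarrow> complex fps" where
  "beta m = qpn 1 2 2 m * inverse (Q m) * inverse (Q (2 * m))"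

text \<open>The parts allowed above m are m + 1, ..., 2 m and the even numbers 2 m + 2, ..., 2 N.
  The factor \<open>qpn 1 2 2 N\<close> cancels the latter and leaves \<open>qpn 1 2 2 m\<close>;
  the former contribute (q)_m / (q)_2m.\<close>

lemma qpn_even_parts:
  assumes "1 \<le> m" "m \<le> N"
  shows "qpn 1 2 2 N * (wgen of_nat m * parts_gf (spt_parts (2 * N) m)) = q ^ m * Q (m - 1) ^ 2 * beta m"
proof -
  let ?f = "\<lambda>j. 1 - q ^ j"
  have S: "spt_parts (2 * N) m = {m<..2 * m} \<union> (\<lambda>k. 2 + 2 * k) ` {m..<N}"
  proof (intro equalityI subsetI)
    fix j assume j: "j \<in> spt_parts (2 * N) m"
    show "j \<in> {m<..2 * m} \<union> (\<lambda>k. 2 + 2 * k) ` {m..<N}"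
    proof (cases "j \<le> 2 * m")
      case False
      then obtain i where i: "j = 2 * i" using j by (auto simp: spt_parts_def)
      have "j = 2 + 2 * (i - 1)" "i - 1 \<in> {m..<N}" using i j False by (auto simp: spt_parts_def)
      then show ?thesis by blast
    qed (use j in \<open>auto simp: spt_parts_def\<close>)
  next
    fix j assume "j \<in> {m<..2 * m} \<union> (\<lambda>k. 2 + 2 * k) ` {m..<N}"
    then show "j \<in> spt_parts (2 * N) m" using assms by (auto simp: spt_parts_def intro: le_neq_implies_less)
  qed
  have "parts_gf (spt_parts (2 * N) m) = (\<Prod>j\<in>spt_parts (2 * N) m. geo j)"
    by (rule parts_gf_eq_prod) (auto simp: S)
  also have "\<dots> = (\<Prod>j\<in>{m<..2 * m}. geo j) * (\<Prod>k\<in>{m..<N}. geo (2 + 2 * k))"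
    unfolding S by (subst prod.union_disjoint) (auto simp: prod.reindex inj_on_def)
  finally have G: "parts_gf (spt_parts (2 * N) m) = (\<Prod>j\<in>{m<..2 * m}. geo j) * (\<Prod>k\<in>{m..<N}. geo (2 + 2 * k))" .
  have "qpn 1 2 2 N = qpn 1 2 2 m * (\<Prod>k\<in>{m..<N}. ?f (2 + 2 * k))"
    unfolding qpn_def using assms prod.atLeastLessThan_concat[of 0 m N "\<lambda>k. ?f (2 + 2 * k)"]
    by (simp add: atLeast0LessThan)
  moreover have "(\<Prod>k\<in>{m..<N}. ?f (2 + 2 * k)) * (\<Prod>k\<in>{m..<N}. geo (2 + 2 * k)) = 1"
    unfolding prod.distrib [symmetric] by (rule prod.neutral) (simp only: geo_inverse, simp add: geo_inverse)
  ultimately have 1: "qpn 1 2 2 N * (\<Prod>k\<in>{m..<N}. geo (2 + 2 * k)) = qpn 1 2 2 m"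
    by (simp add: mult.assoc)
  have Qp: "Q n = (\<Prod>j\<in>{0<..n}. ?f j)" for n
  proof (induction n)
    case (Suc n)
    have "{0<..Suc n} = insert (Suc n) {0<..n}" by auto
    then show ?case using Suc by (simp add: Q_Suc[unfolded One_nat_def] ac_simps del: power_Suc)
  qed (simp add: qpn_def)
  have "Q (2 * m) * (\<Prod>j\<in>{m<..2 * m}. geo j) = Q m"
  proof -
    have "{0<..2 * m} = {0<..m} \<union> {m<..2 * m}" by auto
    then have "Q (2 * m) = Q m * (\<Prod>j\<in>{m<..2 * m}. ?f j)"
      unfolding Qp by (simp only:) (subst prod.union_disjoint, auto)
    moreover have "(\<Prod>j\<in>{m<..2 * m}. ?f j) * (\<Prod>j\<in>{m<..2 * m}. geo j) = 1"
      unfolding prod.distrib [symmetric] by (rule prod.neutral) (auto intro!: geo_inverse)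
    ultimately show ?thesis by (simp add: mult.assoc)
  qed
  then have "inverse (Q (2 * m)) * Q (2 * m) * (\<Prod>j\<in>{m<..2 * m}. geo j) = inverse (Q (2 * m)) * Q m"
    by (simp only: mult.assoc)
  then have 2: "(\<Prod>j\<in>{m<..2 * m}. geo j) = inverse (Q (2 * m)) * Q m"
    by (simp add: qpn_unit)
  have Qm: "Q m = Q (m - 1) * ?f m" using assms Q_Suc[of "m - 1"] by (cases m) auto
  have "qpn 1 2 2 N * (wgen of_nat m * parts_gf (spt_parts (2 * N) m)) =
      (qpn 1 2 2 N * (\<Prod>k\<in>{m..<N}. geo (2 + 2 * k))) * wgen of_nat m * (\<Prod>j\<in>{m<..2 * m}. geo j)"
    unfolding G by (simp only: ac_simps)
  also have "\<dots> = qpn 1 2 2 m * inverse (Q (2 * m)) * (inverse (Q m) * Q m) * Q m * wgen of_nat m"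
    unfolding 1 2 qpn_unit[OF zero_less_one] by (simp only: mult_1_right mult_1_left ac_simps)
  also have "\<dots> = beta m * (Q m ^ 2 * wgen of_nat m)"
    by (simp add: beta_def power2_eq_square ac_simps)
  also have "Q m ^ 2 * wgen of_nat m = Q (m - 1) ^ 2 * (?f m ^ 2 * wgen of_nat m)"
    unfolding Qm by (simp add: power_mult_distrib ac_simps)
  also have "?f m ^ 2 * wgen of_nat m = q ^ m" by (rule wgen_of_nat) (use assms in simp)
  finally show ?thesis by (simp only: ac_simps)
qed

text \<open>With the convention \<open>1 / (q)\<^sub>k = 0\<close> for \<open>k < 0\<close> the sums over \<open>r\<close> need no range conditions.\<close>

definition iq :: "int \<Rightarrow> complex fps" where
  "iq k = (if k < 0 then 0 else inverse (Q (nat k)))"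

lemma iq_of_nat: "iq (int n) = inverse (Q n)"
  by (simp add: iq_def)

lemma iq_pred: "k \<ge> 0 \<Longrightarrow> iq (k - 1) = (1 - q ^ nat k) * iq k"
proof (cases "k = 0")
  case False
  assume "k \<ge> 0"
  then obtain n where "k = int (Suc n)" using False by (metis nonneg_int_cases of_nat_0 not0_implies_Suc)
  then show ?thesis using inverse_qpn_Suc[of 1 n] by (simp add: iq_def nat_add_distrib)
qed (simp add: iq_def)

text \<open>The entry with index 2 r of the Bailey sequence: the terms r and -r of Euler's
  pentagonal series in \<open>q\<^sup>2\<close>, taken together for r > 0.\<close>

definition alpha :: "nat \<Rightarrow> complex fps" where
  "alpha r = (if r = 0 then 1 else (- 1) ^ r * q ^ (3 * r\<^sup>2 - r) * (1 + q ^ (2 * r)))"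

text \<open>The right-hand side was found by creative telescoping; it vanishes for \<open>R > n\<close>, which gives the recurrence of \<open>beta\<close>.\<close>

lemma bailey_certificate:
  defines "b \<equiv> \<lambda>n r. iq (int n - 2 * int r) * iq (int n + 2 * int r)"
  shows "(\<Sum>r\<le>R. alpha r * (b (Suc n) r * ((1 - q ^ (2 * n + 1)) * (1 - q ^ (n + 1))) - b n r)) =
    (- 1) ^ R * q ^ (3 * R\<^sup>2 + 3 * R + n + 1) * (iq (int n - 1 - 2 * int R) * iq (int n + 2 * int R + 1))"
proof (induction R)
  case 0
  define J x where "J = iq (int n + 1)" and "x = q ^ n"
  have i: "iq (int n) = (1 - q * x) * J" "iq (int n - 1) = (1 - x) * iq (int n)" "iq (int (Suc n)) = J"
    using iq_pred[of "int n + 1"] iq_pred[of "int n"] by (simp_all add: J_def x_def nat_add_distrib add.commute)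
  have p: "q ^ (2 * n + 1) = q * x * x" "q ^ (n + 1) = q * x"
    by (simp_all add: mult_2 power_add x_def)
  have "(J * J) * ((1 - q * x * x) * (1 - q * x)) - ((1 - q * x) * J) * ((1 - q * x) * J) =
      q * x * (((1 - x) * ((1 - q * x) * J)) * J)" by algebra
  moreover have "b (Suc n) 0 = J * J" "b n 0 = ((1 - q * x) * J) * ((1 - q * x) * J)"
    unfolding b_def using i by simp_all
  moreover have "(- 1) ^ 0 * q ^ (3 * 0\<^sup>2 + 3 * 0 + n + 1) * (iq (int n - 1 - 2 * int 0) * iq (int n + 2 * int 0 + 1)) =
      q * x * (((1 - x) * ((1 - q * x) * J)) * J)"
    using i p by (simp add: J_def)
  ultimately show ?case unfolding p by (simp add: alpha_def)
next
  case (Suc R)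
  define r where "r = Suc R"
  show ?case
  proof (cases "2 * r \<le> n + 1")
    case False
    \<comment> \<open>If 2 r > n + 1, everything vanishes by the convention for negative
      arguments.\<close>
    then have "iq (int n + 1 - 2 * int r) = 0" "iq (int n - 2 * int r) = 0" "iq (int n - 1 - 2 * int R) = 0" "iq (int n - 1 - 2 * int (Suc R)) = 0"
      by (auto simp: iq_def r_def)
    then show ?thesis using Suc unfolding r_def [symmetric] by (simp add: b_def r_def algebra_simps)
  next
    case True
    define a where "a = n + 1 - 2 * r"
    have n: "n + 1 = a + 2 * r" using True by (simp add: a_def)
    define J where "J = iq (int a) * iq (int n + 1 + 2 * int r)"
    define A Z where "A = q ^ a" and "Z = q ^ r"
    have i1: "iq (int a - 1) = (1 - A) * iq (int a)"
      using iq_pred[of "int a"] by (simp add: A_def)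
    have i2: "iq (int n + 2 * int r) = (1 - A * Z ^ 4) * iq (int n + 1 + 2 * int r)"
    proof -
      have "nat (int n + 1 + 2 * int r) = a + 4 * r" using n by linarith
      then show ?thesis using iq_pred[of "int n + 1 + 2 * int r"]
        by (simp add: A_def Z_def power_add power_mult [symmetric] mult.commute)
    qed
    have qn: "q * q ^ n = A * Z ^ 2"
      using n by (simp add: A_def Z_def power_add [symmetric] power_mult [symmetric] mult.commute flip: power_Suc)
    have e: "int n + 1 - 2 * int r = int a" "int n - 2 * int r = int a - 1" "int n - 1 - 2 * int R = int a" 
       "int n - 1 - 2 * int (Suc R) = int a - 2" "int n + 2 * int R + 1 = int n + 2 * int r - 1" "int n + 2 * int (Suc R) + 1 = int n + 1 + 2 * int r"
      using n by (auto simp: r_def)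
    \<comment> \<open>The extra factor \<open>q\<close> turns 1 - q^(a - 1) into
      \<open>q - A\<close>; in this form the equation also holds at a = 0, where both sides are
      0.\<close>
    have i3: "q * iq (int a - 2) * iq (int n + 1 + 2 * int r) = (q - A) * (1 - A) * J"
    proof (cases "a = 0")
      case True
      then show ?thesis by (simp add: iq_def A_def)
    next
      case False
      then obtain a' where a': "a = Suc a'" by (cases a) auto
      have h: "iq (int a - 2) = (1 - q ^ a') * iq (int a - 1)" using iq_pred[of "int a'"] by (simp add: a')
      have A: "A = q * q ^ a'" by (simp add: A_def a')
      show ?thesis unfolding h i1 J_def A by (simp add: algebra_simps)
    qed
    have i4: "q * iq (int a) * iq (int n + 2 * int r - 1) = (q - A * Z ^ 4) * (1 - A * Z ^ 4) * J"
    proof -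
      have "nat (int n + 2 * int r) = a + 4 * r - 1" "a + 4 * r \<ge> 1" using n by (auto simp: r_def)
      then have h: "iq (int n + 2 * int r - 1) = (1 - q ^ (a + 4 * r - 1)) * iq (int n + 2 * int r)"
        using iq_pred[of "int n + 2 * int r"] by simp
      have e: "q * q ^ (a + 4 * r - 1) = A * Z ^ 4"
        using \<open>a + 4 * r \<ge> 1\<close> by (simp add: A_def Z_def power_add [symmetric] power_mult [symmetric] mult.commute flip: power_Suc)
      have "q * iq (int n + 2 * int r - 1) = (q - A * Z ^ 4) * iq (int n + 2 * int r)"
        unfolding e [symmetric] h by (simp add: algebra_simps)
      then show ?thesis unfolding i2 J_def by (simp add: ac_simps)
    qed
    define c where "c = (- 1) ^ R * q ^ (3 * R\<^sup>2 + 3 * R)"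
    have z: "q ^ (2 * r) = Z ^ 2" "q ^ (6 * r) = Z ^ 6" by (simp_all add: Z_def power_mult [symmetric] mult.commute)
    have sgn: "(- 1) ^ r = - ((- 1) ^ R :: complex fps)" by (simp add: r_def)
    have x1: "3 * r\<^sup>2 - r = 3 * R\<^sup>2 + 3 * R + 2 * r" by (simp add: r_def power2_eq_square algebra_simps)
    have x2: "3 * r\<^sup>2 + 3 * r + n + 1 = (3 * R\<^sup>2 + 3 * R) + 6 * r + (n + 1)" by (simp add: r_def power2_eq_square algebra_simps)
    have al: "alpha r = - c * Z ^ 2 * (1 + Z ^ 2)"
    proof -
      have "alpha r = (- 1) ^ r * q ^ (3 * r\<^sup>2 - r) * (1 + q ^ (2 * r))" by (simp add: alpha_def r_def)
      then show ?thesis unfolding x1 power_add z sgn c_def by (simp only: mult_minus_left mult.assoc)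
    qed
    have e': "int (Suc n) - 2 * int r = int a" "int (Suc n) + 2 * int r = int n + 1 + 2 * int r" using n by auto
    have bb: "b (Suc n) r = J" "b n r = (1 - A) * (1 - A * Z ^ 4) * J"
      unfolding b_def J_def e' e(2) i1 i2 by (simp_all only: ac_simps)
    \<comment> \<open>The induction step is proved after multiplication by \<open>q\<close>, where
      it is a polynomial identity in \<open>A\<close>, \<open>Z\<close>, \<open>q\<close>,
      \<open>c\<close> and \<open>J\<close>.\<close>
    have "q * (c * q ^ (n + 1) * (iq (int a) * iq (int n + 2 * int r - 1)) + alpha r * (J * ((1 - q ^ (2 * n + 1)) * (1 - q ^ (n + 1))) - (1 - A) * (1 - A * Z ^ 4) * J))
       = q * (- c * Z ^ 6 * q ^ (n + 1) * (iq (int a - 2) * iq (int n + 1 + 2 * int r)))"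
    proof -
      have X: "q ^ (n + 1) = A * Z ^ 2" using qn by simp
      have Y: "q * q ^ (2 * n + 1) = (A * Z ^ 2) ^ 2"
        unfolding qn [symmetric] by (simp add: power2_eq_square mult_2 power_add)
      have gen: "q * (c * x * (u * v) + d * (J * ((1 - y) * (1 - x)) - w)) =
          c * x * (q * u * v) + d * (J * ((q - q * y) * (1 - x)) - q * w)" for x y u v w d :: "complex fps"
        by (simp add: algebra_simps)
      have "q * (c * q ^ (n + 1) * (iq (int a) * iq (int n + 2 * int r - 1)) + alpha r * (J * ((1 - q ^ (2 * n + 1)) * (1 - q ^ (n + 1))) - (1 - A) * (1 - A * Z ^ 4) * J))
        = c * (A * Z ^ 2) * (q * iq (int a) * iq (int n + 2 * int r - 1)) + alpha r * (J * ((q - (A * Z ^ 2) ^ 2) * (1 - A * Z ^ 2)) - q * ((1 - A) * (1 - A * Z ^ 4) * J))"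
        unfolding gen unfolding Y unfolding X by (rule refl)
      also have "\<dots> = - c * Z ^ 6 * (A * Z ^ 2) * (q * iq (int a - 2) * iq (int n + 1 + 2 * int r))"
        unfolding i3 i4 al by algebra
      also have "\<dots> = q * (- c * Z ^ 6 * q ^ (n + 1) * (iq (int a - 2) * iq (int n + 1 + 2 * int r)))"
        unfolding X by (simp only: mult.assoc mult.left_commute[of q])
      finally show ?thesis .
    qed
    then have "c * q ^ (n + 1) * (iq (int a) * iq (int n + 2 * int r - 1)) + alpha r * (J * ((1 - q ^ (2 * n + 1)) * (1 - q ^ (n + 1))) - (1 - A) * (1 - A * Z ^ 4) * J)
       = - c * Z ^ 6 * q ^ (n + 1) * (iq (int a - 2) * iq (int n + 1 + 2 * int r))"
      by (simp only: mult_cancel_left) simp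
    moreover have "(- 1) ^ Suc R * q ^ (3 * (Suc R)\<^sup>2 + 3 * Suc R + n + 1) = - c * Z ^ 6 * q ^ (n + 1)"
      unfolding r_def [symmetric] x2 power_add [of q "_ + _" "n + 1"] power_add [of q _ "6 * r"] z sgn c_def
      by (simp only: mult_minus_left mult.assoc)
    moreover have "(- 1) ^ R * q ^ (3 * R\<^sup>2 + 3 * R + n + 1) = c * q ^ (n + 1)"
      by (simp add: c_def power_add ac_simps)
    ultimately show ?thesis
      unfolding sum.atMost_Suc unfolding Suc.IH unfolding e(3-6) unfolding r_def [symmetric] unfolding bb
      by (simp only:)
  qed
qed

text \<open>Both sides satisfy the same first-order recurrence in n. For the sum this is the
  certificate at R = n + 1, where its right-hand side vanishes.\<close>

lemma beta_eq_sum: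
  "beta n = (\<Sum>r\<le>n. alpha r * (iq (int n - 2 * int r) * iq (int n + 2 * int r)))"
proof (induction n)
  case 0
  then show ?case by (simp add: beta_def alpha_def iq_def qpn_def)
next
  case (Suc n)
  let ?b = "\<lambda>n r. iq (int n - 2 * int r) * iq (int n + 2 * int r)"
  define c where "c = (1 - q ^ (2 * n + 1)) * (1 - q ^ (n + 1))"
  have "(\<Sum>r\<le>Suc n. alpha r * (?b (Suc n) r * c - ?b n r)) = 0"
    unfolding bailey_certificate c_def by (simp add: iq_def)
  then have "(\<Sum>r\<le>Suc n. alpha r * ?b (Suc n) r) * c = (\<Sum>r\<le>Suc n. alpha r * ?b n r)"
    unfolding right_diff_distrib sum_subtractf right_minus_eq by (simp only: sum_distrib_right mult.assoc)
  also have "\<dots> = beta n"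
    unfolding Suc.IH by (simp add: iq_def)
  also have "\<dots> = beta (Suc n) * c"
  proof -
    have "inverse (Q n) = (1 - q ^ (n + 1)) * inverse (Q (Suc n))"
      "inverse (Q (2 * n)) = (1 - q ^ (2 * n + 1)) * ((1 - q ^ (2 * n + 2)) * inverse (Q (2 * Suc n)))"
      using inverse_qpn_Suc[of 1 n] inverse_qpn_Suc[of 1 "2 * n"] inverse_qpn_Suc[of 1 "Suc (2 * n)"]
      by (simp_all add: numeral_2_eq_2)
    moreover have "qpn 1 2 2 (Suc n) = qpn 1 2 2 n * (1 - q ^ (2 * n + 2))" by (simp add: qpn_Suc add.commute)
    ultimately show ?thesis unfolding beta_def c_def by (simp only: ac_simps)
  qed
  finally show ?case
  proof -
    assume eq: "(\<Sum>r\<le>Suc n. alpha r * ?b (Suc n) r) * c = beta (Suc n) * c"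
    have "fps_nth c 0 = 1" by (simp add: c_def)
    then have "c \<noteq> 0" by (metis fps_zero_nth zero_neq_one)
    then show ?thesis using eq by simp
  qed
qed

text \<open>The sum telescopes: consecutive right-hand sides differ by the summand times
  \<open>(1 - q ^ s) ^ 2\<close>. As N grows, \<open>Q N ^ 2\<close> cancels against the two
  reciprocals and q^s / (1 - q^s)^2 remains.\<close>

lemma bailey_inner_sum:
  assumes "s \<ge> 1"
  shows "(1 - q ^ s) ^ 2 * (\<Sum>m=1..N. q ^ m * Q (m - 1) ^ 2 * (iq (int m - int s) * iq (int m + int s))) =
    q ^ s * (Q N ^ 2 * (iq (int N - int s) * iq (int N + int s)))"
proof (induction N)
  case 0
  then show ?case using assms by (simp add: iq_def)
next
  case (Suc N)
  let ?J = "iq (int (Suc N) - int s) * iq (int (Suc N) + int s)"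
  have "(1 - q ^ s) ^ 2 * (q ^ Suc N * Q N ^ 2 * ?J) + q ^ s * (Q N ^ 2 * (iq (int N - int s) * iq (int N + int s)))
      = q ^ s * (Q (Suc N) ^ 2 * ?J)"
  proof (cases "s \<le> Suc N")
    case False
    then show ?thesis by (simp add: iq_def)
  next
    case True
    define a where "a = Suc N - s"
    have N: "Suc N = a + s" using True by (simp add: a_def)
    have "iq (int N - int s) = (1 - q ^ a) * iq (int (Suc N) - int s)"
      using iq_pred[of "int a"] N by (simp add: of_nat_diff algebra_simps)
        (metis add_diff_cancel_right' diff_add_eq int_ops(4) of_nat_add)
    moreover have "iq (int N + int s) = (1 - q ^ (a + 2 * s)) * iq (int (Suc N) + int s)"
    proof -
      have "nat (int (Suc N) + int s) = a + 2 * s" "int (Suc N) + int s - 1 = int N + int s" using N by linarith+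
      then show ?thesis using iq_pred[of "int (Suc N) + int s"] by simp
    qed
    moreover have "q ^ Suc N = q ^ a * q ^ s" "q ^ (a + 2 * s) = q ^ a * q ^ s * q ^ s"
      unfolding N by (simp_all add: power_add mult_2)
    moreover have "(1 - S)\<^sup>2 * (x * S * P\<^sup>2 * (I * K)) + S * (P\<^sup>2 * (((1 - x) * I) * ((1 - x * S * S) * K))) =
        S * ((P * (1 - x * S))\<^sup>2 * (I * K))" for S x P I K :: "complex fps"
      by algebra
    ultimately show ?thesis unfolding Q_Suc by (simp only:)
  qed
  moreover have "(\<Sum>m=1..Suc N. f m) = (\<Sum>m=1..N. f m) + f (Suc N)" for f :: "nat \<Rightarrow> complex fps" by simp
  ultimately show ?case unfolding distrib_left Suc.IH diff_Suc_1 by (simp only: distrib_left Suc.IH diff_Suc_1 add.commute)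
qed

lemma eqm_iq:
  assumes "1 \<le> s" "s \<le> N"
  shows "eqm (N - s + 1) (Q N ^ 2 * (iq (int N - int s) * iq (int N + int s))) 1"
proof -
  have "int N - int s = int (N - s)" "int N + int s = int (N + s)" using assms by simp_all
  then have i: "iq (int N - int s) = inverse (Q (N - s))" "iq (int N + int s) = inverse (Q (N + s))"
    by (simp_all only: iq_of_nat)
  have n0: "fps_nth (Q n) 0 = 1" for n by (simp add: qpn_nth_0)
  have *: "eqm (N - s + 1) (Q n) (Q N)" if "N - s \<le> n" for n
  proof -
    have "eqm (N - s + 1) (Q n) (Q (N - s))" "eqm (N - s + 1) (Q N) (Q (N - s))"
      using that by (auto intro!: eqm_qpn)
    then show ?thesis using eqm_trans eqm_sym by blast
  qed
  have "eqm (N - s + 1) (Q N ^ 2 * (iq (int N - int s) * iq (int N + int s))) (Q N ^ 2 * (inverse (Q N) * inverse (Q N)))"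
    unfolding i by (intro eqm_mult eqm_refl eqm_inverse *) (simp_all only: n0, simp_all)
  also have "Q N ^ 2 * (inverse (Q N) * inverse (Q N)) = (inverse (Q N) * Q N) * (inverse (Q N) * Q N)"
    by (simp only: power2_eq_square ac_simps)
  also have "\<dots> = 1" unfolding qpn_unit[OF zero_less_one] by simp
  finally show ?thesis .
qed

lemma eqm_X_power_iq:
  assumes "1 \<le> s"
  shows "eqm (N + 1) (q ^ s * (Q N ^ 2 * (iq (int N - int s) * iq (int N + int s)))) (q ^ s)"
proof (cases "s \<le> N")
  case True
  have "eqm (s + (N - s + 1)) (q ^ s * (Q N ^ 2 * (iq (int N - int s) * iq (int N + int s)))) (q ^ s * 1)"
    by (intro eqm_X_power_mult eqm_iq assms True)
  then show ?thesis using True by simp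
next
  case False
  then have *: "eqm (N + 1) (q ^ s * f) 0" for f by (intro eqm_X_power_0) simp
  show ?thesis by (rule eqm_trans[OF * eqm_sym[OF *[of 1, unfolded mult_1_right]]])
qed

section \<open>The generating function up to even powers\<close>

definition spt_gf :: "complex fps" where
  "spt_gf = Abs_fps (\<lambda>n. of_nat (spt_omega n))"

text \<open>Everything coming from \<open>r \<ge> 1\<close> in the Bailey pair is a series in \<open>q\<^sup>2\<close> and hence invisible in the odd part; \<open>alpha_even\<close> is its summand with \<open>q\<^sup>2\<close> replaced by \<open>q\<close>.\<close>

definition alpha_even :: "nat \<Rightarrow> complex fps" where
  "alpha_even r = (- 1) ^ r * q ^ ((3 * r\<^sup>2 - r) div 2) * (1 + q ^ r) * geo r ^ 2 * q ^ r"

lemma geo_compose: "d \<ge> 1 \<Longrightarrow> fps_compose (geo m) (q ^ d) = geo (d * m)"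
proof (rule fps_ext)
  fix n assume "d \<ge> 1"
  have "d * m dvd n \<longleftrightarrow> d dvd n \<and> m dvd n div d"
  proof
    assume "d * m dvd n"
    then show "d dvd n \<and> m dvd n div d" using \<open>d \<ge> 1\<close> by (auto elim!: dvdE)
  next
    assume "d dvd n \<and> m dvd n div d"
    then show "d * m dvd n" using \<open>d \<ge> 1\<close> by (auto elim!: dvdE simp: mult.assoc)
  qed
  then show "fps_nth (fps_compose (geo m) (q ^ d)) n = fps_nth (geo (d * m)) n"
    using \<open>d \<ge> 1\<close> by (simp add: compose_X_power_nth geo_def)
qed

lemma alpha_even_compose:
  assumes "r \<ge> 1"
  shows "fps_compose (alpha_even r) (q\<^sup>2) = alpha r * geo (2 * r) ^ 2 * q ^ (2 * r)"
proof -
  have "even (3 * r\<^sup>2 - r)" by (cases "even r") (auto simp: power2_eq_square)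
  then have e: "2 * ((3 * r\<^sup>2 - r) div 2) = 3 * r\<^sup>2 - r" by simp
  have X: "fps_compose (q ^ k) (q\<^sup>2) = q ^ (2 * k)" for k
    by (simp add: fps_X_power_compose power_mult)
  have "fps_compose ((- 1) ^ r) (q\<^sup>2) = (- 1) ^ r"
    by (simp add: compose_X_power_hom fps_compose_uminus)
  then show ?thesis using assms
    unfolding alpha_even_def alpha_def
    by (simp add: compose_X_power_hom X e fps_compose_add_distrib geo_compose del: One_nat_def)
qed

lemma E2_spt_gf:
  "eqm (N + 1) (E 2 * spt_gf) ((\<Sum>m=1..N. wgen of_nat m) + fps_compose (\<Sum>r=1..N. alpha_even r) (q\<^sup>2))"
proof -
  let ?p = "\<lambda>m. parts_gf (spt_parts (2 * N) m)" and ?S = "\<lambda>r. \<Sum>m=1..N. q ^ m * Q (m - 1) ^ 2 * (iq (int m - int (2 * r)) * iq (int m + int (2 * r)))"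
  have "eqm (N + 1) (E 2 * spt_gf) (qpn 1 2 2 N * (\<Sum>m=1..N. wgen of_nat m * ?p m))"
  proof (rule eqm_mult)
    show "eqm (N + 1) (E 2) (qpn 1 2 2 N)" by (auto simp: E_eq_qp intro!: eqm_qp)
    show "eqm (N + 1) spt_gf (\<Sum>m=1..N. wgen of_nat m * ?p m)"
      unfolding eqm_def
    proof (intro allI impI)
      fix n assume "n < N + 1"
      then show "fps_nth spt_gf n = fps_nth (\<Sum>m=1..N. wgen of_nat m * ?p m) n"
        unfolding spt_gf_def fps_nth_Abs_fps fps_sum_nth by (intro spt_omega_eq_sum) auto
    qed
  qed
  also have "qpn 1 2 2 N * (\<Sum>m=1..N. wgen of_nat m * ?p m) =
      (\<Sum>m=1..N. q ^ m * Q (m - 1) ^ 2 * beta m)"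
    unfolding sum_distrib_left by (intro sum.cong refl qpn_even_parts) simp_all
  also have "\<dots> = (\<Sum>m=1..N. \<Sum>r=0..N. alpha r * (q ^ m * Q (m - 1) ^ 2 * (iq (int m - int (2 * r)) * iq (int m + int (2 * r)))))"
  proof (rule sum.cong)
    fix m assume m: "m \<in> {1..N}"
    have "beta m = (\<Sum>r=0..N. alpha r * (iq (int m - 2 * int r) * iq (int m + 2 * int r)))"
      unfolding beta_eq_sum using m by (intro sum.mono_neutral_left) (auto simp: iq_def)
    then show "q ^ m * Q (m - 1) ^ 2 * beta m =
        (\<Sum>r=0..N. alpha r * (q ^ m * Q (m - 1) ^ 2 * (iq (int m - int (2 * r)) * iq (int m + int (2 * r)))))"
      by (simp only: sum_distrib_left of_nat_mult of_nat_numeral) (simp only: ac_simps)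
  qed simp
  also have "\<dots> = (\<Sum>r=0..N. alpha r * ?S r)"
    unfolding sum_distrib_left by (rule sum.swap)
  also have "\<dots> = (\<Sum>m=1..N. q ^ m * Q (m - 1) ^ 2 * (iq (int m) * iq (int m))) +
      (\<Sum>r=1..N. alpha r * ?S r)"
    by (subst sum.atLeast_Suc_atMost) (auto simp: alpha_def)
  \<comment> \<open>The term r = 0 is outside the range s > 0 of the telescoping formula. Here the
    products cancel and the sum of q^m / (1 - q^m)^2 is left, which generates the divisor
    sums.\<close>
  also have "(\<Sum>m=1..N. q ^ m * Q (m - 1) ^ 2 * (iq (int m) * iq (int m))) = (\<Sum>m=1..N. wgen of_nat m)"
  proof (rule sum.cong)
    fix m assume m: "m \<in> {1..N}"
    have Qm: "Q m = Q (m - 1) * (1 - q ^ m)" using m Q_Suc[of "m - 1"] by (cases m) auto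
    have "q ^ m * Q (m - 1) ^ 2 * (iq (int m) * iq (int m)) =
        (1 - q ^ m) ^ 2 * wgen of_nat m * Q (m - 1) ^ 2 * (inverse (Q m) * inverse (Q m))"
      using wgen_of_nat[of m] m by (simp add: iq_of_nat)
    also have "\<dots> = wgen of_nat m * ((Q (m - 1) * (1 - q ^ m)) * inverse (Q m)) ^ 2"
      by (simp only: power_mult_distrib power2_eq_square ac_simps)
    also have "(Q (m - 1) * (1 - q ^ m)) * inverse (Q m) = 1"
      unfolding Qm [symmetric] using qpn_unit[OF zero_less_one, of 1 1 m] by (simp only: mult.commute)
    finally show "q ^ m * Q (m - 1) ^ 2 * (iq (int m) * iq (int m)) = wgen of_nat m" by simp
  qed simp
  also have "eqm (N + 1) ((\<Sum>m=1..N. wgen of_nat m) +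
      (\<Sum>r=1..N. alpha r * ?S r))
    ((\<Sum>m=1..N. wgen of_nat m) + (\<Sum>r=1..N. fps_compose (alpha_even r) (q\<^sup>2)))"
  proof (intro eqm_add eqm_refl eqm_sum)
    fix r assume "r \<in> {1..N}"
    then have r: "r \<ge> 1" "2 * r \<ge> 1" by auto
    let ?s = "2 * r"
    have "geo ?s ^ 2 * ((1 - q ^ ?s) ^ 2 * ?S r) = ((1 - q ^ ?s) * geo ?s) ^ 2 * ?S r"
      by (simp only: power_mult_distrib ac_simps)
    then have "?S r = geo ?s ^ 2 * ((1 - q ^ ?s) ^ 2 * ?S r)" by (simp only: geo_inverse[OF r(2)]) simp
    also have "\<dots> = geo ?s ^ 2 * (q ^ ?s * (Q N ^ 2 * (iq (int N - int ?s) * iq (int N + int ?s))))"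
      by (simp only: bailey_inner_sum[OF r(2)])
    also have "eqm (N + 1) \<dots> (geo ?s ^ 2 * q ^ ?s)"
      by (intro eqm_mult eqm_refl eqm_X_power_iq r)
    finally have "eqm (N + 1) (alpha r * ?S r) (alpha r * (geo ?s ^ 2 * q ^ ?s))"
      by (intro eqm_mult eqm_refl)
    then show "eqm (N + 1) (alpha r * ?S r) (fps_compose (alpha_even r) (q\<^sup>2))"
      unfolding alpha_even_compose[OF r(1)] by (simp only: mult.assoc)
  qed
  also have "(\<Sum>r=1..N. fps_compose (alpha_even r) (q\<^sup>2)) = fps_compose (\<Sum>r=1..N. alpha_even r) (q\<^sup>2)"
    by (rule fps_compose_sum_distrib [symmetric])
  finally show ?thesis .
qed

lemma sum_wgen_nth:
  assumes "1 \<le> n" "n \<le> N"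
  shows "fps_nth (\<Sum>m=1..N. wgen of_nat m) n = (\<Sum>d | d dvd n. of_nat d)"
proof -
  have "fps_nth (\<Sum>m=1..N. wgen of_nat m) n = (\<Sum>m=1..N. if m dvd n then of_nat (n div m) else 0)"
    by (simp add: fps_sum_nth wgen_def)
  also have "\<dots> = (\<Sum>m\<in>{m \<in> {1..N}. m dvd n}. of_nat (n div m))"
    by (simp add: sum.If_cases Int_def)
  also have "\<dots> = (\<Sum>d | d dvd n. of_nat d)"
  proof (rule sum.reindex_bij_witness[of _ "\<lambda>d. n div d" "\<lambda>m. n div m"])
    fix d assume "d \<in> {d. d dvd n}"
    then obtain e where e: "n = d * e" by auto
    then have "d > 0" "e > 0" using assms by auto
    then have "e \<le> n" unfolding e by simp
    then have "e \<le> N" using assms(2) by (rule order_trans)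
    then show "n div d \<in> {m \<in> {1..N}. m dvd n}" "n div (n div d) = d"
      using e \<open>d > 0\<close> \<open>e > 0\<close> assms by auto
  next
    fix m assume "m \<in> {m \<in> {1..N}. m dvd n}"
    then obtain e where "n = m * e" by auto
    then show "n div (n div m) = m" "n div m \<in> {d. d dvd n}" using assms by auto
  qed simp
  finally show ?thesis .
qed

theorem spt_omega_odd: "sec 2 1 spt_gf * E 1 ^ 5 = E 2 ^ 8"
proof -
  have "E 1 * sec 2 1 spt_gf = sec 2 1 (E 2 * spt_gf)"
    using sec_mult[of 2 1 "E 1" spt_gf] E_compose[of 2 1] by simp
  also have "\<dots> = Abs_fps (\<lambda>n. \<Sum>d | d dvd 2 * n + 1. of_nat d)"
  proof (rule fps_ext)
    fix n :: nat
    define N where "N = 2 * n + 1"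
    have "fps_nth (sec 2 1 (E 2 * spt_gf)) n = fps_nth (E 2 * spt_gf) N"
      by (simp add: sec_def N_def)
    also have "\<dots> = fps_nth (\<Sum>m=1..N. wgen of_nat m) N + fps_nth (fps_compose (\<Sum>r=1..N. alpha_even r) (q\<^sup>2)) N"
      using E2_spt_gf[of N] by (simp add: eqm_def)
    also have "fps_nth (fps_compose (\<Sum>r=1..N. alpha_even r) (q\<^sup>2)) N = 0"
      by (simp add: compose_X_power_nth N_def)
    also have "fps_nth (\<Sum>m=1..N. wgen of_nat m) N = (\<Sum>d | d dvd N. of_nat d)"
      by (rule sum_wgen_nth) (simp_all add: N_def)
    finally show "fps_nth (sec 2 1 (E 2 * spt_gf)) n = fps_nth (Abs_fps (\<lambda>n. \<Sum>d | d dvd 2 * n + 1. of_nat d)) n"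
      by (simp add: N_def)
  qed
  finally have "E 1 ^ 4 * (E 1 * sec 2 1 spt_gf) = E 2 ^ 8" using divisor_sum_odd by simp
  moreover have "E 1 ^ 5 = E 1 ^ 4 * E 1" by (simp flip: power_Suc2)
  ultimately show ?thesis by (simp add: ac_simps)
qed

section \<open>Quintic dissections\<close>

lemma X_power_sec_nth:
  assumes "i < 5"
  shows "fps_nth (q ^ i * fps_compose (sec 5 i f) (q ^ 5)) n = (if n mod 5 = i then fps_nth f n else 0)"
proof (cases "n < i")
  case True
  then show ?thesis using assms by (simp add: fps_X_power_mult_nth)
next
  case False
  then have "5 dvd n - i \<longleftrightarrow> n mod 5 = i"
    using assms by (metis mod_eq_dvd_iff_nat mod_less not_less)
  moreover have "5 * ((n - i) div 5) + i = n" if "5 dvd n - i" using that False by simp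
  ultimately show ?thesis using False by (simp add: fps_X_power_mult_nth compose_X_power_nth sec_def)
qed

lemma dissect5:
  "f = fps_compose (sec 5 0 f) (q ^ 5) + q * fps_compose (sec 5 1 f) (q ^ 5) + q ^ 2 * fps_compose (sec 5 2 f) (q ^ 5)
    + q ^ 3 * fps_compose (sec 5 3 f) (q ^ 5) + q ^ 4 * fps_compose (sec 5 4 f) (q ^ 5)"
proof (rule fps_ext)
  fix n :: nat
  have "fps_nth (q ^ 0 * fps_compose (sec 5 0 f) (q ^ 5)) n + fps_nth (q ^ 1 * fps_compose (sec 5 1 f) (q ^ 5)) n
     + fps_nth (q ^ 2 * fps_compose (sec 5 2 f) (q ^ 5)) n
    + fps_nth (q ^ 3 * fps_compose (sec 5 3 f) (q ^ 5)) n + fps_nth (q ^ 4 * fps_compose (sec 5 4 f) (q ^ 5)) n = fps_nth f n"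
    by (simp only: X_power_sec_nth) (auto simp: X_power_sec_nth)
  then show "fps_nth f n = fps_nth (fps_compose (sec 5 0 f) (q ^ 5) + q * fps_compose (sec 5 1 f) (q ^ 5) + q ^ 2 * fps_compose (sec 5 2 f) (q ^ 5)
    + q ^ 3 * fps_compose (sec 5 3 f) (q ^ 5) + q ^ 4 * fps_compose (sec 5 4 f) (q ^ 5)) n"
    by (simp only: fps_add_nth power_0 power_one_right mult_1_left)
qed

text \<open>Uniqueness of the dissection. Any expansion of this form, however it was found, may be
  compared class by class with another one.\<close>

lemma sec5_eq:
  assumes "f = fps_compose g0 (q ^ 5) + q * fps_compose g1 (q ^ 5) + q ^ 2 * fps_compose g2 (q ^ 5)
    + q ^ 3 * fps_compose g3 (q ^ 5) + q ^ 4 * fps_compose g4 (q ^ 5)"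
  shows "sec 5 0 f = g0" "sec 5 1 f = g1" "sec 5 2 f = g2" "sec 5 3 f = g3" "sec 5 4 f = g4"
proof -
  have X: "sec 5 i (q ^ j) = (if i = j then 1 else 0)" if "i < 5" "j < 5" for i j
    using that by (intro fps_ext) (auto simp: sec_def)
  have X1: "sec 5 i q = (if i = 1 then 1 else 0)" if "i < 5" for i
    using X[of i 1] that by simp
  have X0: "sec 5 i 1 = (if i = 0 then 1 else 0)" if "i < 5" for i
    using X[of i 0] that by simp
  have "f = fps_compose g0 (q ^ 5) * 1 + fps_compose g1 (q ^ 5) * q + fps_compose g2 (q ^ 5) * q ^ 2
    + fps_compose g3 (q ^ 5) * q ^ 3 + fps_compose g4 (q ^ 5) * q ^ 4"
    unfolding assms by (simp add: ac_simps)
  note eq = this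
  have five: "(1::nat) \<le> 5" by simp
  have *: "sec 5 i f = g0 * sec 5 i 1 + g1 * sec 5 i q + g2 * sec 5 i (q ^ 2) + g3 * sec 5 i (q ^ 3) + g4 * sec 5 i (q ^ 4)"
    if "i < 5" for i
    unfolding eq sec_add sec_mult[OF five that] by (rule refl)
  show "sec 5 0 f = g0" "sec 5 1 f = g1" "sec 5 2 f = g2" "sec 5 3 f = g3" "sec 5 4 f = g4"
    by (subst *; simp add: X X1 X0)+
qed

lemma sec_gs:
  assumes "i < m"
  shows "sec m i (gs A c e) = gs {j \<in> A. e j mod m = i} c (\<lambda>j. e j div m)"
proof (rule fps_ext)
  fix n
  have "e j = m * n + i \<longleftrightarrow> e j mod m = i \<and> e j div m = n" for j
    using assms mult_div_mod_eq[of m "e j"] by auto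
  then have "{j. j \<in> A \<and> e j = m * n + i} = {j. j \<in> {j \<in> A. e j mod m = i} \<and> e j div m = n}" by auto
  then show "fps_nth (sec m i (gs A c e)) n = fps_nth (gs {j \<in> A. e j mod m = i} c (\<lambda>j. e j div m)) n"
    by (simp add: sec_def gs_nth)
qed

lemma gs_empty [simp]: "gs {} c e = 0"
  by (rule fps_ext) (simp add: gs_nth)

lemma int_mod5_cases:
  obtains m :: int where "j = 5 * m" | m where "j = 5 * m + 1" | m where "j = 5 * m + 2" | m where "j = 5 * m + 3" | m where "j = 5 * m + 4"
proof -
  have j: "j = 5 * (j div 5) + j mod 5" by simp
  have "j mod 5 = 0 \<or> j mod 5 = 1 \<or> j mod 5 = 2 \<or> j mod 5 = 3 \<or> j mod 5 = 4" by presburger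
  then show thesis using j that by (elim disjE) (metis add.right_neutral)+
qed

text \<open>Classes met by a single residue of j, namely 1 for pentagonal and 3 for triangular
  exponents, reproduce the whole series in q^25. This is the source of E_25 and of psi(q^25) in the
  dissections.\<close>

lemma te_5m:
  shows "te 3 1 (5 * m) mod 5 = 0" "te 3 1 (5 * m + 1) = 5 * (5 * te 3 1 (- m)) + 1" "te 3 1 (5 * m + 2) mod 5 = 0"
    "te 3 1 (5 * m + 3) mod 5 = 2" "te 3 1 (5 * m + 4) mod 5 = 2"
    and "te 1 0 (5 * m) = 5 * te 5 2 m" "te 1 0 (5 * m + 1) = 5 * te 5 2 (- m)" "te 1 0 (5 * m + 2) = 5 * te 5 1 (- m) + 1"
    "te 1 0 (5 * m + 3) = 5 * (5 * te 1 0 (- m)) + 3" "te 1 0 (5 * m + 4) = 5 * te 5 1 (m + 1) + 1"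
proof -
  have e: "2 * int (te 3 1 j) = 3 * (j * j) - j" "2 * int (te 1 0 j) = j * j - j" "2 * int (te 5 2 j) = 5 * (j * j) - j"
    "2 * int (te 5 1 j) = 5 * (j * j) - 3 * j" for j
    using two_te[of 1 3 j] two_te[of 0 1 j] two_te[of 2 5 j] two_te[of 1 5 j] by (simp_all add: algebra_simps)
  have *: "n mod 5 = r" if "2 * int n = 5 * k + 2 * int r" "r < 5" for n r :: nat and k
  proof -
    have "int n = int r + 5 * (int n - int r - 2 * k)" using that(1) by presburger
    then have "int n mod 5 = int r mod 5" by (metis mod_mult_self2)
    then have "int (n mod 5) = int (r mod 5)" by (simp only: of_nat_mod of_nat_numeral)
    then show ?thesis using that(2) by simp
  qed
  show "te 3 1 (5 * m) mod 5 = 0" by (rule *[of _ "15 * (m * m) - m"]) (simp_all add: e[unfolded One_nat_def] algebra_simps)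
  show "te 3 1 (5 * m + 2) mod 5 = 0" by (rule *[of _ "15 * (m * m) + 11 * m + 2"]) (simp_all add: e[unfolded One_nat_def] algebra_simps)
  show "te 3 1 (5 * m + 3) mod 5 = 2" by (rule *[of _ "15 * (m * m) + 17 * m + 4"]) (simp_all add: e[unfolded One_nat_def] algebra_simps)
  show "te 3 1 (5 * m + 4) mod 5 = 2" by (rule *[of _ "15 * (m * m) + 23 * m + 8"]) (simp_all add: e[unfolded One_nat_def] algebra_simps)
  have **: "a = b" if "2 * int a = 2 * int b" for a b using that by simp
  show "te 3 1 (5 * m + 1) = 5 * (5 * te 3 1 (- m)) + 1"
    "te 1 0 (5 * m) = 5 * te 5 2 m"
    "te 1 0 (5 * m + 1) = 5 * te 5 2 (- m)"
    "te 1 0 (5 * m + 2) = 5 * te 5 1 (- m) + 1"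
    "te 1 0 (5 * m + 3) = 5 * (5 * te 1 0 (- m)) + 3"
    "te 1 0 (5 * m + 4) = 5 * te 5 1 (m + 1) + 1"
    by (rule **, simp only: of_nat_add of_nat_mult of_nat_numeral of_nat_1 distrib_left mult.left_commute[of 2 5] e, simp add: algebra_simps)+
qed

lemma inj_on_affine: "inj_on (\<lambda>m::int. 5 * m + r) A"
  by (auto simp: inj_on_def)

lemma sec_E1: "sec 5 1 (E 1) = - E 5" "sec 5 3 (E 1) = 0" "sec 5 4 (E 1) = 0"
proof -
  have cl: "te 3 1 j mod 5 = 1 \<longleftrightarrow> (\<exists>m. j = 5 * m + 1)" "te 3 1 j mod 5 \<le> 2" for j
    by (rule int_mod5_cases[of j]; simp add: te_5m[unfolded One_nat_def]; presburger)+
  have "{j \<in> UNIV. te 3 1 j mod 5 = 3} = {}" "{j \<in> UNIV. te 3 1 j mod 5 = 4} = {}"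
    using cl(2) by (auto, (metis numeral_le_iff not_numeral_le_zero semiring_norm)+)
  then show "sec 5 3 (E 1) = 0" "sec 5 4 (E 1) = 0"
    unfolding euler_pentagonal [symmetric] by (simp_all add: sec_gs)
  have bij: "bij_betw (\<lambda>m. 5 * m + 1) UNIV {j \<in> UNIV. te 3 1 j mod 5 = 1}"
    unfolding bij_betw_def cl(1) using inj_on_affine by auto
  have "sec 5 1 (E 1) = gs {j \<in> UNIV. te 3 1 j mod 5 = 1} (sg 1) (\<lambda>j. te 3 1 j div 5)"
    unfolding euler_pentagonal [symmetric] by (rule sec_gs) simp
  also have "\<dots> = gs UNIV (\<lambda>m. sg 1 (5 * m + 1)) (\<lambda>m. te 3 1 (5 * m + 1) div 5)"
    by (rule gs_reindex[OF bij])
  also have "\<dots> = gs UNIV (\<lambda>m. - 1 * sg 1 (- m)) (\<lambda>m. 5 * te 3 1 (- m))"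
    unfolding te_5m by (rule gs_cong) (auto simp: sg_def)
  also have "\<dots> = gs UNIV (\<lambda>m. - 1 * sg 1 m) (\<lambda>m. 5 * te 3 1 m)"
    by (rule gs_reindex [symmetric]) (rule bij_uminus)
  also have "\<dots> = - fps_compose (gs UNIV (sg 1) (te 3 1)) (q ^ 5)"
    unfolding gs_cmult by (subst gs_scale) (simp_all add: fps_const_neg [symmetric] del: fps_const_neg)
  also have "\<dots> = - E 5" unfolding euler_pentagonal using E_compose[of 5 1] by simp
  finally show "sec 5 1 (E 1) = - E 5" .
qed

lemma sec_E1_cube: "sec 5 2 (E 1 ^ 3) = 0"
proof -
  have "te 1 0 j mod 5 \<noteq> 2" for j
    by (rule int_mod5_cases[of j]; simp add: te_5m[unfolded One_nat_def]; presburger)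
  then have "{j \<in> UNIV. te 1 0 j mod 5 = 2} = {}" by blast
  then have "sec 5 2 (2 * E 1 ^ 3) = 0" unfolding jacobi_cube [symmetric] by (subst sec_gs) simp_all
  then have "sec 5 2 (E 1 ^ 3) + sec 5 2 (E 1 ^ 3) = 0" by (simp only: sec_add mult_2)
  then have "2 * sec 5 2 (E 1 ^ 3) = 0" by (simp only: mult_2)
  then show ?thesis by simp
qed

definition psi5 :: "complex fps" where "psi5 = fps_compose psi (q ^ 5)"

text \<open>The bilateral series, twice psi, is dissected. The residues 0 and 1 of j fall into class
  0, the residues 2 and 4 into class 1, and 3 alone into class 3; the two halves of a pair agree
  after a reflection.\<close>

lemma psi_dissect: "psi = fps_compose f23 (q ^ 5) + q * fps_compose f14 (q ^ 5) + q ^ 3 * fps_compose psi5 (q ^ 5)"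
proof -
  let ?t = "gs UNIV (sg (-1)) (te 1 0)"
  have one: "sg (-1) = (\<lambda>_. 1)" by (auto simp: sg_def)
  have d: "(5 * n + 1) div 5 = n" for n :: nat by presburger
  have fin: "fin_below A (te 1 0)" for A by (rule fin_below_te) auto
  have fin5: "fin_below A (\<lambda>j. te 1 0 j div 5)" for A
    unfolding fin_below_def
  proof
    fix N
    have "{j \<in> A. te 1 0 j div 5 < N} \<subseteq> {j \<in> A. te 1 0 j < 5 * N}" by auto
    then show "finite {j \<in> A. te 1 0 j div 5 < N}" using fin[of A] unfolding fin_below_def by (meson finite_subset)
  qed
  have cl: "te 1 0 j mod 5 = 0 \<longleftrightarrow> (\<exists>m. j = 5 * m) \<or> (\<exists>m. j = 5 * m + 1)"
    "te 1 0 j mod 5 = 1 \<longleftrightarrow> (\<exists>m. j = 5 * m + 2) \<or> (\<exists>m. j = 5 * m + 4)"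
    "te 1 0 j mod 5 = 3 \<longleftrightarrow> (\<exists>m. j = 5 * m + 3)" "te 1 0 j mod 5 \<noteq> 2" "te 1 0 j mod 5 \<noteq> 4" for j
    by (rule int_mod5_cases[of j]; simp add: te_5m[unfolded One_nat_def]; presburger)+
  have "{j \<in> UNIV. te 1 0 j mod 5 = 2} = {}" "{j \<in> UNIV. te 1 0 j mod 5 = 4} = {}"
    using cl(4,5) by blast+
  then have z: "sec 5 2 ?t = 0" "sec 5 4 ?t = 0" by (simp_all add: sec_gs)
  have split: "sec 5 i ?t = gs UNIV (sg (-1)) (\<lambda>m. te 1 0 (5 * m + r) div 5) + gs UNIV (sg (-1)) (\<lambda>m. te 1 0 (5 * m + s) div 5)"
    if "i < 5" "0 \<le> r" "r < s" "s < 5" "{j \<in> UNIV. te 1 0 j mod 5 = i} = range (\<lambda>m. 5 * m + r) \<union> range (\<lambda>m. 5 * m + s)" for i r s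
  proof -
    have "range (\<lambda>m::int. 5 * m + r) \<inter> range (\<lambda>m. 5 * m + s) = {}"
      using that by (auto, presburger)
    then have "sec 5 i ?t = gs (range (\<lambda>m. 5 * m + r)) (sg (-1)) (\<lambda>j. te 1 0 j div 5) + gs (range (\<lambda>m. 5 * m + s)) (sg (-1)) (\<lambda>j. te 1 0 j div 5)"
      unfolding sec_gs[OF that(1)] that(5) by (intro gs_Un fin5)
    moreover have bij: "bij_betw (\<lambda>m. 5 * m + t) UNIV (range (\<lambda>m::int. 5 * m + t))" for t
      unfolding bij_betw_def using inj_on_affine by blast
    have "gs (range (\<lambda>m::int. 5 * m + t)) (sg (-1)) (\<lambda>j. te 1 0 j div 5) =
        gs UNIV (sg (-1)) (\<lambda>m. te 1 0 (5 * m + t) div 5)" for t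
      using gs_reindex[OF bij[of t], of "sg (-1)"] by (simp add: one)
    ultimately show ?thesis by simp
  qed
  have S: "{j \<in> UNIV. te 1 0 j mod 5 = 0} = range (\<lambda>m. 5 * m + 0) \<union> range (\<lambda>m. 5 * m + 1)"
    "{j \<in> UNIV. te 1 0 j mod 5 = 1} = range (\<lambda>m. 5 * m + 2) \<union> range (\<lambda>m. 5 * m + 4)"
    unfolding cl by auto
  have "sec 5 0 ?t = gs UNIV (sg (-1)) (\<lambda>m. te 1 0 (5 * m + 0) div 5) + gs UNIV (sg (-1)) (\<lambda>m. te 1 0 (5 * m + 1) div 5)"
    by (rule split[OF _ _ _ _ S(1)]) simp_all
  also have "\<dots> = gs UNIV (sg (-1)) (te 5 2) + gs UNIV (\<lambda>m. sg (-1) (- m)) (\<lambda>m. te 5 2 (- m))"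
    unfolding te_5m add_0_right by (simp add: one)
  also have "gs UNIV (\<lambda>m. sg (-1) (- m)) (\<lambda>m. te 5 2 (- m)) = gs UNIV (sg (-1)) (te 5 2)"
    by (rule gs_reindex [symmetric]) (rule bij_uminus)
  finally have s0: "sec 5 0 ?t = 2 * f23" by (simp add: f23_def)
  have "sec 5 1 ?t = gs UNIV (sg (-1)) (\<lambda>m. te 1 0 (5 * m + 2) div 5) + gs UNIV (sg (-1)) (\<lambda>m. te 1 0 (5 * m + 4) div 5)"
    by (rule split[OF _ _ _ _ S(2)]) simp_all
  also have "\<dots> = gs UNIV (\<lambda>m. sg (-1) (- m)) (\<lambda>m. te 5 1 (- m)) + gs UNIV (\<lambda>m. sg (-1) (m + 1)) (\<lambda>m. te 5 1 (m + 1))"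
    unfolding te_5m d by (simp add: one)
  also have "gs UNIV (\<lambda>m. sg (-1) (- m)) (\<lambda>m. te 5 1 (- m)) = gs UNIV (sg (-1)) (te 5 1)"
    by (rule gs_reindex [symmetric]) (rule bij_uminus)
  also have "gs UNIV (\<lambda>m. sg (-1) (m + 1)) (\<lambda>m. te 5 1 (m + 1)) = gs UNIV (sg (-1)) (te 5 1)"
    by (rule gs_reindex [symmetric]) (auto simp: bij_betw_def inj_on_def intro!: surjI[of _ "\<lambda>m. m - 1"])
  finally have s1: "sec 5 1 ?t = 2 * f14" by (simp add: f14_def)
  have bij: "bij_betw (\<lambda>m. 5 * m + 3) UNIV {j \<in> UNIV. te 1 0 j mod 5 = 3}"
    unfolding bij_betw_def cl(3) using inj_on_affine by auto
  have "sec 5 3 ?t = gs {j \<in> UNIV. te 1 0 j mod 5 = 3} (sg (-1)) (\<lambda>j. te 1 0 j div 5)"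
    by (rule sec_gs) simp
  also have "\<dots> = gs UNIV (\<lambda>m. sg (-1) (5 * m + 3)) (\<lambda>m. te 1 0 (5 * m + 3) div 5)"
    by (rule gs_reindex[OF bij])
  also have "\<dots> = gs UNIV (\<lambda>m. sg (-1) (- m)) (\<lambda>m. 5 * te 1 0 (- m))"
    unfolding te_5m by (rule gs_cong) (auto simp: sg_def)
  also have "\<dots> = gs UNIV (sg (-1)) (\<lambda>m. 5 * te 1 0 m)"
    by (rule gs_reindex [symmetric]) (rule bij_uminus)
  also have "\<dots> = fps_compose ?t (q ^ 5)" by (rule gs_scale) simp
  finally have s3: "sec 5 3 ?t = 2 * psi5"
    unfolding psi_sum psi5_def by (simp add: fps_compose_mult_distrib)
  have "2 * psi = 2 * (fps_compose f23 (q ^ 5) + q * fps_compose f14 (q ^ 5) + q ^ 3 * fps_compose psi5 (q ^ 5))"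
    using dissect5[of ?t] unfolding s0 s1 s3 z unfolding psi_sum
    by (simp add: fps_compose_mult_distrib algebra_simps)
  then show ?thesis by (simp only: mult_cancel_left) simp
qed

section \<open>The dissections of E_1 and E_2\<close>

text \<open>\<open>E\<^sub>1 = A5(q\<^sup>5) - q E\<^sub>2\<^sub>5 + q\<^sup>2 C5(q\<^sup>5)\<close>.\<close>

definition A5 :: "complex fps" where "A5 = sec 5 0 (E 1)"
definition C5 :: "complex fps" where "C5 = sec 5 2 (E 1)"

abbreviation D5 :: "complex fps \<Rightarrow> complex fps" where "D5 f \<equiv> fps_compose f (q ^ 5)"

lemma D5_simps:
  "D5 (f * g) = D5 f * D5 g" "D5 (f ^ n) = D5 f ^ n" "D5 (f + g) = D5 f + D5 g" "D5 (f - g) = D5 f - D5 g"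
  "D5 (- f) = - D5 f" "D5 q = q ^ 5" "D5 1 = 1" "D5 (numeral k) = numeral k"
  by (simp_all add: fps_compose_mult_distrib compose_X_power_hom fps_compose_add_distrib fps_compose_sub_distrib fps_compose_uminus)

lemma D5_eq_iff: "D5 f = D5 g \<longleftrightarrow> f = g"
proof
  assume *: "D5 f = D5 g"
  show "f = g"
  proof (rule fps_ext)
    fix n
    have "fps_nth (D5 f) (5 * n) = fps_nth (D5 g) (5 * n)" using * by simp
    then show "fps_nth f n = fps_nth g n" by (simp add: compose_X_power_nth)
  qed
qed simp

lemma E1_dissect: "E 1 = D5 A5 - q * D5 (E 5) + q ^ 2 * D5 C5"
  using dissect5[of "E 1"] by (simp add: sec_E1 [unfolded One_nat_def] A5_def C5_def fps_compose_uminus)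

lemma A5_nth_0: "fps_nth A5 0 = 1"
  using fps_nth_E_0[of 1] by (simp add: A5_def sec_def)

text \<open>The cube of \<open>E 1\<close> has no exponents congruent to \<open>2\<close> modulo \<open>5\<close>.\<close>

lemma A5_C5: "A5 * C5 = - (E 5 ^ 2)"
proof -
  have "E 1 ^ 3 = D5 (A5 ^ 3 - 3 * q * E 5 * C5 ^ 2) + q * D5 (q * C5 ^ 3 - 3 * A5 ^ 2 * E 5)
     + q ^ 2 * D5 (3 * A5 ^ 2 * C5 + 3 * A5 * E 5 ^ 2) + q ^ 3 * D5 (- (E 5 ^ 3) - 6 * A5 * E 5 * C5) + q ^ 4 * D5 (3 * A5 * C5 ^ 2 + 3 * E 5 ^ 2 * C5)"
    unfolding E1_dissect D5_simps by algebra
  then have "sec 5 2 (E 1 ^ 3) = 3 * A5 ^ 2 * C5 + 3 * A5 * E 5 ^ 2" by (rule sec5_eq)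
  then have "3 * A5 * (A5 * C5 + E 5 ^ 2) = 0"
    unfolding sec_E1_cube by (simp add: algebra_simps power2_eq_square)
  moreover have "A5 \<noteq> 0" using A5_nth_0 by auto
  ultimately have "A5 * C5 + E 5 ^ 2 = 0" by simp
  then show ?thesis by (simp add: eq_neg_iff_add_eq_0)
qed

lemma E2_dissect: "E 2 = D5 (fps_compose A5 (q ^ 2)) - q ^ 2 * D5 (E 10) + q ^ 4 * D5 (fps_compose C5 (q ^ 2))"
proof -
  have comm: "fps_compose (D5 f) (q ^ 2) = D5 (fps_compose f (q ^ 2))" for f
  proof (rule fps_ext)
    fix n :: nat
    have "2 dvd n \<and> 5 dvd n div 2 \<longleftrightarrow> 5 dvd n \<and> 2 dvd n div 5" by presburger
    moreover have "n div 2 div 5 = n div 5 div 2" by (simp add: div_mult2_eq [symmetric] mult.commute)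
    ultimately show "fps_nth (fps_compose (D5 f) (q ^ 2)) n = fps_nth (D5 (fps_compose f (q ^ 2))) n"
      by (auto simp: compose_X_power_nth)
  qed
  have "E 2 = fps_compose (E 1) (q ^ 2)" using E_compose[of 2 1] by simp
  also have "\<dots> = fps_compose (D5 A5) (q ^ 2) - fps_compose q (q ^ 2) * fps_compose (D5 (E 5)) (q ^ 2) +
      fps_compose q (q ^ 2) ^ 2 * fps_compose (D5 C5) (q ^ 2)"
    by (subst E1_dissect) (simp add: fps_compose_add_distrib fps_compose_sub_distrib fps_compose_mult_distrib compose_X_power_hom)
  finally show ?thesis unfolding comm using E_compose[of 2 5] by (simp flip: power_mult)
qed

lemma A5_C5_2: "fps_compose A5 (q ^ 2) * fps_compose C5 (q ^ 2) = - (E 10 ^ 2)"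
proof -
  have "fps_compose (A5 * C5) (q ^ 2) = fps_compose (- (E 5 ^ 2)) (q ^ 2)" by (simp only: A5_C5)
  then show ?thesis using E_compose[of 2 5]
    by (simp add: fps_compose_mult_distrib fps_compose_uminus compose_X_power_hom)
qed

text \<open>The two sides of \<open>E\<^sub>2\<^sup>2 = \<psi> E\<^sub>1\<close>, dissected.\<close>

lemma psi_classes:
  defines "u2 \<equiv> fps_compose A5 (q ^ 2)" and "v2 \<equiv> fps_compose C5 (q ^ 2)"
  shows "u2 ^ 2 = f23 * A5 + q * psi5 * C5" "- 2 * q * E 10 * v2 = f14 * A5 - f23 * E 5"
    "- 2 * u2 * E 10 = f23 * C5 - f14 * E 5" "q * v2 ^ 2 = f14 * C5 + psi5 * A5"
proof -
  have "E 2 ^ 2 = D5 (u2 ^ 2) + q * D5 (- 2 * q * E 10 * v2) + q ^ 2 * D5 (- 2 * u2 * E 10) + q ^ 3 * D5 (q * v2 ^ 2) + q ^ 4 * D5 (E 10 ^ 2 + 2 * (u2 * v2))"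
    unfolding E2_dissect u2_def v2_def D5_simps by algebra
  note 1 = sec5_eq[OF this]
  have "psi * E 1 = D5 (f23 * A5 + q * psi5 * C5) + q * D5 (f14 * A5 - f23 * E 5) + q ^ 2 * D5 (f23 * C5 - f14 * E 5)
      + q ^ 3 * D5 (f14 * C5 + psi5 * A5) + q ^ 4 * D5 (- psi5 * E 5)"
    unfolding E1_dissect D5_simps by (subst psi_dissect) algebra
  note 2 = sec5_eq[OF this]
  show "u2 ^ 2 = f23 * A5 + q * psi5 * C5" "- 2 * q * E 10 * v2 = f14 * A5 - f23 * E 5"
    "- 2 * u2 * E 10 = f23 * C5 - f14 * E 5" "q * v2 ^ 2 = f14 * C5 + psi5 * A5"
    using 1(1-4) 2(1-4) unfolding psi_prod by simp_all
qed

section \<open>Norms over the fifth roots of unity\<close>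

definition rt :: "nat \<Rightarrow> complex" where
  "rt i = exp (2 * of_real pi * \<i> * of_nat i / of_nat 5)"

lemma rt_mult: "rt (i * j) = rt i ^ j"
  unfolding rt_def exp_of_nat_mult [symmetric] by (simp add: field_simps)

lemma rt_eq_1_iff: "rt i = 1 \<longleftrightarrow> 5 dvd i"
  unfolding rt_def by (rule complex_root_unity_eq_1) simp

lemma rt_5: "rt 5 = 1" and rt_0: "rt 0 = 1"
  by (simp_all add: rt_eq_1_iff)

lemma rt_sum:
  assumes "\<not> 5 dvd k"
  shows "1 + rt k + rt k ^ 2 + rt k ^ 3 + rt k ^ 4 = 0"
proof -
  have "rt k \<noteq> 1" using assms by (simp add: rt_eq_1_iff)
  moreover have "(rt k - 1) * (1 + rt k + rt k ^ 2 + rt k ^ 3 + rt k ^ 4) = rt k ^ 5 - 1" by algebra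
  moreover have "rt k ^ 5 = 1" using rt_mult[of 5 k] rt_mult[of k 5] rt_5 by (simp add: mult.commute)
  ultimately show ?thesis by simp
qed

definition tw :: "nat \<Rightarrow> complex fps \<Rightarrow> complex fps" where
  "tw i f = fps_compose f (fps_const (rt i) * q)"

lemma tw_nth: "fps_nth (tw i f) n = rt i ^ n * fps_nth f n"
  by (simp add: tw_def fps_compose_linear)

lemma tw_hom: "tw i (f * g) = tw i f * tw i g" "tw i (f + g) = tw i f + tw i g" "tw i (f - g) = tw i f - tw i g"
  by (simp_all add: tw_def fps_compose_mult_distrib fps_compose_add_distrib fps_compose_sub_distrib)

lemma tw_D5: "tw i (D5 f) = D5 f"
proof (rule fps_ext)
  fix n
  have "rt i ^ n = 1" if "5 dvd n"
  proof -
    from that obtain m where "n = 5 * m" by auto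
    then show ?thesis unfolding rt_mult [symmetric] rt_eq_1_iff by simp
  qed
  then show "fps_nth (tw i (D5 f)) n = fps_nth (D5 f) n" by (simp add: tw_nth compose_X_power_nth)
qed

lemma tw_q_power: "tw i (q ^ k) = fps_const (rt i ^ k) * q ^ k"
  by (rule fps_ext) (simp add: tw_nth)

lemma eqm_tw: "eqm N f g \<Longrightarrow> eqm N (tw i f) (tw i g)"
  by (simp add: eqm_def tw_nth)

text \<open>The product of \<open>f(\<zeta> q)\<close> over the fifth roots of unity \<open>\<zeta>\<close>.\<close>

definition norm5 :: "complex fps \<Rightarrow> complex fps" where
  "norm5 f = tw 0 f * tw 1 f * tw 2 f * tw 3 f * tw 4 f"

lemma eqm_norm5: "eqm N f g \<Longrightarrow> eqm N (norm5 f) (norm5 g)"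
  unfolding norm5_def by (intro eqm_mult eqm_tw)

lemma norm5_mult: "norm5 (f * g) = norm5 f * norm5 g"
  by (simp add: norm5_def tw_hom ac_simps)

lemma norm5_1: "norm5 1 = 1"
  by (simp add: norm5_def tw_def)

lemma norm5_prod: "norm5 (\<Prod>i\<in>A. f i) = (\<Prod>i\<in>A. norm5 (f i))"
proof (induction A rule: infinite_finite_induct)
qed (simp_all add: norm5_mult norm5_1)

lemma norm5_factor:
  "norm5 (1 - q ^ k) = (if 5 dvd k then (1 - q ^ k) ^ 5 else 1 - q ^ (5 * k))"
proof -
  define z where "z = fps_const (rt k)"
  have "tw i (1 - q ^ k) = 1 - z ^ i * q ^ k" for i
  proof -
    have "rt i ^ k = rt k ^ i" by (simp add: rt_mult [symmetric] mult.commute)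
    then show ?thesis unfolding tw_hom tw_q_power z_def by (simp add: tw_def fps_const_power)
  qed
  then have n: "norm5 (1 - q ^ k) = (1 - q ^ k) * (1 - z * q ^ k) * (1 - z ^ 2 * q ^ k) * (1 - z ^ 3 * q ^ k) * (1 - z ^ 4 * q ^ k)"
    by (simp add: norm5_def)
  show ?thesis
  proof (cases "5 dvd k")
    case True
    then obtain m where m: "k = 5 * m" by auto
    have "rt k = 1" unfolding m rt_mult rt_5 by simp
    then have "z = 1" by (simp add: z_def)
    then show ?thesis using True n by (simp add: eval_nat_numeral ac_simps)
  next
    case False
    have "1 + z + z ^ 2 + z ^ 3 + z ^ 4 = fps_const (1 + rt k + rt k ^ 2 + rt k ^ 3 + rt k ^ 4)"
      by (simp add: z_def fps_const_power fps_const_add [symmetric] del: fps_const_add)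
    then have "1 + z + z ^ 2 + z ^ 3 + z ^ 4 = 0" using rt_sum[OF False] by simp
    then have id: "(1 - y) * (1 - z * y) * (1 - z ^ 2 * y) * (1 - z ^ 3 * y) * (1 - z ^ 4 * y) = 1 - y ^ 5" for y
      by algebra
    then show ?thesis using False unfolding n id by (simp add: power_mult [symmetric] mult.commute)
  qed
qed

text \<open>The factors with k prime to 5 give the product of 1 - q^(5 k), which is E_5 / E_25; the
  multiples of 5 give E_5^5. Blocks of five consecutive factors make this a finite identity.\<close>

lemma norm5_E1: "norm5 (E 1) * E 25 = E 5 ^ 6"
proof (rule eqm_eqI)
  fix N :: nat
  have fin: "norm5 (qpn 1 1 1 (N * 5)) * qpn 1 25 25 N = qpn 1 5 5 (N * 5) * qpn 1 5 5 N ^ 5"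
  proof -
    let ?g = "\<lambda>k. norm5 (1 - q ^ Suc k)" and ?h = "\<lambda>k. 1 - q ^ (5 * Suc k)"
    have blk: "{k * 5..<k * 5 + 5} = {5 * k, 5 * k + 1, 5 * k + 2, 5 * k + 3, 5 * k + 4}" for k :: nat by auto
    have "norm5 (qpn 1 1 1 (N * 5)) = (\<Prod>k<N * 5. ?g k)"
      by (simp add: qpn_def norm5_prod)
    also have "\<dots> = (\<Prod>j<N. \<Prod>k\<in>{j * 5..<j * 5 + 5}. ?g k)" by (rule prod.nat_group [symmetric])
    finally have 1: "norm5 (qpn 1 1 1 (N * 5)) = (\<Prod>j<N. \<Prod>k\<in>{j * 5..<j * 5 + 5}. ?g k)" .
    have "qpn 1 5 5 (N * 5) = (\<Prod>k<N * 5. ?h k)" by (simp add: qpn_def)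
    also have "\<dots> = (\<Prod>j<N. \<Prod>k\<in>{j * 5..<j * 5 + 5}. ?h k)" by (rule prod.nat_group [symmetric])
    finally have 2: "qpn 1 5 5 (N * 5) = (\<Prod>j<N. \<Prod>k\<in>{j * 5..<j * 5 + 5}. ?h k)" .
    have "(\<Prod>k\<in>{j * 5..<j * 5 + 5}. ?g k) * (1 - q ^ (25 + 25 * j)) = (\<Prod>k\<in>{j * 5..<j * 5 + 5}. ?h k) * (1 - q ^ (5 + 5 * j)) ^ 5" for j
    proof -
      have "\<not> 5 dvd Suc (5 * j)" "\<not> 5 dvd Suc (5 * j + 1)" "\<not> 5 dvd Suc (5 * j + 2)" "\<not> 5 dvd Suc (5 * j + 3)" "5 dvd Suc (5 * j + 4)"
        by presburger+
      then have "?g (5 * j) = ?h (5 * j)" "?g (5 * j + 1) = ?h (5 * j + 1)" "?g (5 * j + 2) = ?h (5 * j + 2)" "?g (5 * j + 3) = ?h (5 * j + 3)"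
        "?g (5 * j + 4) = (1 - q ^ Suc (5 * j + 4)) ^ 5"
        unfolding norm5_factor by simp_all
      moreover have "25 + 25 * j = 5 * Suc (5 * j + 4)" "5 + 5 * j = Suc (5 * j + 4)" by simp_all
      moreover have "(\<Prod>k\<in>{5 * j, 5 * j + 1, 5 * j + 2, 5 * j + 3, 5 * j + 4}. f k) = f (5 * j) * f (5 * j + 1) * f (5 * j + 2) * f (5 * j + 3) * f (5 * j + 4)" for f :: "nat \<Rightarrow> complex fps"
        by (simp add: ac_simps)
      ultimately show ?thesis unfolding blk by (simp only: ac_simps)
    qed
    then have "(\<Prod>j<N. (\<Prod>k\<in>{j * 5..<j * 5 + 5}. ?g k) * (1 - q ^ (25 + 25 * j))) = (\<Prod>j<N. (\<Prod>k\<in>{j * 5..<j * 5 + 5}. ?h k) * (1 - q ^ (5 + 5 * j)) ^ 5)"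
      by (simp only:)
    then show ?thesis unfolding 1 2 by (simp add: prod.distrib qpn_def prod_power_distrib)
  qed
  have "eqm N (norm5 (E 1) * E 25) (norm5 (qpn 1 1 1 (N * 5)) * qpn 1 25 25 N)"
    by (intro eqm_mult eqm_norm5) (auto simp: E_eq_qp intro!: eqm_qp)
  also have "norm5 (qpn 1 1 1 (N * 5)) * qpn 1 25 25 N = qpn 1 5 5 (N * 5) * qpn 1 5 5 N ^ 5" by (rule fin)
  also have "eqm N \<dots> (E 5 * E 5 ^ 5)"
    by (intro eqm_mult eqm_power eqm_sym[of N "E 5"]) (auto simp: E_eq_qp intro!: eqm_qp)
  finally show "eqm N (norm5 (E 1) * E 25) (E 5 ^ 6)" by (simp flip: power_Suc)
qed

text \<open>The norm of a + b + c, with b and c of classes 1 and 2, is a^5 + b^5 + c^5 - 5 a b^3 c +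
  5 a^2 b c^2. Since a c = -b^2, both mixed terms become 5 b^5, whence the coefficient 11.\<close>

lemma norm5_E1_dissect: "norm5 (E 1) = D5 (A5 ^ 5 - 11 * q * E 5 ^ 5 + q ^ 2 * C5 ^ 5)"
proof -
  define a b c z where "a = D5 A5" and "b = - (q * D5 (E 5))" and "c = q ^ 2 * D5 C5" and "z = fps_const (rt 1)"
  have ac: "a * c = - (b ^ 2)"
  proof -
    have "D5 (A5 * C5) = D5 (- (E 5 ^ 2))" by (simp only: A5_C5)
    then show ?thesis unfolding D5_simps a_def b_def c_def by (simp add: power2_eq_square algebra_simps)
  qed
  have "tw i (E 1) = a + z ^ i * b + z ^ (2 * i) * c" for i
  proof -
    have r: "fps_const (rt i) = z ^ i" using rt_mult[of 1 i] by (simp add: z_def fps_const_power)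
    have "tw i q = z ^ i * q" using tw_q_power[of i 1] r by simp
    moreover have "tw i (q ^ 2) = z ^ (2 * i) * q ^ 2"
      using tw_q_power[of i 2] r by (simp add: fps_const_power [symmetric] power_mult [symmetric] mult.commute del: fps_const_power)
    ultimately show ?thesis
      by (subst E1_dissect) (simp add: tw_hom tw_D5 a_def b_def c_def algebra_simps)
  qed
  then have n: "norm5 (E 1) = (a + b + c) * (a + z * b + z ^ 2 * c) * (a + z ^ 2 * b + z ^ 4 * c) * (a + z ^ 3 * b + z ^ 6 * c) * (a + z ^ 4 * b + z ^ 8 * c)"
    by (simp add: norm5_def)
  have "1 + z + z ^ 2 + z ^ 3 + z ^ 4 = fps_const (1 + rt 1 + rt 1 ^ 2 + rt 1 ^ 3 + rt 1 ^ 4)"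
    by (simp add: z_def fps_const_power fps_const_add [symmetric] del: fps_const_add)
  then have z0: "1 + z + z ^ 2 + z ^ 3 + z ^ 4 = 0" using rt_sum[of 1] by simp
  have z5: "z ^ 5 = 1" using z0 by algebra
  have z68: "z ^ 6 = z" "z ^ 8 = z ^ 3" using z5 by algebra+
  \<comment> \<open>Pairing each root of unity with its inverse leaves only the root s of s^2 + s -
    1.\<close>
  define s where "s = z + z ^ 4"
  have s2: "s ^ 2 = 1 - s" using z0 z5 unfolding s_def by algebra
  have p1: "(a + z * b + z ^ 2 * c) * (a + z ^ 4 * b + z ^ 3 * c) = a ^ 2 + b ^ 2 + c ^ 2 + s * (a * b + b * c) + (- 1 - s) * (a * c)"
    using z0 z5 unfolding s_def by algebra
  have p2: "(a + z ^ 2 * b + z ^ 4 * c) * (a + z ^ 3 * b + z * c) = a ^ 2 + b ^ 2 + c ^ 2 + (- 1 - s) * (a * b + b * c) + s * (a * c)"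
    using z0 z5 unfolding s_def by algebra
  have "norm5 (E 1) = (a + b + c) * (((a + z * b + z ^ 2 * c) * (a + z ^ 4 * b + z ^ 3 * c)) * ((a + z ^ 2 * b + z ^ 4 * c) * (a + z ^ 3 * b + z * c)))"
    unfolding n z68 by (simp only: mult.assoc mult.commute mult.left_commute)
  also have "\<dots> = a ^ 5 + 11 * b ^ 5 + c ^ 5" unfolding p1 p2 using ac s2 by algebra
  also have "\<dots> = D5 (A5 ^ 5 - 11 * q * E 5 ^ 5 + q ^ 2 * C5 ^ 5)"
    unfolding D5_simps a_def b_def c_def by (simp add: power_mult_distrib power_mult [symmetric])
  finally show ?thesis .
qed

text \<open>Two evaluations of the same norm. Divided by \<open>q * E 5 ^ 6\<close> this is
  Ramanujan's formula for 1 / R(q)^5 - 11 - R(q)^5.\<close>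

theorem ramanujan_quintic: "(A5 ^ 5 - 11 * q * E 5 ^ 5 + q ^ 2 * C5 ^ 5) * E 5 = E 1 ^ 6"
proof -
  have "D5 ((A5 ^ 5 - 11 * q * E 5 ^ 5 + q ^ 2 * C5 ^ 5) * E 5) = D5 (E 1 ^ 6)"
    using norm5_E1 E_compose[of 5 5] E_compose[of 5 1] unfolding norm5_E1_dissect by (simp add: D5_simps)
  then show ?thesis by (simp only: D5_eq_iff)
qed

section \<open>Rational functions of the parameter\<close>

text \<open>The relations are overdetermined. \<open>r3\<close> gives \<open>p1\<close> and
  \<open>r0\<close> gives \<open>p0\<close>; then \<open>r2\<close> factors into
  \<open>X ^ 2 - Y\<close> and an equation linear in k. The first factor is excluded by
  \<open>r1\<close>, which would force q = 0.\<close>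

lemma k_parametrization:
  fixes q X Y p0 p1 :: "'a :: field_char_0"
  assumes nz: "q \<noteq> 0" "X \<noteq> 0" "Y \<noteq> 0"
    and r0: "Y ^ 2 = p0 * X - q / X" and r1: "2 * q / Y = p1 * X - p0"
    and r2: "2 * Y = p1 + p0 / X" and r3: "q / Y ^ 2 = X - p1 / X"
  defines "k \<equiv> q / (X * Y ^ 2)"
  shows "k \<noteq> 0" "1 + k \<noteq> 0" "1 - k \<noteq> 0" "Y * (1 + k) = X ^ 2 * (1 - k)"
    "q * (1 + k) ^ 2 = X ^ 5 * (k * (1 - k) ^ 2)" "p1 = X ^ 2 * (1 - k)" "p0 * (1 + k) = X ^ 3 * (1 - k) ^ 2"
proof -
  have q: "q = k * (X * Y ^ 2)" using nz by (simp add: k_def)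
  show p1: "p1 = X ^ 2 * (1 - k)"
    using r3 nz unfolding q by (simp add: field_simps power2_eq_square)
  have p0: "p0 * X ^ 2 = Y ^ 2 * X + q" using r0 nz by (simp add: field_simps power2_eq_square)
  have p0': "p0 = (Y ^ 2 * X + q) / X ^ 2" using p0 nz by (simp add: field_simps)
  have 1: "2 * Y * X ^ 3 = X ^ 5 * (1 - k) + (Y ^ 2 * X + q)"
    using r2 nz unfolding p1 p0' by (simp add: field_simps eval_nat_numeral)
  have "X ^ 2 \<noteq> Y"
  proof
    assume Y: "X ^ 2 = Y"
    have "2 * q = Y * (p1 * X - p0)"
      using r1 nz by (simp add: field_simps)
    then have "2 * q * X ^ 2 = Y * (p1 * X ^ 3 - p0 * X ^ 2)" by algebra
    then have "4 * q * X ^ 2 = 0"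
      unfolding p1 p0 q Y [symmetric] by (simp add: algebra_simps eval_nat_numeral)
    then show False using nz by simp
  qed
  moreover have "(X ^ 2 - Y) * ((X ^ 2 - Y) - k * (X ^ 2 + Y)) = 0"
  proof -
    have "X * ((X ^ 2 - Y) * ((X ^ 2 - Y) - k * (X ^ 2 + Y))) = 0"
      using 1 unfolding q by algebra
    then show ?thesis using nz by simp
  qed
  ultimately have Yk: "X ^ 2 - Y = k * (X ^ 2 + Y)" by simp
  then show Yk': "Y * (1 + k) = X ^ 2 * (1 - k)" by algebra
  show "k \<noteq> 0" using nz by (simp add: k_def)
  show k1: "1 + k \<noteq> 0"
  proof
    assume "1 + k = 0"
    then have "k = - 1" by (simp add: eq_neg_iff_add_eq_0 add.commute)
    then show False using Yk' nz by simp
  qed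
  show "1 - k \<noteq> 0" using Yk' nz k1 by auto
  show "q * (1 + k) ^ 2 = X ^ 5 * (k * (1 - k) ^ 2)"
    unfolding q using Yk' by algebra
  have "(p0 * (1 + k)) * (X ^ 2 * (1 + k)) = (X ^ 3 * (1 - k) ^ 2) * (X ^ 2 * (1 + k))"
    using Yk' p0 q by algebra
  then show "p0 * (1 + k) = X ^ 3 * (1 - k) ^ 2" using nz k1 by simp
qed

text \<open>Under k -> -1/k the quantity a = 1/k - k is fixed, while \<open>B\<close> and
  \<open>B2\<close> become their negative reciprocals; hence both left-hand combinations must be
  rational in a.\<close>

lemma T_factor:
  fixes k :: "'a :: field_char_0"
  assumes "k \<noteq> 0" "1 + k \<noteq> 0" "1 - k \<noteq> 0"
  defines "a \<equiv> (1 - k ^ 2) / k" and "B \<equiv> k * (1 - k) ^ 2 / (1 + k) ^ 2" and "B2 \<equiv> k ^ 2 * (1 + k) / (1 - k)"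
  shows "(1 / B - 11 - B) * a ^ 2 = (a + 1) * (a - 4) ^ 2"
    and "(1 / B2 - 11 - B2) * a = (a + 1) ^ 2 * (a - 4)"
    and "a \<noteq> 0"
proof -
  have e: "1 - k ^ 2 = (1 - k) * (1 + k)" by algebra
  show "a \<noteq> 0" unfolding a_def e using assms by simp
  show "(1 / B - 11 - B) * a ^ 2 = (a + 1) * (a - 4) ^ 2"
    unfolding a_def B_def e using assms(1-3) by (simp add: divide_simps) algebra
  show "(1 / B2 - 11 - B2) * a = (a + 1) ^ 2 * (a - 4)"
    unfolding a_def B2_def e using assms(1-3) by (simp add: divide_simps) algebra
qed

text \<open>\<open>u\<close> and \<open>v\<close> will be coordinates of the normalised psi, and
  \<open>s0\<close> to \<open>s4\<close> those of its fourth power. The last four values are the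
  coordinates of class 0 after multiplication by eta^j for j = 1, ..., 4; there k combines to
  a.\<close>

lemma M_values:
  fixes k :: "'a :: field_char_0"
  assumes nz: "k \<noteq> 0" "1 + k \<noteq> 0" "1 - k \<noteq> 0"
  defines "a \<equiv> (1 - k) * (1 + k) / k" and "B \<equiv> k * (1 - k) ^ 2 / (1 + k) ^ 2"
    and "u \<equiv> (1 + k) / k" and "v \<equiv> (1 + k) ^ 2 / (k * (1 - k))"
  defines "s0 \<equiv> 1 + 12 * a + 6 * a ^ 2" and "s1 \<equiv> (6 + 4 * a) * (1 + k) ^ 2 / k + 4 * (1 + k) * (1 - k) ^ 2 / k ^ 2"
    and "s2 \<equiv> (1 + k) ^ 4 / k ^ 2 + (4 + 12 * a) * (1 + k) / k"
    and "s3 \<equiv> (4 + 12 * a) * (1 + k) ^ 2 / (k * (1 - k)) + (1 + k) ^ 2 * (1 - k) ^ 2 / k ^ 3"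
    and "s4 \<equiv> 4 * (1 + k) ^ 4 / (k ^ 2 * (1 - k)) + (6 + 4 * a) * (1 + k) ^ 2 / k ^ 2"
  shows "B * u * v = a"
    "2 * (1 + 2 * a) * (B * v ^ 2) + B * (4 * u ^ 3 + 4 * v ^ 2) = s1"
    "4 * (1 + 2 * a) * u + (B * v ^ 2) ^ 2 + 4 * a * u = s2"
    "4 * (1 + 2 * a) * v + 4 * a * v + B * u ^ 4 = s3"
    "2 * (1 + 2 * a) * u ^ 2 + 4 * (B * v ^ 3) + 4 * u ^ 2 = s4"
    "- s0 + s1 - B * s4 = 23 - 4 * a - 2 * a ^ 2"
    "- s0 - 2 * s1 + s2 + B * s3 + 2 * (B * s4) = - 25"
    "5 * s0 - (B + 3) * s2 + (1 - 3 * B) * s3 = a ^ 3 + 4 * a + 37 + 32 / a"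
    "- 5 * s0 + (B + 8) * s1 + (4 * B + 2) * s2 + (2 * B - 4) * s3 + (1 - 8 * B) * s4 = - 125"
proof -
  show "B * u * v = a" unfolding B_def u_def v_def a_def using nz by (simp add: divide_simps) algebra
  show "2 * (1 + 2 * a) * (B * v ^ 2) + B * (4 * u ^ 3 + 4 * v ^ 2) = s1"
    unfolding B_def u_def v_def a_def s1_def using nz by (simp add: divide_simps) algebra
  show "4 * (1 + 2 * a) * u + (B * v ^ 2) ^ 2 + 4 * a * u = s2"
    unfolding B_def u_def v_def a_def s2_def using nz by (simp add: divide_simps) algebra
  show "4 * (1 + 2 * a) * v + 4 * a * v + B * u ^ 4 = s3"
    unfolding B_def u_def v_def a_def s3_def using nz by (simp add: divide_simps) algebra
  show "2 * (1 + 2 * a) * u ^ 2 + 4 * (B * v ^ 3) + 4 * u ^ 2 = s4"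
    unfolding B_def u_def v_def a_def s4_def using nz by (simp add: divide_simps) algebra
  have Bs3: "B * s3 = (4 + 12 * a) * (1 - k) + (1 - k) ^ 4 / k ^ 2"
    unfolding B_def a_def s3_def using nz by (simp add: divide_simps) algebra
  have Bs4: "B * s4 = 4 * (1 + k) ^ 2 * (1 - k) / k + (6 + 4 * a) * (1 - k) ^ 2 / k"
    unfolding B_def a_def s4_def using nz by (simp add: divide_simps) algebra
  show "- s0 + s1 - B * s4 = 23 - 4 * a - 2 * a ^ 2"
    unfolding Bs4 unfolding s0_def s1_def a_def using nz by (simp add: divide_simps) algebra
  show "- s0 - 2 * s1 + s2 + B * s3 + 2 * (B * s4) = - 25"
    unfolding Bs4 Bs3 unfolding s0_def s1_def s2_def a_def using nz by (simp add: divide_simps) algebra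
  have Bs2: "B * s2 = (1 - k) ^ 2 * (1 + k) ^ 2 / k + (4 + 12 * a) * (1 - k) ^ 2 / (1 + k)"
    unfolding B_def a_def s2_def using nz by (simp add: divide_simps) algebra
  have Bs1: "B * s1 = (6 + 4 * a) * (1 - k) ^ 2 + 4 * (1 - k) ^ 4 / (k * (1 + k))"
    unfolding B_def a_def s1_def using nz by (simp add: divide_simps) algebra
  have "5 * s0 - (B + 3) * s2 + (1 - 3 * B) * s3 = 5 * s0 - B * s2 - 3 * s2 + s3 - 3 * (B * s3)" by algebra
  also have "\<dots> = a ^ 3 + 4 * a + 37 + 32 / a"
    unfolding Bs2 Bs3 unfolding s0_def s2_def s3_def a_def using nz by (simp add: divide_simps) algebra
  finally show "5 * s0 - (B + 3) * s2 + (1 - 3 * B) * s3 = a ^ 3 + 4 * a + 37 + 32 / a" .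
  have "- 5 * s0 + (B + 8) * s1 + (4 * B + 2) * s2 + (2 * B - 4) * s3 + (1 - 8 * B) * s4 =
    - 5 * s0 + B * s1 + 8 * s1 + 4 * (B * s2) + 2 * s2 + 2 * (B * s3) - 4 * s3 + s4 - 8 * (B * s4)" by algebra
  also have "\<dots> = - 125"
    unfolding Bs1 Bs2 Bs3 Bs4 unfolding s0_def s1_def s2_def s3_def s4_def a_def using nz by (simp add: divide_simps) algebra
  finally show "- 5 * s0 + (B + 8) * s1 + (4 * B + 2) * s2 + (2 * B - 4) * s3 + (1 - 8 * B) * s4 = - 125" .
qed

text \<open>\<open>R\<^sub>j(a) / (a - 4)\<^sup>2\<^sup>j\<close> will be the part of \<open>psh ^ 4 / eta ^ j\<close> with exponents divisible by \<open>5\<close>.\<close>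

definition R1 :: "'a :: field_char_0 \<Rightarrow> 'a" where
  "R1 a = 160 * a + 125 * a ^ 2 + 95 * a ^ 3 + 5 * a ^ 4"

definition R2 :: "'a :: field_char_0 \<Rightarrow> 'a" where
  "R2 a = 512 * a + 3744 * a ^ 2 + 1936 * a ^ 3 + 1439 * a ^ 4 + 236 * a ^ 5 + 1 * a ^ 6"

definition R3 :: "'a :: field_char_0 \<Rightarrow> 'a" where
  "R3 a = 26880 * a ^ 2 + 64000 * a ^ 3 + 37200 * a ^ 4 + 21400 * a ^ 5 + 5925 * a ^ 6 + 230 * a ^ 7"

definition R4 :: "'a :: field_char_0 \<Rightarrow> 'a" where
  "R4 a = 114688 * a ^ 2 + 761856 * a ^ 3 + 1049088 * a ^ 4 + 711680 * a ^ 5 + 338880 * a ^ 6 + 118048 * a ^ 7 + 10931 * a ^ 8 + 128 * a ^ 9"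

definition R5 :: "'a :: field_char_0 \<Rightarrow> 'a" where
  "R5 a = 65536 * a ^ 2 + 5832704 * a ^ 3 + 16777216 * a ^ 4 + 17997824 * a ^ 5 + 12919296 * a ^ 6 + 5799936 * a ^ 7 + 2137104 * a ^ 8 + 327416 * a ^ 9 + 11899 * a ^ 10 + 46 * a ^ 11"

definition R6 :: "'a :: field_char_0 \<Rightarrow> 'a" where
  "R6 a = 20971520 * a ^ 3 + 177930240 * a ^ 4 + 334888960 * a ^ 5 + 322109440 * a ^ 6 + 227164160 * a ^ 7 + 103681280 * a ^ 8 + 37738240 * a ^ 9 + 7816960 * a ^ 10 + 549440 * a ^ 11 + 8785 * a ^ 12 + 10 * a ^ 13"

text \<open>\<open>m1\<close> to \<open>m6\<close> stand for the classes of psi^4 / eta^j. Each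
  premise is the quintic equation of eta multiplied by psi^4 / eta^j, with the known values for
  nonnegative powers inserted.\<close>

lemma R_recursion:
  fixes a :: "'a :: field_char_0"
  assumes nz: "a \<noteq> 0" "a + 1 \<noteq> 0" "a - 4 \<noteq> 0" and T: "T * a ^ 2 = (a + 1) * (a - 4) ^ 2"
    and M: "T * m1 = - 125 + 5 * (a ^ 3 + 4 * a + 37 + 32 / a) + 15 * (- 25) + 25 * (23 - 4 * a - 2 * a ^ 2) + 25 * (1 + 12 * a + 6 * a ^ 2)"
     "T * m2 = (a ^ 3 + 4 * a + 37 + 32 / a) + 5 * (- 25) + 15 * (23 - 4 * a - 2 * a ^ 2) + 25 * (1 + 12 * a + 6 * a ^ 2) + 25 * m1"
     "T * m3 = - 25 + 5 * (23 - 4 * a - 2 * a ^ 2) + 15 * (1 + 12 * a + 6 * a ^ 2) + 25 * m1 + 25 * m2"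
     "T * m4 = (23 - 4 * a - 2 * a ^ 2) + 5 * (1 + 12 * a + 6 * a ^ 2) + 15 * m1 + 25 * m2 + 25 * m3"
     "T * m5 = (1 + 12 * a + 6 * a ^ 2) + 5 * m1 + 15 * m2 + 25 * m3 + 25 * m4"
     "T * m6 = m1 + 5 * m2 + 15 * m3 + 25 * m4 + 25 * m5"
  shows "m1 = R1 a / (a - 4) ^ 2" "m6 = R6 a / (a - 4) ^ 12"
proof -
  define c where "c = a - 4"
  have c: "c \<noteq> 0" using nz by (simp add: c_def)
  have T': "T = (a + 1) * c ^ 2 / a ^ 2" using T nz by (simp add: c_def field_simps)
  \<comment> \<open>Division by \<open>T\<close> adds \<open>c ^ 2\<close> to the denominator. The
    factor a + 1 has to cancel, and the third premise is this divisibility; it holds at every stage,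
    so the only pole is at a = 4.\<close>
  have solve: "m = r / c ^ (2 * n + 2)" if "T * m = x" "x = y / c ^ (2 * n)" "r * (a + 1) = a ^ 2 * y" for m r x y n
  proof -
    have "((a + 1) * c ^ 2) * m = a ^ 2 * (y / c ^ (2 * n))" using that(1,2) nz unfolding T' by (simp add: field_simps)
    also have "\<dots> = (a + 1) * (r / c ^ (2 * n))" using that(3) by (simp add: mult.commute)
    finally have "(a + 1) * (c ^ 2 * m) = (a + 1) * (r / c ^ (2 * n))" by (simp only: mult.assoc)
    then have "c ^ 2 * m = r / c ^ (2 * n)" using nz(2) by (simp only: mult_cancel_left) simp
    then have "m = r / c ^ (2 * n) / c ^ 2" using c by (metis nonzero_mult_div_cancel_left power_not_zero)
    then show ?thesis by (simp only: power_add divide_divide_eq_left)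
  qed
  have 1: "m1 = R1 a / c ^ (2 * 0 + 2)"
  proof (rule solve[OF M(1)])
    show "- 125 + 5 * (a ^ 3 + 4 * a + 37 + 32 / a) + 15 * (- 25) + 25 * (23 - 4 * a - 2 * a ^ 2) + 25 * (1 + 12 * a + 6 * a ^ 2)
        = ((5 * a ^ 4 + 100 * a ^ 3 + 220 * a ^ 2 + 285 * a + 160) / a) / c ^ (2 * 0)"
      using nz by (simp add: field_simps eval_nat_numeral)
    have "R1 a * (a + 1) = a * (5 * a ^ 4 + 100 * a ^ 3 + 220 * a ^ 2 + 285 * a + 160)" unfolding R1_def by algebra
    then show "R1 a * (a + 1) = a ^ 2 * ((5 * a ^ 4 + 100 * a ^ 3 + 220 * a ^ 2 + 285 * a + 160) / a)"
      using nz(1) by (simp add: power2_eq_square)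
  qed
  have 2: "m2 = R2 a / c ^ (2 * 1 + 2)"
  proof (rule solve[OF M(2)])
    show "a ^ 3 + 4 * a + 37 + 32 / a + 5 * (- 25) + 15 * (23 - 4 * a - 2 * a ^ 2) + 25 * (1 + 12 * a + 6 * a ^ 2) + 25 * m1
        = (((a ^ 4 + 4 * a ^ 2 + 37 * a + 32) * c ^ 2 + a * (5 * (- 25) * c ^ 2 + 15 * (23 - 4 * a - 2 * a ^ 2) * c ^ 2 + 25 * (1 + 12 * a + 6 * a ^ 2) * c ^ 2 + 25 * R1 a)) / a) / c ^ (2 * 1)"
      unfolding 1 using nz(1) c by (simp add: divide_simps) algebra
    have "R2 a * (a + 1) = a * ((a ^ 4 + 4 * a ^ 2 + 37 * a + 32) * c ^ 2 + a * (5 * (- 25) * c ^ 2 + 15 * (23 - 4 * a - 2 * a ^ 2) * c ^ 2 + 25 * (1 + 12 * a + 6 * a ^ 2) * c ^ 2 + 25 * R1 a))" unfolding R1_def R2_def c_def by algebra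
    then show "R2 a * (a + 1) = a ^ 2 * (((a ^ 4 + 4 * a ^ 2 + 37 * a + 32) * c ^ 2 + a * (5 * (- 25) * c ^ 2 + 15 * (23 - 4 * a - 2 * a ^ 2) * c ^ 2 + 25 * (1 + 12 * a + 6 * a ^ 2) * c ^ 2 + 25 * R1 a)) / a)"
      using nz(1) by (simp add: power2_eq_square)
  qed
  have 3: "m3 = R3 a / c ^ (2 * 2 + 2)"
  proof (rule solve[OF M(3)])
    let ?y = "(- 25) * c ^ 4 + 5 * (23 - 4 * a - 2 * a ^ 2) * c ^ 4 + 15 * (1 + 12 * a + 6 * a ^ 2) * c ^ 4 + 25 * R1 a * c ^ 2 + 25 * R2 a"
    show "(- 25) + 5 * (23 - 4 * a - 2 * a ^ 2) + 15 * (1 + 12 * a + 6 * a ^ 2) + 25 * m1 + 25 * m2 = ?y / c ^ (2 * 2)"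
      unfolding 1 2 using c by (simp add: divide_simps; algebra)
    show "R3 a * (a + 1) = a ^ 2 * ?y"
      unfolding R1_def R2_def R3_def c_def by algebra
  qed
  have 4: "m4 = R4 a / c ^ (2 * 3 + 2)"
  proof (rule solve[OF M(4)])
    let ?y = "(23 - 4 * a - 2 * a ^ 2) * c ^ 6 + 5 * (1 + 12 * a + 6 * a ^ 2) * c ^ 6 + 15 * R1 a * c ^ 4 + 25 * R2 a * c ^ 2 + 25 * R3 a"
    show "(23 - 4 * a - 2 * a ^ 2) + 5 * (1 + 12 * a + 6 * a ^ 2) + 15 * m1 + 25 * m2 + 25 * m3 = ?y / c ^ (2 * 3)"
      unfolding 1 2 3 using c by (simp add: divide_simps; algebra)
    show "R4 a * (a + 1) = a ^ 2 * ?y"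
      unfolding R1_def R2_def R3_def R4_def c_def by algebra
  qed
  have 5: "m5 = R5 a / c ^ (2 * 4 + 2)"
  proof (rule solve[OF M(5)])
    let ?y = "(1 + 12 * a + 6 * a ^ 2) * c ^ 8 + 5 * R1 a * c ^ 6 + 15 * R2 a * c ^ 4 + 25 * R3 a * c ^ 2 + 25 * R4 a"
    show "(1 + 12 * a + 6 * a ^ 2) + 5 * m1 + 15 * m2 + 25 * m3 + 25 * m4 = ?y / c ^ (2 * 4)"
      unfolding 1 2 3 4 using c by (simp add: divide_simps; algebra)
    show "R5 a * (a + 1) = a ^ 2 * ?y"
      unfolding R1_def R2_def R3_def R4_def R5_def c_def by algebra
  qed
  have 6: "m6 = R6 a / c ^ (2 * 5 + 2)"
  proof (rule solve[OF M(6)])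
    let ?y = "R1 a * c ^ 8 + 5 * R2 a * c ^ 6 + 15 * R3 a * c ^ 4 + 25 * R4 a * c ^ 2 + 25 * R5 a"
    show "m1 + 5 * m2 + 15 * m3 + 25 * m4 + 25 * m5 = ?y / c ^ (2 * 5)"
      unfolding 1 2 3 4 5 using c by (simp add: divide_simps; algebra)
    show "R6 a * (a + 1) = a ^ 2 * ?y"
      unfolding R1_def R2_def R3_def R4_def R5_def R6_def c_def by algebra
  qed
  have "2 * 0 + 2 = (2 :: nat)" "2 * 5 + 2 = (12 :: nat)" by simp_all
  with 1 6 show "m1 = R1 a / (a - 4) ^ 2" "m6 = R6 a / (a - 4) ^ 12" unfolding c_def by metis+
qed

section \<open>Decompositions into terms that become eta quotients\<close>

lemma R1_identity:
  fixes a :: "'a :: field_char_0"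
  assumes "a - 4 \<noteq> 0"
  shows "R1 a / (a - 4) ^ 2 = 5 * (a * (a - 4) + 6 * a + 25 * (a ^ 2 * (a + 1) / (a - 4) ^ 2))"
proof -
  have "R1 a = 5 * ((a * (a - 4) + 6 * a) * (a - 4) ^ 2 + 25 * (a ^ 2 * (a + 1)))"
    unfolding R1_def by algebra
  then show ?thesis using assms by (simp add: add_divide_distrib)
qed

text \<open>The left-hand side comes from the three terms of the first formula after removal of 5
  E_1 E_5^2. The right-hand summands are monomials in a, b, c, hence eta quotients; for this reason
  some keep powers of a in the numerator. \<open>D\<close> clears the largest denominators.\<close>

lemma R6_identity:
  fixes a b c :: "'a :: field_char_0"
  assumes b: "b = a + 1" and c: "c = a - 4" and nz: "a \<noteq> 0" "b \<noteq> 0" "c \<noteq> 0"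
  shows "- 1 + 6 * (b / c) + 25 * (b * c / a ^ 3) * (R6 a / c ^ 12) = 5 * (
      1
    + 6 / c
    + 50 / b
    + 625 * a / (b ^ 3 * c)
    + 50 * c ^ 3 / b ^ 3
    + 7500 * c ^ 2 / b ^ 3
    + 282500 * c / b ^ 3
    + 5091250 / b ^ 3
    + 53406250 / (b ^ 3 * c)
    + 352125000 / (b ^ 3 * c ^ 2)
    + 1490000000 / (b ^ 3 * c ^ 3)
    + 3950000000 / (b ^ 3 * c ^ 4)
    + 6000000000 / (b ^ 3 * c ^ 5)
    + 4000000000 / (b ^ 3 * c ^ 6)
    + 39375 * a * b / c ^ 3
    + 4062500 * a ^ 3 / c ^ 5
    + 123046875 * a ^ 5 / (b * c ^ 7)
    + 1464843750 * a ^ 7 / (b ^ 2 * c ^ 9)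
    + 6103515625 * a ^ 9 / (b ^ 3 * c ^ 11))" (is "?L = 5 * ?S")
proof -
  define D where "D = b ^ 3 * c ^ 11"
  have D: "D \<noteq> 0" using nz by (simp add: D_def)
  define p where "p = 20971520 + 177930240 * a + 334888960 * a ^ 2 + 322109440 * a ^ 3 + 227164160 * a ^ 4 + 103681280 * a ^ 5 + 37738240 * a ^ 6 + 7816960 * a ^ 7 + 549440 * a ^ 8 + 8785 * a ^ 9 + 10 * a ^ 10"
  have t: "D * 1 = b ^ 3 * c ^ 11"
    "D * (6 / c) = 6 * b ^ 3 * c ^ 10"
    "D * (50 / b) = 50 * b ^ 2 * c ^ 11"
    "D * (625 * a / (b ^ 3 * c)) = 625 * a * c ^ 10"
    "D * (50 * c ^ 3 / b ^ 3) = 50 * c ^ 14"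
    "D * (7500 * c ^ 2 / b ^ 3) = 7500 * c ^ 13"
    "D * (282500 * c / b ^ 3) = 282500 * c ^ 12"
    "D * (5091250 / b ^ 3) = 5091250 * c ^ 11"
    "D * (53406250 / (b ^ 3 * c)) = 53406250 * c ^ 10"
    "D * (352125000 / (b ^ 3 * c ^ 2)) = 352125000 * c ^ 9"
    "D * (1490000000 / (b ^ 3 * c ^ 3)) = 1490000000 * c ^ 8"
    "D * (3950000000 / (b ^ 3 * c ^ 4)) = 3950000000 * c ^ 7"
    "D * (6000000000 / (b ^ 3 * c ^ 5)) = 6000000000 * c ^ 6"
    "D * (4000000000 / (b ^ 3 * c ^ 6)) = 4000000000 * c ^ 5"
    "D * (39375 * a * b / c ^ 3) = 39375 * a * b ^ 4 * c ^ 8"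
    "D * (4062500 * a ^ 3 / c ^ 5) = 4062500 * a ^ 3 * b ^ 3 * c ^ 6"
    "D * (123046875 * a ^ 5 / (b * c ^ 7)) = 123046875 * a ^ 5 * b ^ 2 * c ^ 4"
    "D * (1464843750 * a ^ 7 / (b ^ 2 * c ^ 9)) = 1464843750 * a ^ 7 * b * c ^ 2"
    "D * (6103515625 * a ^ 9 / (b ^ 3 * c ^ 11)) = 6103515625 * a ^ 9"
    using nz by (simp add: D_def divide_simps; algebra)+
  have "D * ?L = - (b ^ 3 * c ^ 11) + 6 * b ^ 4 * c ^ 10 + 25 * b ^ 4 * (R6 a / a ^ 3)"
    using nz by (simp add: D_def divide_simps; algebra)
  also have "R6 a / a ^ 3 = p"
    unfolding R6_def p_def using nz(1) by (simp add: divide_simps; algebra)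
  also have "- (b ^ 3 * c ^ 11) + 6 * b ^ 4 * c ^ 10 + 25 * b ^ 4 * p = 5 * (b ^ 3 * c ^ 11
    + 6 * b ^ 3 * c ^ 10
    + 50 * b ^ 2 * c ^ 11
    + 625 * a * c ^ 10
    + 50 * c ^ 14
    + 7500 * c ^ 13
    + 282500 * c ^ 12
    + 5091250 * c ^ 11
    + 53406250 * c ^ 10
    + 352125000 * c ^ 9
    + 1490000000 * c ^ 8
    + 3950000000 * c ^ 7
    + 6000000000 * c ^ 6
    + 4000000000 * c ^ 5
    + 39375 * a * b ^ 4 * c ^ 8
    + 4062500 * a ^ 3 * b ^ 3 * c ^ 6
    + 123046875 * a ^ 5 * b ^ 2 * c ^ 4
    + 1464843750 * a ^ 7 * b * c ^ 2
    + 6103515625 * a ^ 9)"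
    unfolding b c p_def by algebra
  also have "\<dots> = D * (5 * ?S)"
    unfolding mult.left_commute[of D] distrib_left[of D] t ..
  finally show ?thesis using D by (simp only: mult_cancel_left) simp
qed

section \<open>Dissection in the field of Laurent series\<close>

abbreviation fl :: "complex fps \<Rightarrow> complex fls" where "fl \<equiv> fps_to_fls"

definition t :: "complex fls" where "t = fls_X"

lemma fl_q: "fl q = t" and t_nonzero: "t \<noteq> 0"
  by (simp_all add: t_def)

text \<open>The field embedding q -> q^5; its image is the field of scalars for the
  dissection.\<close>

definition sig :: "complex fls \<Rightarrow> complex fls" where "sig f = fls_compose_power f 5"

lemma sig_fl: "sig (fl f) = fl (D5 f)"
  by (simp add: sig_def fls_compose_power_fps_to_fls)

lemma sig_simps:
  "sig (f + g) = sig f + sig g" "sig (f - g) = sig f - sig g" "sig (- f) = - sig f" "sig (f * g) = sig f * sig g"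
  "sig 0 = 0" "sig 1 = 1" "sig (f ^ n) = sig f ^ n" "sig t = t ^ 5"
proof -
  show "sig (f ^ n) = sig f ^ n" by (simp add: sig_def)
  show "sig t = t ^ 5" using sig_fl[of q] by (simp add: fps_to_fls_power t_def)
qed (simp_all add: sig_def)

lemma sig_numeral: "sig (numeral n) = numeral n"
  using sig_fl[of "numeral n"] by simp

lemma sig_eq_0_iff: "sig f = 0 \<longleftrightarrow> f = 0"
proof
  assume *: "sig f = 0"
  show "f = 0"
  proof (rule fls_eqI)
    fix n
    have "fls_nth (sig f) (5 * n) = 0" using * by simp
    then show "fls_nth f n = fls_nth 0 n" by (simp add: sig_def fls_nth_compose_power)
  qed
qed (simp add: sig_simps)

lemma sig_divide: "sig (f / g) = sig f / sig g"
proof (cases "g = 0")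
  case False
  then have "sig (f / g) * sig g = sig f" by (simp add: sig_simps(4) [symmetric])
  then show ?thesis using False by (simp add: sig_eq_0_iff nonzero_eq_divide_eq)
qed (simp add: sig_simps)

lemma sig_nth: "fls_nth (sig f) n = (if 5 dvd n then fls_nth f (n div 5) else 0)"
  by (simp add: sig_def fls_nth_compose_power)

section \<open>Extracting one class modulo 5\<close>

text \<open>\<open>r\<close> is the part of \<open>f\<close> with exponents divisible by \<open>5\<close>, after replacing \<open>q\<^sup>5\<close> by \<open>q\<close>.\<close>

definition rep :: "complex fls \<Rightarrow> complex fls \<Rightarrow> bool" where
  "rep f r \<longleftrightarrow> (\<exists>g1 g2 g3 g4. f = sig r + t * sig g1 + t ^ 2 * sig g2 + t ^ 3 * sig g3 + t ^ 4 * sig g4)"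

lemma rep_add: "rep f r \<Longrightarrow> rep g s \<Longrightarrow> rep (f + g) (r + s)"
  unfolding rep_def
proof (elim exE)
  fix g1 g2 g3 g4 h1 h2 h3 h4
  assume "f = sig r + t * sig g1 + t ^ 2 * sig g2 + t ^ 3 * sig g3 + t ^ 4 * sig g4"
    "g = sig s + t * sig h1 + t ^ 2 * sig h2 + t ^ 3 * sig h3 + t ^ 4 * sig h4"
  then have "f + g = sig (r + s) + t * sig (g1 + h1) + t ^ 2 * sig (g2 + h2) + t ^ 3 * sig (g3 + h3) + t ^ 4 * sig (g4 + h4)"
    by (simp add: sig_simps algebra_simps)
  then show "\<exists>g1 g2 g3 g4. f + g = sig (r + s) + t * sig g1 + t ^ 2 * sig g2 + t ^ 3 * sig g3 + t ^ 4 * sig g4" by blast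
qed

lemma rep_sig_mult: "rep f r \<Longrightarrow> rep (sig g * f) (g * r)"
  unfolding rep_def
proof (elim exE)
  fix g1 g2 g3 g4
  assume "f = sig r + t * sig g1 + t ^ 2 * sig g2 + t ^ 3 * sig g3 + t ^ 4 * sig g4"
  then have "sig g * f = sig (g * r) + t * sig (g * g1) + t ^ 2 * sig (g * g2) + t ^ 3 * sig (g * g3) + t ^ 4 * sig (g * g4)"
    by (simp add: sig_simps algebra_simps)
  then show "\<exists>g1 g2 g3 g4. sig g * f = sig (g * r) + t * sig g1 + t ^ 2 * sig g2 + t ^ 3 * sig g3 + t ^ 4 * sig g4" by blast
qed

lemma rep_numeral_mult: "rep f r \<Longrightarrow> rep (numeral n * f) (numeral n * r)"
  using rep_sig_mult[of f r "numeral n"] by (simp add: sig_numeral)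

lemma X_power_mult_nth: "fls_nth (t ^ n * f) m = fls_nth f (m - int n)"
  by (simp add: t_def fls_X_power_times_conv_shift)

text \<open>The power of t moves class 0 of \<open>F\<close> to class i, and the other four classes
  elsewhere. After q^5 -> q, the part \<open>t ^ (5 * m)\<close> becomes
  \<open>t ^ m\<close>.\<close>

lemma sec_extract:
  assumes eq: "fl f = t ^ (5 * m + i) * sig G * F" and rep: "rep F r" and i: "i < 5"
  shows "fl (sec 5 i f) = t ^ m * G * r"
proof (rule fls_eqI)
  fix n :: int
  from rep obtain g1 g2 g3 g4 where F: "F = sig r + t * sig g1 + t ^ 2 * sig g2 + t ^ 3 * sig g3 + t ^ 4 * sig g4"
    unfolding rep_def by blast
  have "fl f = t ^ (5 * m + i) * sig (G * r) + t ^ (5 * m + i + 1) * sig (G * g1) + t ^ (5 * m + i + 2) * sig (G * g2)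
     + t ^ (5 * m + i + 3) * sig (G * g3) + t ^ (5 * m + i + 4) * sig (G * g4)"
    unfolding eq F by (simp only: sig_simps power_add distrib_left distrib_right power_one_right mult.assoc mult.left_commute mult.commute)
  then have "fls_nth (fl f) (5 * n + int i) = fls_nth (sig (G * r)) (5 * (n - int m)) + fls_nth (sig (G * g1)) (5 * (n - int m) - 1)
     + fls_nth (sig (G * g2)) (5 * (n - int m) - 2) + fls_nth (sig (G * g3)) (5 * (n - int m) - 3) + fls_nth (sig (G * g4)) (5 * (n - int m) - 4)"
    by (simp only: fls_plus_nth X_power_mult_nth) (simp add: algebra_simps)
  also have "\<dots> = fls_nth (G * r) (n - int m)"
  proof -
    have "\<not> 5 dvd 5 * (n - int m) - 1" "\<not> 5 dvd 5 * (n - int m) - 2" "\<not> 5 dvd 5 * (n - int m) - 3" "\<not> 5 dvd 5 * (n - int m) - 4"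
      by presburger+
    then show ?thesis unfolding sig_nth by simp
  qed
  also have "\<dots> = fls_nth (t ^ m * G * r) n" by (simp only: mult.assoc X_power_mult_nth)
  finally have "fls_nth (fl f) (5 * n + int i) = fls_nth (t ^ m * G * r) n" .
  moreover have "fls_nth (fl (sec 5 i f)) n = fls_nth (fl f) (5 * n + int i)"
  proof (cases "n < 0")
    case False
    then have "nat (5 * n + int i) = 5 * nat n + i" by (simp add: nat_add_distrib nat_mult_distrib)
    then show ?thesis using False by (simp add: sec_def)
  qed (use i in simp)
  ultimately show "fls_nth (fl (sec 5 i f)) n = fls_nth (t ^ m * G * r) n" by simp
qed

section \<open>The parameters as Laurent series\<close>

definition ee :: "nat \<Rightarrow> complex fls" where "ee j = fl (E j)"

lemma ee_nonzero: "j \<ge> 1 \<Longrightarrow> ee j \<noteq> 0"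
  by (simp add: ee_def E_nonzero)

lemma sig_ee: "j \<ge> 1 \<Longrightarrow> sig (ee j) = ee (5 * j)"
  by (simp add: ee_def sig_fl E_compose)

text \<open>Up to the powers q^(1/5) and q^(2/5), \<open>xx\<close> and \<open>yy\<close> are 1 /
  R(q) and 1 / R(q^2); thus \<open>kk\<close> is R(q) R(q^2)^2 and \<open>BB\<close> is
  R(q)^5.\<close>

definition xx :: "complex fls" where "xx = fl A5 / ee 5"
definition yy :: "complex fls" where "yy = fl (fps_compose A5 (q ^ 2)) / ee 10"
definition kk :: "complex fls" where "kk = t / (xx * yy ^ 2)"
definition aa :: "complex fls" where "aa = (1 - kk) * (1 + kk) / kk"
definition p0 :: "complex fls" where "p0 = fl f23 / fl psi5"
definition p1 :: "complex fls" where "p1 = fl f14 / fl psi5"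
definition BB :: "complex fls" where "BB = t / xx ^ 5"

lemma ee_nz: "ee 1 \<noteq> 0" "ee 2 \<noteq> 0" "ee 5 \<noteq> 0" "ee 10 \<noteq> 0"
  by (simp_all add: ee_nonzero)

lemma A5_nz: "fl A5 \<noteq> 0" "fl (fps_compose A5 (q ^ 2)) \<noteq> 0"
proof -
  show "fl A5 \<noteq> 0" using A5_nth_0 by auto
  have "fps_nth (fps_compose A5 (q ^ 2)) 0 = 1" using A5_nth_0 by (simp add: compose_X_power_nth)
  then have "fps_compose A5 (q ^ 2) \<noteq> 0" by (metis fps_zero_nth zero_neq_one)
  then show "fl (fps_compose A5 (q ^ 2)) \<noteq> 0" by simp
qed

lemma xx_yy_nz: "xx \<noteq> 0" "yy \<noteq> 0" "t \<noteq> 0"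
  using A5_nz ee_nz t_nonzero by (simp_all add: xx_def yy_def)

lemma fl_A5: "fl A5 = xx * ee 5" "fl C5 = - (ee 5 / xx)"
  "fl (fps_compose A5 (q ^ 2)) = yy * ee 10" "fl (fps_compose C5 (q ^ 2)) = - (ee 10 / yy)"
proof -
  show 1: "fl A5 = xx * ee 5" "fl (fps_compose A5 (q ^ 2)) = yy * ee 10"
    using ee_nz by (simp_all add: xx_def yy_def)
  have "fl A5 * fl C5 = - (ee 5 ^ 2)"
    using arg_cong[OF A5_C5, of fl] by (simp add: fls_times_fps_to_fls fps_to_fls_power ee_def)
  then have "(xx * ee 5) * fl C5 = (xx * ee 5) * - (ee 5 / xx)"
    using xx_yy_nz unfolding 1 by (simp add: power2_eq_square)
  then show "fl C5 = - (ee 5 / xx)" using ee_nz xx_yy_nz by (subst (asm) mult_cancel_left) simp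
  have "fl (fps_compose A5 (q ^ 2)) * fl (fps_compose C5 (q ^ 2)) = - (ee 10 ^ 2)"
    using arg_cong[OF A5_C5_2, of fl] by (simp add: fls_times_fps_to_fls fps_to_fls_power ee_def)
  then have "(yy * ee 10) * fl (fps_compose C5 (q ^ 2)) = (yy * ee 10) * - (ee 10 / yy)"
    using xx_yy_nz unfolding 1 by (simp add: power2_eq_square)
  then show "fl (fps_compose C5 (q ^ 2)) = - (ee 10 / yy)" using ee_nz xx_yy_nz by (subst (asm) mult_cancel_left) simp
qed

lemma fl_psi: "fl psi = ee 2 ^ 2 / ee 1" "fl psi5 = ee 10 ^ 2 / ee 5"
proof -
  have "fl psi * ee 1 = ee 2 ^ 2"
    using arg_cong[OF psi_prod, of fl] by (simp add: fls_times_fps_to_fls fps_to_fls_power ee_def)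
  then show 1: "fl psi = ee 2 ^ 2 / ee 1" using ee_nz by (simp add: field_simps)
  have "fl psi5 = sig (fl psi)" by (simp add: psi5_def sig_fl)
  then show "fl psi5 = ee 10 ^ 2 / ee 5" unfolding 1 by (simp add: sig_divide sig_simps sig_ee)
qed

lemma fl_f: "fl f23 = p0 * fl psi5" "fl f14 = p1 * fl psi5"
  using ee_nz by (simp_all add: p0_def p1_def fl_psi)

lemmas fl_simps = fls_times_fps_to_fls fps_to_fls_power fps_to_fls_plus fps_to_fls_minus fps_to_fls_uminus
  fps_to_fls_numeral fl_q ee_def [symmetric]

text \<open>After the substitutions every class equation carries the same factor
  \<open>e10 ^ 2\<close>; dividing by it leaves relations among X, Y, p0, p1 alone.\<close>

lemma class_relations:
  fixes t p0 p1 :: "'a :: field_char_0"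
  assumes nz: "e5 \<noteq> 0" "e10 \<noteq> 0" "x \<noteq> 0" "y \<noteq> 0"
    and r: "A2 ^ 2 = F * A + t * ps * C" "- 2 * t * e10 * C2' = G * A - F * e5" "- 2 * A2 * e10 = F * C - G * e5" "t * C2' ^ 2 = G * C + ps * A"
    and d: "A = x * e5" "C = - (e5 / x)" "A2 = y * e10" "C2' = - (e10 / y)" "ps = e10 ^ 2 / e5" "F = p0 * ps" "G = p1 * ps"
  shows "y ^ 2 = p0 * x - t / x" "2 * t / y = p1 * x - p0" "2 * y = p1 + p0 / x" "t / y ^ 2 = x - p1 / x"
proof -
  note nz' = nz power_not_zero[OF nz(2), of 2]
  have "e10 ^ 2 * y ^ 2 = A2 ^ 2" by (simp add: d power_mult_distrib)
  also have "\<dots> = F * A + t * ps * C" by fact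
  also have "\<dots> = e10 ^ 2 * (p0 * x - t / x)" using nz by (simp add: d field_simps)
  finally show "y ^ 2 = p0 * x - t / x" using nz' by (simp only: mult_cancel_left) simp
  have "e10 ^ 2 * (2 * t / y) = - 2 * t * e10 * C2'" by (simp add: d power2_eq_square)
  also have "\<dots> = G * A - F * e5" by fact
  also have "\<dots> = e10 ^ 2 * (p1 * x - p0)" using nz by (simp add: d field_simps)
  finally show "2 * t / y = p1 * x - p0" using nz' by (simp only: mult_cancel_left) simp
  have "e10 ^ 2 * (2 * y) = - (- 2 * A2 * e10)" by (simp add: d power2_eq_square)
  also have "- 2 * A2 * e10 = F * C - G * e5" by fact
  also have "- (F * C - G * e5) = e10 ^ 2 * (p1 + p0 / x)" using nz by (simp add: d field_simps)
  finally show "2 * y = p1 + p0 / x" using nz' by (simp only: mult_cancel_left) simp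
  have "e10 ^ 2 * (t / y ^ 2) = t * C2' ^ 2" by (simp add: d power_divide)
  also have "\<dots> = G * C + ps * A" by fact
  also have "\<dots> = e10 ^ 2 * (x - p1 / x)" using nz by (simp add: d field_simps)
  finally show "t / y ^ 2 = x - p1 / x" using nz' by (simp only: mult_cancel_left) simp
qed

lemma quintic_quotient:
  fixes t :: "'a :: field_char_0"
  assumes nz: "e \<noteq> 0" "x \<noteq> 0" "t \<noteq> 0" and eq: "((x * e) ^ 5 - 11 * t * e ^ 5 + t ^ 2 * (- (e / x)) ^ 5) * e = g"
  shows "g / (t * e ^ 6) = x ^ 5 / t - 11 - t / x ^ 5"
proof -
  have pw: "(- (e / x)) ^ 5 = - (e ^ 5 / x ^ 5)" by (simp add: power_divide)
  have "g = (e ^ 5 * e) * (x ^ 5 - 11 * t - t ^ 2 / x ^ 5)"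
    unfolding eq [symmetric] pw by (simp add: power_mult_distrib algebra_simps)
  moreover have "e ^ 6 = e ^ 5 * e" by (simp flip: power_Suc2)
  ultimately have "g / (t * e ^ 6) = (x ^ 5 - 11 * t - t ^ 2 / x ^ 5) / t" using nz by simp
  also have "\<dots> = x ^ 5 / t - 11 - t / x ^ 5" using nz by (simp add: diff_divide_distrib power2_eq_square)
  finally show ?thesis .
qed

lemma xx_yy_relations:
  "yy ^ 2 = p0 * xx - t / xx" "2 * t / yy = p1 * xx - p0" "2 * yy = p1 + p0 / xx" "t / yy ^ 2 = xx - p1 / xx"
proof -
  note c = psi_classes[THEN arg_cong[of _ _ fl], unfolded fl_simps]
  note r = class_relations[OF ee_nz(3,4) xx_yy_nz(1,2) c fl_A5 fl_psi(2) fl_f]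
  show "yy ^ 2 = p0 * xx - t / xx" "2 * t / yy = p1 * xx - p0" "2 * yy = p1 + p0 / xx" "t / yy ^ 2 = xx - p1 / xx"
    by (fact r)+
qed

lemmas kk_facts = k_parametrization[OF xx_yy_nz(3,1,2) xx_yy_relations, folded kk_def]

lemma k_quotients:
  fixes t x y p0 p1 k :: "'a :: field_char_0"
  assumes nz: "k \<noteq> 0" "1 + k \<noteq> 0" "1 - k \<noteq> 0" "x \<noteq> 0" "t \<noteq> 0" "y \<noteq> 0"
    and y: "y * (1 + k) = x ^ 2 * (1 - k)" and t: "t * (1 + k) ^ 2 = x ^ 5 * (k * (1 - k) ^ 2)"
    and p1: "p1 = x ^ 2 * (1 - k)" and p0: "p0 * (1 + k) = x ^ 3 * (1 - k) ^ 2"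
  shows "t / x ^ 5 = k * (1 - k) ^ 2 / (1 + k) ^ 2" "y = x ^ 2 * ((1 - k) / (1 + k))"
    "p0 * p1 / t = (1 - k) * (1 + k) / k" "t ^ 2 / y ^ 5 = k ^ 2 * (1 + k) / (1 - k)"
    "p0 * x ^ 2 = t * ((1 + k) / k)" "p1 * x ^ 3 = t * ((1 + k) ^ 2 / (k * (1 - k)))"
proof -
  show "t / x ^ 5 = k * (1 - k) ^ 2 / (1 + k) ^ 2" using t nz by (simp add: frac_eq_eq ac_simps)
  show "y = x ^ 2 * ((1 - k) / (1 + k))" using y nz by (simp add: field_simps)
  have "(p0 * p1 * k) * (1 + k) ^ 2 = (p0 * (1 + k)) * p1 * k * (1 + k)" by algebra
  also have "\<dots> = (1 - k) * (1 + k) * (t * (1 + k) ^ 2)" unfolding p0 p1 t by algebra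
  also have "\<dots> = ((1 - k) * (1 + k) * t) * (1 + k) ^ 2" by algebra
  finally have "p0 * p1 * k = (1 - k) * (1 + k) * t" by (rule mult_right_cancel[THEN iffD1, rotated]) (use nz in simp)
  then show "p0 * p1 / t = (1 - k) * (1 + k) / k" using nz by (simp add: frac_eq_eq)
  have "(t ^ 2 * (1 - k)) * (1 + k) ^ 4 = (t * (1 + k) ^ 2) ^ 2 * (1 - k)" by algebra
  also have "\<dots> = k ^ 2 * (y * (1 + k)) ^ 5" unfolding t y by algebra
  also have "\<dots> = (k ^ 2 * (1 + k) * y ^ 5) * (1 + k) ^ 4" by algebra
  finally have "t ^ 2 * (1 - k) = k ^ 2 * (1 + k) * y ^ 5" by (rule mult_right_cancel[THEN iffD1, rotated]) (use nz in simp)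
  then show "t ^ 2 / y ^ 5 = k ^ 2 * (1 + k) / (1 - k)" using nz by (simp add: frac_eq_eq)
  have "(p0 * x ^ 2 * k) * (1 + k) = (p0 * (1 + k)) * x ^ 2 * k" by algebra
  also have "\<dots> = t * (1 + k) ^ 2" unfolding p0 t by algebra
  also have "\<dots> = (t * (1 + k)) * (1 + k)" by algebra
  finally have "p0 * x ^ 2 * k = t * (1 + k)" by (rule mult_right_cancel[THEN iffD1, rotated]) (use nz in simp)
  then show "p0 * x ^ 2 = t * ((1 + k) / k)" using nz by (simp add: field_simps)
  have "p1 * x ^ 3 * (k * (1 - k)) = t * (1 + k) ^ 2" unfolding p1 t by algebra
  then show "p1 * x ^ 3 = t * ((1 + k) ^ 2 / (k * (1 - k)))" using nz by (simp add: nonzero_eq_divide_eq)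
qed

lemmas kk_consequences = k_quotients[OF kk_facts(1-3) xx_yy_nz(1,3,2) kk_facts(4-7), folded BB_def aa_def]

section \<open>Eta quotients for a, a + 1 and a - 4\<close>

definition TT :: "complex fls" where "TT = ee 1 ^ 6 / (t * ee 5 ^ 6)"
definition TT2 :: "complex fls" where "TT2 = ee 2 ^ 6 / (t ^ 2 * ee 10 ^ 6)"

lemma TT_B: "TT = 1 / BB - 11 - BB" "TT2 = yy ^ 5 / t ^ 2 - 11 - t ^ 2 / yy ^ 5"
proof -
  have "fl ((A5 ^ 5 - 11 * q * E 5 ^ 5 + q ^ 2 * C5 ^ 5) * E 5) = fl (E 1 ^ 6)" by (simp only: ramanujan_quintic)
  then have "((xx * ee 5) ^ 5 - 11 * t * ee 5 ^ 5 + t ^ 2 * (- (ee 5 / xx)) ^ 5) * ee 5 = ee 1 ^ 6"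
    unfolding fl_simps fl_A5 .
  from quintic_quotient[OF ee_nz(3) xx_yy_nz(1,3) this] show "TT = 1 / BB - 11 - BB"
    by (simp add: TT_def BB_def)
  have "fl (fps_compose ((A5 ^ 5 - 11 * q * E 5 ^ 5 + q ^ 2 * C5 ^ 5) * E 5) (q ^ 2)) = fl (fps_compose (E 1 ^ 6) (q ^ 2))"
    by (simp only: ramanujan_quintic)
  moreover have "fps_compose ((A5 ^ 5 - 11 * q * E 5 ^ 5 + q ^ 2 * C5 ^ 5) * E 5) (q ^ 2) =
      (fps_compose A5 (q ^ 2) ^ 5 - 11 * q ^ 2 * E 10 ^ 5 + (q ^ 2) ^ 2 * fps_compose C5 (q ^ 2) ^ 5) * E 10"
    using E_compose[of 2 5]
    by (simp add: fps_compose_mult_distrib fps_compose_add_distrib fps_compose_sub_distrib compose_X_power_hom)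
  moreover have "fps_compose (E 1 ^ 6) (q ^ 2) = E 2 ^ 6" using E_compose[of 2 1] by (simp add: compose_X_power_hom)
  ultimately have "((yy * ee 10) ^ 5 - 11 * t ^ 2 * ee 10 ^ 5 + (t ^ 2) ^ 2 * (- (ee 10 / yy)) ^ 5) * ee 10 = ee 2 ^ 6"
    by (simp only: fl_simps fl_A5)
  from quintic_quotient[OF ee_nz(4) xx_yy_nz(2) power_not_zero[OF xx_yy_nz(3)] this]
  show "TT2 = yy ^ 5 / t ^ 2 - 11 - t ^ 2 / yy ^ 5" by (simp only: TT2_def)
qed

lemma TT_a: "TT * aa ^ 2 = (aa + 1) * (aa - 4) ^ 2" "TT2 * aa = (aa + 1) ^ 2 * (aa - 4)" "aa \<noteq> 0"
proof -
  have a: "aa = (1 - kk ^ 2) / kk" by (simp add: aa_def power2_eq_square algebra_simps)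
  note T = T_factor[OF kk_facts(1-3)]
  show "TT * aa ^ 2 = (aa + 1) * (aa - 4) ^ 2"
    unfolding TT_B kk_consequences a by (rule T(1))
  have "yy ^ 5 / t ^ 2 = 1 / (kk ^ 2 * (1 + kk) / (1 - kk))" unfolding kk_consequences(4) [symmetric] by simp
  then show "TT2 * aa = (aa + 1) ^ 2 * (aa - 4)"
    unfolding TT_B kk_consequences(4) a by (simp only: T(2))
  show "aa \<noteq> 0" unfolding a by (rule T(3))
qed

lemma TT_nz: "TT \<noteq> 0" "TT2 \<noteq> 0" "aa + 1 \<noteq> 0" "aa - 4 \<noteq> 0"
proof -
  show "TT \<noteq> 0" "TT2 \<noteq> 0" using ee_nz xx_yy_nz by (simp_all add: TT_def TT2_def)
  then show "aa + 1 \<noteq> 0" "aa - 4 \<noteq> 0" using TT_a by auto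
qed

text \<open>The cofactor of f - g in f^3 - g^3 has constant coefficient 3, so it is nonzero in an
  integral domain.\<close>

lemma cube_root_unique:
  fixes f g :: "complex fps"
  assumes "f ^ 3 = g ^ 3" "fps_nth f 0 = 1" "fps_nth g 0 = 1"
  shows "f = g"
proof -
  have "(f - g) * (f ^ 2 + f * g + g ^ 2) = 0" using assms(1) by algebra
  moreover have "fps_nth (f ^ 2 + f * g + g ^ 2) 0 = 3" using assms(2,3) by (simp add: fps_power_zeroth)
  then have "f ^ 2 + f * g + g ^ 2 \<noteq> 0" by (metis fps_zero_nth zero_neq_numeral)
  ultimately show ?thesis by simp
qed

text \<open>Laurent series with equal cubes agree if a common multiplier turns both into power
  series with constant coefficient 1; this excludes a nontrivial cube root of unity.\<close>

lemma fl_cube_cancel: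
  assumes "fl f = d * x" "fl g = d * y" "x ^ 3 = y ^ 3" "d \<noteq> 0" "fps_nth f 0 = 1" "fps_nth g 0 = 1"
  shows "x = y"
proof -
  have "fl f ^ 3 = fl g ^ 3" unfolding assms(1,2) power_mult_distrib assms(3) ..
  then have "f ^ 3 = g ^ 3" by (simp only: fps_to_fls_power [symmetric] fps_to_fls_eq_iff)
  then have "f = g" using assms(5,6) by (rule cube_root_unique)
  then show ?thesis using assms(1,2,4) by simp
qed

lemma aa_eta: "aa = ee 2 * ee 5 ^ 5 / (t * ee 1 * ee 10 ^ 5)"
proof -
  have "fl f23 * fl f14 * (ee 1 * ee 10) = ee 2 * ee 5 ^ 3"
    using arg_cong[OF f23_f14_prod, of fl] by (simp add: fl_simps)
  then have "p0 * p1 * (ee 10 ^ 4 / ee 5 ^ 2) * (ee 1 * ee 10) = ee 2 * ee 5 ^ 3"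
    unfolding fl_f fl_psi by (simp add: power_divide power2_eq_square eval_nat_numeral ac_simps)
  then have "p0 * p1 = ee 2 * ee 5 ^ 5 / (ee 1 * ee 10 ^ 5)"
    using ee_nz by (simp add: divide_simps; algebra)
  then show ?thesis unfolding kk_consequences(3) [symmetric] by (simp add: ac_simps)
qed

lemma aa_mult_eq: "t * ee 1 * ee 10 ^ 5 * aa = ee 2 * ee 5 ^ 5"
  using ee_nz xx_yy_nz by (simp add: aa_eta)

text \<open>Eliminating \<open>TT\<close> from \<open>TT_a\<close> gives the cube of the identity.\<close>

lemma aa_plus_1_eta: "aa + 1 = ee 2 ^ 4 * ee 5 ^ 2 / (t * ee 1 ^ 2 * ee 10 ^ 4)"
proof -
  \<comment> \<open>The two sides multiplied by t E_1^2 E_10^5, that is, without denominators and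
    with constant coefficient 1.\<close>
  let ?f = "E 2 ^ 4 * E 5 ^ 2 * E 10" and ?g = "(E 2 * E 5 ^ 5 + q * E 1 * E 10 ^ 5) * E 1"
  define b where "b = ee 2 ^ 4 * ee 5 ^ 2 / (t * ee 1 ^ 2 * ee 10 ^ 4)"
  have f: "fl ?f = t * ee 1 ^ 2 * ee 10 ^ 5 * b"
    using ee_nz xx_yy_nz by (simp add: fl_simps b_def divide_simps; algebra)
  have g: "fl ?g = t * ee 1 ^ 2 * ee 10 ^ 5 * (aa + 1)"
  proof -
    have "fl ?g = (ee 2 * ee 5 ^ 5 + t * ee 1 * ee 10 ^ 5) * ee 1" by (simp only: fl_simps)
    then show ?thesis unfolding aa_mult_eq [symmetric] by algebra
  qed
  have "TT2 ^ 2 * aa ^ 2 = (aa + 1) ^ 3 * ((aa + 1) * (aa - 4) ^ 2)" using TT_a(2) by algebra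
  then have "TT2 ^ 2 * aa ^ 2 = (aa + 1) ^ 3 * TT * aa ^ 2" unfolding TT_a(1) [symmetric] by (simp only: mult.assoc)
  then have "TT2 ^ 2 = (aa + 1) ^ 3 * TT" using TT_a(3) by simp
  moreover have "TT2 ^ 2 = b ^ 3 * TT"
    using ee_nz xx_yy_nz by (simp add: TT_def TT2_def b_def divide_simps; algebra)
  ultimately have b3: "b ^ 3 = (aa + 1) ^ 3" using TT_nz by simp
  have "b = aa + 1"
    by (rule fl_cube_cancel[OF f g b3]) (use ee_nz xx_yy_nz in \<open>simp_all add: fps_nth_E_0 fps_power_zeroth\<close>)
  then show ?thesis by (simp add: b_def)
qed

text \<open>Here a + 1 is eliminated from the two equations, leaving
  \<open>TT ^ 2 * aa ^ 3 = TT2 * (aa - 4) ^ 3\<close>, again the cube of the claim.\<close>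

lemma aa_minus_4_eta: "aa - 4 = ee 1 ^ 3 * ee 5 / (t * ee 2 * ee 10 ^ 3)"
proof -
  let ?f = "E 1 ^ 4 * E 5 * E 10 ^ 2" and ?g = "(E 2 * E 5 ^ 5 - 4 * q * E 1 * E 10 ^ 5) * E 2"
  define c where "c = ee 1 ^ 3 * ee 5 / (t * ee 2 * ee 10 ^ 3)"
  have f: "fl ?f = t * ee 1 * ee 2 * ee 10 ^ 5 * c"
    using ee_nz xx_yy_nz by (simp add: fl_simps c_def divide_simps; algebra)
  have g: "fl ?g = t * ee 1 * ee 2 * ee 10 ^ 5 * (aa - 4)"
  proof -
    have "fl ?g = (ee 2 * ee 5 ^ 5 - 4 * t * ee 1 * ee 10 ^ 5) * ee 2" by (simp only: fl_simps)
    then show ?thesis unfolding aa_mult_eq [symmetric] by algebra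
  qed
  have "TT ^ 2 * aa ^ 4 = ((aa + 1) ^ 2 * (aa - 4)) * (aa - 4) ^ 3" using TT_a(1) by algebra
  then have "(TT ^ 2 * aa ^ 3) * aa = (TT2 * (aa - 4) ^ 3) * aa" unfolding TT_a(2) [symmetric] by algebra
  then have "TT ^ 2 * aa ^ 3 = TT2 * (aa - 4) ^ 3" using TT_a(3) by simp
  moreover have "TT ^ 2 * aa ^ 3 = TT2 * c ^ 3"
    using ee_nz xx_yy_nz unfolding aa_eta by (simp add: TT_def TT2_def c_def divide_simps; algebra)
  ultimately have c3: "c ^ 3 = (aa - 4) ^ 3" using TT_nz by simp
  have "c = aa - 4"
    by (rule fl_cube_cancel[OF f g c3]) (use ee_nz xx_yy_nz in \<open>simp_all add: fps_nth_E_0 fps_power_zeroth\<close>)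
  then show ?thesis by (simp add: c_def)
qed

section \<open>Coordinates in powers of rho\<close>

text \<open>\<open>rho\<close> is a fifth root of \<open>sig BB\<close>, so all computations take place in a field extension of degree \<open>5\<close> with basis \<open>1, rho, rho\<^sup>2, rho\<^sup>3, rho\<^sup>4\<close>.\<close>

definition rho :: "complex fls" where "rho = t / sig xx"

lemma rho_facts: "rho \<noteq> 0" "sig xx \<noteq> 0" "BB \<noteq> 0" "rho ^ 5 = sig BB"
  using xx_yy_nz by (simp_all add: rho_def sig_eq_0_iff BB_def sig_divide sig_simps power_divide)

definition dis where
  "dis r0 r1 r2 r3 r4 = sig r0 + rho * sig r1 + rho ^ 2 * sig r2 + rho ^ 3 * sig r3 + rho ^ 4 * sig r4"

lemma dis_mult:
  "dis r0 r1 r2 r3 r4 * dis s0 s1 s2 s3 s4 =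
   dis (r0 * s0 + BB * (r1 * s4 + r2 * s3 + r3 * s2 + r4 * s1))
       (r0 * s1 + r1 * s0 + BB * (r2 * s4 + r3 * s3 + r4 * s2))
       (r0 * s2 + r1 * s1 + r2 * s0 + BB * (r3 * s4 + r4 * s3))
       (r0 * s3 + r1 * s2 + r2 * s1 + r3 * s0 + BB * (r4 * s4))
       (r0 * s4 + r1 * s3 + r2 * s2 + r3 * s1 + r4 * s0)"
  unfolding dis_def sig_simps rho_facts(4) [symmetric] by algebra

lemma rep_dis: "rep (dis r0 r1 r2 r3 r4) r0"
  unfolding rep_def
proof (intro exI)
  have "rho ^ n * sig r = t ^ n * sig (r / xx ^ n)" for n r
    by (simp add: rho_def power_divide sig_divide sig_simps)
  from this[of 1] this[of 2] this[of 3] this[of 4]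
  show "dis r0 r1 r2 r3 r4 = sig r0 + t * sig (r1 / xx ^ 1) + t ^ 2 * sig (r2 / xx ^ 2) + t ^ 3 * sig (r3 / xx ^ 3) + t ^ 4 * sig (r4 / xx ^ 4)"
    by (simp only: dis_def power_one_right)
qed

definition uu :: "complex fls" where "uu = (1 + kk) / kk"
definition vv :: "complex fls" where "vv = (1 + kk) ^ 2 / (kk * (1 - kk))"
text \<open>psi(q) / (q^3 psi(q^25)). Like \<open>eta\<close> and \<open>e2h\<close>, it is divided
  by the self-similar term of its own dissection up to sign, so that its coordinates are functions
  of k.\<close>

definition psh :: "complex fls" where "psh = fl psi / (t ^ 3 * sig (fl psi5))"
definition eta :: "complex fls" where "eta = ee 1 / (t * ee 25)"
definition e2h :: "complex fls" where "e2h = ee 2 / (t ^ 2 * ee 50)"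

lemma psh_dis: "psh = dis 1 0 uu vv 0"
proof -
  have nz: "sig (fl psi5) \<noteq> 0" "t \<noteq> 0" "sig xx \<noteq> 0"
    using ee_nz xx_yy_nz rho_facts by (simp_all add: sig_eq_0_iff fl_psi)
  have "fl psi = sig (fl f23) + t * sig (fl f14) + t ^ 3 * sig (fl psi5)"
    using arg_cong[OF psi_dissect, of fl] unfolding fl_simps sig_fl [symmetric] .
  also have "\<dots> = sig (fl psi5) * (sig p0 + t * sig p1 + t ^ 3)"
    unfolding fl_f sig_simps by (simp add: algebra_simps)
  finally have "psh = (sig p0 + t * sig p1 + t ^ 3) / t ^ 3" using nz by (simp add: psh_def)
  moreover have "sig p0 * sig xx ^ 2 = t ^ 5 * sig uu" "sig p1 * sig xx ^ 3 = t ^ 5 * sig vv"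
    using arg_cong[OF kk_consequences(5), of sig] arg_cong[OF kk_consequences(6), of sig]
    unfolding sig_simps uu_def vv_def by simp_all
  then have "sig uu = sig p0 * sig xx ^ 2 / t ^ 5" "sig vv = sig p1 * sig xx ^ 3 / t ^ 5"
    using nz by simp_all
  ultimately show ?thesis unfolding dis_def using nz
    by (simp add: sig_simps rho_def power_divide add_divide_distrib; simp add: field_simps eval_nat_numeral)
qed

lemma eta_dis: "eta = 1 / rho - 1 - rho" "eta = dis (- 1) (- 1) 0 0 (1 / BB)"
proof -
  have nz: "t \<noteq> 0" "sig xx \<noteq> 0" "ee 25 \<noteq> 0" using xx_yy_nz rho_facts by (simp_all add: ee_nonzero)
  have s5: "sig (ee 5) = ee 25" by (simp add: sig_ee)
  have "ee 1 = sig (fl A5) - t * sig (ee 5) + t ^ 2 * sig (fl C5)"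
    using arg_cong[OF E1_dissect, of fl] unfolding fl_simps sig_fl [symmetric] .
  then have "ee 1 = sig xx * ee 25 - t * ee 25 - t ^ 2 * (ee 25 / sig xx)"
    unfolding fl_A5 sig_simps sig_divide s5 by simp
  then show *: "eta = 1 / rho - 1 - rho"
    using nz by (simp add: eta_def rho_def diff_divide_distrib; simp add: field_simps eval_nat_numeral)
  have "rho ^ 4 * sig (1 / BB) = 1 / rho"
    unfolding sig_divide rho_facts(4) [symmetric] using rho_facts(1) by (simp add: sig_simps eval_nat_numeral)
  then show "eta = dis (- 1) (- 1) 0 0 (1 / BB)" unfolding * dis_def by (simp add: sig_simps)
qed

text \<open>The dissection of E_2 runs in powers of R(q^10). Writing Y as X^2 (1 - k) / (1 + k)
  turns it into coordinates with respect to the same \<open>rho\<close>.\<close>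

lemma e2h_dis: "e2h = dis (- 1) 0 (- (1 + kk) / (1 - kk)) ((1 - kk) / (1 + kk) / BB) 0"
proof -
  have nz: "t \<noteq> 0" "sig xx \<noteq> 0" "sig yy \<noteq> 0" "ee 50 \<noteq> 0" "sig (1 - kk) \<noteq> 0" "sig (1 + kk) \<noteq> 0"
    using xx_yy_nz rho_facts kk_facts by (simp_all add: ee_nonzero sig_eq_0_iff del: right_minus_eq)
  have s10: "sig (ee 10) = ee 50" by (simp add: sig_ee)
  have "ee 2 = sig (fl (fps_compose A5 (q ^ 2))) - t ^ 2 * sig (ee 10) + t ^ 4 * sig (fl (fps_compose C5 (q ^ 2)))"
    using arg_cong[OF E2_dissect, of fl] unfolding fl_simps sig_fl [symmetric] .
  then have "ee 2 = sig yy * ee 50 - t ^ 2 * ee 50 - t ^ 4 * (ee 50 / sig yy)"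
    unfolding fl_A5 sig_simps sig_divide s10 by simp
  then have 1: "e2h = sig yy / t ^ 2 - 1 - t ^ 2 / sig yy"
    using nz by (simp add: e2h_def diff_divide_distrib; simp add: field_simps eval_nat_numeral)
  have y: "sig yy = sig xx ^ 2 * (sig (1 - kk) / sig (1 + kk))"
    by (subst kk_consequences(2)) (simp only: sig_simps(4,7) sig_divide)
  have "rho ^ 3 * sig ((1 - kk) / (1 + kk) / BB) = sig yy / t ^ 2"
    unfolding y sig_divide rho_facts(4) [symmetric] using rho_facts(1) nz
    by (simp add: rho_def field_simps eval_nat_numeral)
  moreover have "rho ^ 2 * sig (- (1 + kk) / (1 - kk)) = - (t ^ 2 / sig yy)"
    unfolding y sig_divide sig_simps(3) using nz by (simp add: rho_def power_divide del: sig_simps)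
  ultimately show ?thesis unfolding 1 dis_def by (simp add: sig_simps(3,5,6))
qed

text \<open>For \<open>eta = 1 / rho - 1 - rho\<close>, the quintic expresses
  \<open>1 / rho ^ 5 - 11 - rho ^ 5\<close> through \<open>eta\<close>, and this quantity is a
  scalar.\<close>

lemma eta_quintic: "eta ^ 5 + 5 * eta ^ 4 + 15 * eta ^ 3 + 25 * eta ^ 2 + 25 * eta = sig TT" and eta_nz: "eta \<noteq> 0"
proof -
  have "sig TT = 1 / rho ^ 5 - 11 - rho ^ 5"
    unfolding TT_B sig_simps sig_divide rho_facts sig_numeral ..
  moreover have "(1 / r - 1 - r) ^ 5 + 5 * (1 / r - 1 - r) ^ 4 + 15 * (1 / r - 1 - r) ^ 3 + 25 * (1 / r - 1 - r) ^ 2 + 25 * (1 / r - 1 - r) =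
      1 / r ^ 5 - 11 - r ^ 5" if "r \<noteq> 0" for r :: "complex fls"
  proof -
    define s where "s = 1 / r"
    have "s * r = 1" using that by (simp add: s_def)
    then have "(s - 1 - r) ^ 5 + 5 * (s - 1 - r) ^ 4 + 15 * (s - 1 - r) ^ 3 + 25 * (s - 1 - r) ^ 2 + 25 * (s - 1 - r) = s ^ 5 - 11 - r ^ 5"
      by algebra
    then show ?thesis by (simp add: s_def power_divide)
  qed
  ultimately show "eta ^ 5 + 5 * eta ^ 4 + 15 * eta ^ 3 + 25 * eta ^ 2 + 25 * eta = sig TT"
    unfolding eta_dis(1) using rho_facts(1) by simp
  show "eta \<noteq> 0" using xx_yy_nz by (simp add: eta_def ee_nonzero)
qed

lemma eta_powers:
  "eta ^ 2 = dis (- 1) 2 1 (1 / BB) (- 2 / BB)"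
  "eta ^ 3 = dis 5 0 (- 3 + 1 / BB) (- 1 - 3 / BB) 0"
  "eta ^ 4 = dis (- 5) (- 8 + 1 / BB) (2 - 4 / BB) (4 + 2 / BB) (1 + 8 / BB)"
proof -
  define b where "b = 1 / BB"
  have b: "BB * b = 1" using rho_facts by (simp add: b_def)
  have e: "eta = dis (- 1) (- 1) 0 0 b" using eta_dis(2) by (simp add: b_def)
  have cong: "dis r0 r1 r2 r3 r4 = dis s0 s1 s2 s3 s4" if "r0 = s0" "r1 = s1" "r2 = s2" "r3 = s3" "r4 = s4" for r0 r1 r2 r3 r4 s0 s1 s2 s3 s4
    using that by simp
  have e2: "eta ^ 2 = dis (- 1) 2 1 b (- 2 * b)"
    unfolding power2_eq_square e dis_mult by (rule cong) (use b in \<open>algebra | simp add: algebra_simps\<close>)+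
  then show "eta ^ 2 = dis (- 1) 2 1 (1 / BB) (- 2 / BB)" by (simp add: b_def)
  have "eta ^ 3 = eta ^ 2 * eta" by (simp add: power2_eq_square power3_eq_cube)
  also have "\<dots> = dis 5 0 (- 3 + b) (- 1 - 3 * b) 0"
    unfolding e2 unfolding e dis_mult by (rule cong) (use b in \<open>algebra | simp add: algebra_simps\<close>)+
  finally show "eta ^ 3 = dis 5 0 (- 3 + 1 / BB) (- 1 - 3 / BB) 0" by (simp add: b_def)
  have "eta ^ 4 = eta ^ 2 * eta ^ 2" by (simp flip: power_add)
  also have "\<dots> = dis (- 5) (- 8 + b) (2 - 4 * b) (4 + 2 * b) (1 + 8 * b)"
    unfolding e2 dis_mult by (rule cong) (use b in \<open>algebra | simp add: algebra_simps\<close>)+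
  finally show "eta ^ 4 = dis (- 5) (- 8 + 1 / BB) (2 - 4 / BB) (4 + 2 / BB) (1 + 8 / BB)" by (simp add: b_def)
qed

lemma rep_psh_eta:
  "rep (psh ^ 4) (1 + 12 * aa + 6 * aa ^ 2)"
  "rep (psh ^ 4 * eta) (23 - 4 * aa - 2 * aa ^ 2)"
  "rep (psh ^ 4 * eta ^ 2) (- 25)"
  "rep (psh ^ 4 * eta ^ 3) (aa ^ 3 + 4 * aa + 37 + 32 / aa)"
  "rep (psh ^ 4 * eta ^ 4) (- 125)"
proof -
  note M = M_values[OF kk_facts(1-3), folded aa_def kk_consequences(1) uu_def vv_def]
  define b where "b = 1 / BB"
  have b: "BB * b = 1" "1 / BB = b" "- 2 / BB = - 2 * b" "3 / BB = 3 * b" "4 / BB = 4 * b" "2 / BB = 2 * b" "8 / BB = 8 * b"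
    using rho_facts by (simp_all add: b_def)
  have p2: "psh ^ 2 = dis (1 + 2 * aa) (BB * vv ^ 2) (2 * uu) (2 * vv) (uu ^ 2)"
    unfolding power2_eq_square psh_dis dis_mult M(1) [symmetric] by (simp add: algebra_simps)
  define s0 s1 s2 s3 s4 where
    "s0 = 1 + 12 * aa + 6 * aa ^ 2" and "s1 = (6 + 4 * aa) * (1 + kk) ^ 2 / kk + 4 * (1 + kk) * (1 - kk) ^ 2 / kk ^ 2"
    and "s2 = (1 + kk) ^ 4 / kk ^ 2 + (4 + 12 * aa) * (1 + kk) / kk"
    and "s3 = (4 + 12 * aa) * (1 + kk) ^ 2 / (kk * (1 - kk)) + (1 + kk) ^ 2 * (1 - kk) ^ 2 / kk ^ 3"
    and "s4 = 4 * (1 + kk) ^ 4 / (kk ^ 2 * (1 - kk)) + (6 + 4 * aa) * (1 + kk) ^ 2 / kk ^ 2"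
  note M' = M [folded s0_def s1_def s2_def s3_def s4_def]
  have "psh ^ 4 = psh ^ 2 * psh ^ 2" by (simp flip: power_add)
  also have "\<dots> = dis s0 s1 s2 s3 s4"
  proof -
    have "(1 + 2 * aa) * (1 + 2 * aa) + BB * (BB * vv ^ 2 * uu ^ 2 + 2 * uu * (2 * vv) + 2 * vv * (2 * uu) + uu ^ 2 * (BB * vv ^ 2)) = s0"
      unfolding s0_def M'(1) [symmetric] by algebra
    moreover have "(1 + 2 * aa) * (BB * vv ^ 2) + BB * vv ^ 2 * (1 + 2 * aa) + BB * (2 * uu * uu ^ 2 + 2 * vv * (2 * vv) + uu ^ 2 * (2 * uu)) = s1"
      unfolding M'(2) [symmetric] by algebra
    moreover have "(1 + 2 * aa) * (2 * uu) + BB * vv ^ 2 * (BB * vv ^ 2) + 2 * uu * (1 + 2 * aa) + BB * (2 * vv * uu ^ 2 + uu ^ 2 * (2 * vv)) = s2"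
      unfolding M'(3) [symmetric] M'(1) [symmetric] by algebra
    moreover have "(1 + 2 * aa) * (2 * vv) + BB * vv ^ 2 * (2 * uu) + 2 * uu * (BB * vv ^ 2) + 2 * vv * (1 + 2 * aa) + BB * (uu ^ 2 * uu ^ 2) = s3"
      unfolding M'(4) [symmetric] M'(1) [symmetric] by algebra
    moreover have "(1 + 2 * aa) * uu ^ 2 + BB * vv ^ 2 * (2 * vv) + 2 * uu * (2 * uu) + 2 * vv * (BB * vv ^ 2) + uu ^ 2 * (1 + 2 * aa) = s4"
      unfolding M'(5) [symmetric] by algebra
    ultimately show ?thesis unfolding p2 dis_mult by simp
  qed
  finally have p4: "psh ^ 4 = dis s0 s1 s2 s3 s4" .
  show "rep (psh ^ 4) (1 + 12 * aa + 6 * aa ^ 2)"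
    unfolding p4 s0_def [symmetric] by (rule rep_dis)
  have r: "rep (psh ^ 4 * dis r0 r1 r2 r3 r4) m" if "s0 * r0 + BB * (s1 * r4 + s2 * r3 + s3 * r2 + s4 * r1) = m" for r0 r1 r2 r3 r4 m
    unfolding p4 dis_mult that by (rule rep_dis)
  show "rep (psh ^ 4 * eta) (23 - 4 * aa - 2 * aa ^ 2)"
    unfolding eta_dis(2) M'(6) [symmetric] b(2) by (rule r) (use b(1) in algebra)
  show "rep (psh ^ 4 * eta ^ 2) (- 25)"
    unfolding eta_powers M'(7) [symmetric] b(2-) by (rule r) (use b(1) in algebra)
  show "rep (psh ^ 4 * eta ^ 3) (aa ^ 3 + 4 * aa + 37 + 32 / aa)"
    unfolding eta_powers M'(8) [symmetric] b(2-) by (rule r) (use b(1) in algebra)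
  show "rep (psh ^ 4 * eta ^ 4) (- 125)"
    unfolding eta_powers M'(9) [symmetric] b(2-) by (rule r) (use b(1) in algebra)
qed

text \<open>The dictionary from monomials in a, b, c to eta quotients: three entries for the first
  formula, two that bring its remaining dissected terms to the common factor E_1 E_5^2, and then one
  for each partial fraction except the constant.\<close>

lemma eta_quotient_terms:
  fixes t e1 e2 e5 e10 a b c :: "'a :: field_char_0"
  assumes nz: "t \<noteq> 0" "e1 \<noteq> 0" "e2 \<noteq> 0" "e5 \<noteq> 0" "e10 \<noteq> 0"
    and a: "a = e2 * e5 ^ 5 / (t * e1 * e10 ^ 5)" and b: "b = e2 ^ 4 * e5 ^ 2 / (t * e1 ^ 2 * e10 ^ 4)"
    and c: "c = e1 ^ 3 * e5 / (t * e2 * e10 ^ 3)"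
  shows
    "t ^ 2 * ((e10 ^ 2 / e5) ^ 4 / e5) * (a * c) = e1 ^ 2 * e5"
    "t ^ 2 * ((e10 ^ 2 / e5) ^ 4 / e5) * a = t * ((e2 * e10 ^ 3) / e1)"
    "t ^ 2 * ((e10 ^ 2 / e5) ^ 4 / e5) * (a ^ 2 * b / c ^ 2) = t * ((e2 ^ 8 * e5 ^ 5) / e1 ^ 10)"
    "e2 ^ 3 * (e10 / e5) * (a / c) = e1 * e5 ^ 2 * (b / c)"
    "t * e1 ^ 5 * (e10 ^ 2 / e5) ^ 4 / e5 ^ 6 = e1 * e5 ^ 2 * (b * c / a ^ 3)"
    "e1 * e5 ^ 2 * (6 / c) = 6 * (t * ((e2 * e5 * e10 ^ 3) / e1 ^ 2))"
    "e1 * e5 ^ 2 * (50 / b) = 50 * (t * ((e1 ^ 3 * e10 ^ 4) / e2 ^ 4))"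
    "e1 * e5 ^ 2 * (625 * a / (b ^ 3 * c)) = 625 * (t ^ 3 * ((e1 ^ 3 * e10 ^ 10) / e2 ^ 10))"
    "e1 * e5 ^ 2 * (50 * c ^ 3 / b ^ 3) = 50 * ((e1 ^ 16 * e10 ^ 3) / (e2 ^ 15 * e5))"
    "e1 * e5 ^ 2 * (7500 * c ^ 2 / b ^ 3) = 7500 * (t * ((e1 ^ 13 * e10 ^ 6) / (e2 ^ 14 * e5 ^ 2)))"
    "e1 * e5 ^ 2 * (282500 * c / b ^ 3) = 282500 * (t ^ 2 * ((e1 ^ 10 * e10 ^ 9) / (e2 ^ 13 * e5 ^ 3)))"
    "e1 * e5 ^ 2 * (5091250 / b ^ 3) = 5091250 * (t ^ 3 * ((e1 ^ 7 * e10 ^ 12) / (e2 ^ 12 * e5 ^ 4)))"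
    "e1 * e5 ^ 2 * (53406250 / (b ^ 3 * c)) = 53406250 * (t ^ 4 * ((e1 ^ 4 * e10 ^ 15) / (e2 ^ 11 * e5 ^ 5)))"
    "e1 * e5 ^ 2 * (352125000 / (b ^ 3 * c ^ 2)) = 352125000 * (t ^ 5 * ((e1 * e10 ^ 18) / (e2 ^ 10 * e5 ^ 6)))"
    "e1 * e5 ^ 2 * (1490000000 / (b ^ 3 * c ^ 3)) = 1490000000 * (t ^ 6 * (e10 ^ 21 / (e1 ^ 2 * e2 ^ 9 * e5 ^ 7)))"
    "e1 * e5 ^ 2 * (3950000000 / (b ^ 3 * c ^ 4)) = 3950000000 * (t ^ 7 * (e10 ^ 24 / (e1 ^ 5 * e2 ^ 8 * e5 ^ 8)))"
    "e1 * e5 ^ 2 * (6000000000 / (b ^ 3 * c ^ 5)) = 6000000000 * (t ^ 8 * (e10 ^ 27 / (e1 ^ 8 * e2 ^ 7 * e5 ^ 9)))"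
    "e1 * e5 ^ 2 * (4000000000 / (b ^ 3 * c ^ 6)) = 4000000000 * (t ^ 9 * (e10 ^ 30 / (e1 ^ 11 * e2 ^ 6 * e5 ^ 10)))"
    "e1 * e5 ^ 2 * (39375 * a * b / c ^ 3) = 39375 * (t * ((e2 ^ 8 * e5 ^ 6) / e1 ^ 11))"
    "e1 * e5 ^ 2 * (4062500 * a ^ 3 / c ^ 5) = 4062500 * (t ^ 2 * ((e2 ^ 8 * e5 ^ 12) / e1 ^ 17))"
    "e1 * e5 ^ 2 * (123046875 * a ^ 5 / (b * c ^ 7)) = 123046875 * (t ^ 3 * ((e2 ^ 8 * e5 ^ 18) / e1 ^ 23))"
    "e1 * e5 ^ 2 * (1464843750 * a ^ 7 / (b ^ 2 * c ^ 9)) = 1464843750 * (t ^ 4 * ((e2 ^ 8 * e5 ^ 24) / e1 ^ 29))"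
    "e1 * e5 ^ 2 * (6103515625 * a ^ 9 / (b ^ 3 * c ^ 11)) = 6103515625 * (t ^ 5 * ((e2 ^ 8 * e5 ^ 30) / e1 ^ 35))"
  unfolding a b c using nz by (simp add: divide_simps; algebra)+

lemmas ee_quotients = eta_quotient_terms[OF xx_yy_nz(3) ee_nz aa_eta aa_plus_1_eta aa_minus_4_eta]

text \<open>The bracket is T times class 0 of \<open>e2h / eta\<close>, as it arises in
  \<open>rep_e2h_eta\<close>.\<close>

lemma e2_eta_identity:
  fixes k :: "'a :: field_char_0"
  assumes nz: "k \<noteq> 0" "1 + k \<noteq> 0" "1 - k \<noteq> 0"
  defines "a \<equiv> (1 - k) * (1 + k) / k" and "B \<equiv> k * (1 - k) ^ 2 / (1 + k) ^ 2" and "w \<equiv> (1 - k) / (1 + k)"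
  shows "(- 5 + 2 * w + w / B + B / w - 2 / w) * a = (a + 1) * (a - 4)"
proof -
  have h: "w / B = (1 + k) / (k * (1 - k))" "B / w = k * (1 - k) / (1 + k)" "2 / w = 2 * (1 + k) / (1 - k)"
    unfolding w_def B_def using nz by (simp_all add: divide_simps; algebra)+
  show ?thesis unfolding h unfolding a_def w_def using nz by (simp add: divide_simps; algebra)
qed

text \<open>Division by \<open>eta\<close> through its quintic equation.\<close>

lemma rep_divide_eta:
  assumes "rep (f * eta ^ 4) x4" "rep (f * eta ^ 3) x3" "rep (f * eta ^ 2) x2" "rep (f * eta) x1" "rep f x0"
  shows "rep (f / eta) ((x4 + 5 * x3 + 15 * x2 + 25 * x1 + 25 * x0) / TT)"
proof -
  have nz: "sig TT \<noteq> 0" using TT_nz by (simp add: sig_eq_0_iff)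
  have "rep (f * eta ^ 4 + 5 * (f * eta ^ 3) + 15 * (f * eta ^ 2) + 25 * (f * eta) + 25 * f) (x4 + 5 * x3 + 15 * x2 + 25 * x1 + 25 * x0)"
    by (intro rep_add rep_numeral_mult assms)
  from rep_sig_mult[OF this, of "1 / TT"]
  have "rep (sig (1 / TT) * (f * eta ^ 4 + 5 * (f * eta ^ 3) + 15 * (f * eta ^ 2) + 25 * (f * eta) + 25 * f)) ((x4 + 5 * x3 + 15 * x2 + 25 * x1 + 25 * x0) / TT)"
    by simp
  moreover have "eta * (f * eta ^ 4 + 5 * (f * eta ^ 3) + 15 * (f * eta ^ 2) + 25 * (f * eta) + 25 * f) = f * sig TT"
    unfolding eta_quintic [symmetric] by algebra
  then have "f * eta ^ 4 + 5 * (f * eta ^ 3) + 15 * (f * eta ^ 2) + 25 * (f * eta) + 25 * f = sig TT * (f / eta)"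
    using eta_nz by (simp add: field_simps)
  ultimately show ?thesis using nz by (simp add: sig_divide sig_simps)
qed

definition H :: "int \<Rightarrow> complex fls" where "H i = psh ^ 4 * eta powi i"

lemma H_mult: "H i * eta ^ n = H (i + int n)"
  using eta_nz by (simp add: H_def power_int_add mult.assoc)

lemma H_divide: "H i / eta = H (i - 1)"
  using eta_nz by (simp add: H_def power_int_diff)

lemma rep_H_step:
  assumes "rep (H (i + 4)) x4" "rep (H (i + 3)) x3" "rep (H (i + 2)) x2" "rep (H (i + 1)) x1" "rep (H i) x0"
  shows "rep (H (i - 1)) ((x4 + 5 * x3 + 15 * x2 + 25 * x1 + 25 * x0) / TT)"
  unfolding H_divide [symmetric]
  by (rule rep_divide_eta) (use assms H_mult[of i] H_mult[of i 1] in simp_all)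

lemma rep_H: "rep (H (- 1)) (R1 aa / (aa - 4) ^ 2)" "rep (H (- 6)) (R6 aa / (aa - 4) ^ 12)"
proof -
  have r: "rep (H 4) (- 125)" "rep (H 3) (aa ^ 3 + 4 * aa + 37 + 32 / aa)" "rep (H 2) (- 25)"
    "rep (H 1) (23 - 4 * aa - 2 * aa ^ 2)" "rep (H 0) (1 + 12 * aa + 6 * aa ^ 2)"
    using rep_psh_eta by (simp_all add: H_def)
  define m1 where "m1 = (- 125 + 5 * (aa ^ 3 + 4 * aa + 37 + 32 / aa) + 15 * (- 25) + 25 * (23 - 4 * aa - 2 * aa ^ 2) + 25 * (1 + 12 * aa + 6 * aa ^ 2)) / TT"
  have 1: "rep (H (- 1)) m1"
    using rep_H_step[of 0, simplified, OF r] by (simp add: m1_def)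
  define m2 where "m2 = ((aa ^ 3 + 4 * aa + 37 + 32 / aa) + 5 * (- 25) + 15 * (23 - 4 * aa - 2 * aa ^ 2) + 25 * (1 + 12 * aa + 6 * aa ^ 2) + 25 * m1) / TT"
  have 2: "rep (H (- 2)) m2"
    using rep_H_step[of "- 1", simplified, OF r(2-5) 1] by (simp add: m2_def)
  define m3 where "m3 = (- 25 + 5 * (23 - 4 * aa - 2 * aa ^ 2) + 15 * (1 + 12 * aa + 6 * aa ^ 2) + 25 * m1 + 25 * m2) / TT"
  have 3: "rep (H (- 3)) m3"
    using rep_H_step[of "- 2", simplified, OF r(3-5) 1 2] by (simp add: m3_def)
  define m4 where "m4 = ((23 - 4 * aa - 2 * aa ^ 2) + 5 * (1 + 12 * aa + 6 * aa ^ 2) + 15 * m1 + 25 * m2 + 25 * m3) / TT"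
  have 4: "rep (H (- 4)) m4"
    using rep_H_step[of "- 3", simplified, OF r(4-5) 1 2 3] by (simp add: m4_def)
  define m5 where "m5 = ((1 + 12 * aa + 6 * aa ^ 2) + 5 * m1 + 15 * m2 + 25 * m3 + 25 * m4) / TT"
  have 5: "rep (H (- 5)) m5"
    using rep_H_step[of "- 4", simplified, OF r(5) 1 2 3 4] by (simp add: m5_def)
  define m6 where "m6 = (m1 + 5 * m2 + 15 * m3 + 25 * m4 + 25 * m5) / TT"
  have 6: "rep (H (- 6)) m6"
    using rep_H_step[of "- 5", simplified, OF 1 2 3 4 5] by (simp add: m6_def)
  have T: "TT * (x / TT) = x" for x using TT_nz by simp
  have "m1 = R1 aa / (aa - 4) ^ 2 \<and> m6 = R6 aa / (aa - 4) ^ 12"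
    by (intro conjI R_recursion[OF TT_a(3) TT_nz(3,4) TT_a(1), of m1 m2 m3 m4 m5 m6])
       (simp_all only: m1_def m2_def m3_def m4_def m5_def m6_def T)
  then show "rep (H (- 1)) (R1 aa / (aa - 4) ^ 2)" "rep (H (- 6)) (R6 aa / (aa - 4) ^ 12)"
    using 1 6 by simp_all
qed

text \<open>The middle term of the first formula contains E_2 / E_1. Division by eta needs class 0
  of E_2 eta^j for j = 0, ..., 4, which the coordinates of \<open>e2h\<close> supply.\<close>

lemma rep_e2h_eta: "rep (e2h / eta) (aa / (aa - 4))"
proof -
  define w b where "w = (1 - kk) / (1 + kk)" and "b = 1 / BB"
  have nz: "w \<noteq> 0" using kk_facts by (simp add: w_def)
  have b: "BB * b = 1" "1 / BB = b" "- 2 / BB = - 2 * b" "3 / BB = 3 * b" "4 / BB = 4 * b" "2 / BB = 2 * b" "8 / BB = 8 * b"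
    using rho_facts by (simp_all add: b_def)
  define v where "v = 1 / w"
  have v: "v * w = 1" using nz by (simp add: v_def)
  have e: "e2h = dis (- 1) 0 (- v) (w * b) 0"
  proof -
    have "v = (1 + kk) / (1 - kk)" by (simp add: v_def w_def)
    then have "- (1 + kk) / (1 - kk) = - v" by (simp only: minus_divide_left)
    moreover have "(1 - kk) / (1 + kk) / BB = w * b" by (simp add: w_def b_def)
    ultimately show ?thesis unfolding e2h_dis by (simp only:)
  qed
  have r: "rep (e2h * dis r0 r1 r2 r3 r4) m" if "- r0 + BB * (- v * r3 + w * b * r2) = m" for r0 r1 r2 r3 r4 m
  proof -
    have "- 1 * r0 + BB * (0 * r4 + - v * r3 + w * b * r2 + 0 * r1) = m" using that by simp
    then show ?thesis unfolding e dis_mult by (simp only: rep_dis)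
  qed
  have 0: "rep e2h (- 1)" unfolding e by (rule rep_dis)
  have 1: "rep (e2h * eta) 1"
    unfolding eta_dis(2) by (rule r) simp
  have c: "1 + BB * (w * b - v * b) = 1 + w - v"
      "- 5 + BB * (v * (1 + 3 * b) + w * b * (b - 3)) = - 5 + v * (BB + 3) + w * (- 3 + b)"
      "5 + BB * (w * b * (2 - 4 * b) - v * (4 + 2 * b)) = 5 - v * (4 * BB + 2) + w * (2 - 4 * b)"
    using b(1) by algebra+
  have 2: "rep (e2h * eta ^ 2) (1 + w - v)"
    unfolding eta_powers b(2-) by (rule r, subst c(1) [symmetric]) (simp add: algebra_simps)
  have 3: "rep (e2h * eta ^ 3) (- 5 + v * (BB + 3) + w * (- 3 + b))"
    unfolding eta_powers b(2-) by (rule r, subst c(2) [symmetric]) (simp add: algebra_simps)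
  have 4: "rep (e2h * eta ^ 4) (5 - v * (4 * BB + 2) + w * (2 - 4 * b))"
    unfolding eta_powers b(2-) by (rule r, subst c(3) [symmetric]) (simp add: algebra_simps)
  have "rep (e2h / eta) ((5 - v * (4 * BB + 2) + w * (2 - 4 * b) + 5 * (- 5 + v * (BB + 3) + w * (- 3 + b)) + 15 * (1 + w - v) + 25 * 1 + 25 * (- 1)) / TT)"
    by (rule rep_divide_eta[OF 4 3 2 1 0])
  also have "5 - v * (4 * BB + 2) + w * (2 - 4 * b) + 5 * (- 5 + v * (BB + 3) + w * (- 3 + b)) + 15 * (1 + w - v) + 25 * 1 + 25 * (- 1) =
      - 5 + 2 * w + w * b + BB * v - 2 * v" by algebra
  also have "\<dots> = - 5 + 2 * w + w / BB + BB / w - 2 / w" by (simp add: b_def v_def)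
  also have "(- 5 + 2 * w + w / BB + BB / w - 2 / w) / TT = aa / (aa - 4)"
  proof -
    define s where "s = - 5 + 2 * w + w / BB + BB / w - 2 / w"
    have s: "s * aa = (aa + 1) * (aa - 4)"
      using e2_eta_identity[OF kk_facts(1-3)] unfolding s_def w_def kk_consequences(1) aa_def .
    have "(s * (aa - 4)) * aa ^ 2 = (aa * TT) * aa ^ 2"
    proof -
      have "(s * (aa - 4)) * aa ^ 2 = (s * aa) * (aa * (aa - 4))" by algebra
      also have "\<dots> = aa * (TT * aa ^ 2)" unfolding s TT_a(1) by algebra
      finally show ?thesis by (simp only: mult.assoc)
    qed
    then have "s * (aa - 4) = aa * TT"
      by (rule mult_right_cancel[THEN iffD1, rotated]) (use TT_a(3) in simp)
    then show ?thesis unfolding s_def [symmetric] using TT_nz by (simp add: frac_eq_eq)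
  qed
  finally show ?thesis .
qed

lemma fl_divide: "fps_nth g 0 \<noteq> 0 \<Longrightarrow> fl (f / g) = fl f / fl g"
  by (rule fls_divide_fps_to_fls [symmetric]) (simp add: subdegree_eq_0)

lemma E_unit:
  "j \<ge> 1 \<Longrightarrow> fps_nth (E j) 0 \<noteq> 0" "fps_nth f 0 \<noteq> 0 \<Longrightarrow> fps_nth (f ^ n) 0 \<noteq> 0"
  "fps_nth f 0 \<noteq> 0 \<Longrightarrow> fps_nth g 0 \<noteq> 0 \<Longrightarrow> fps_nth (f * g) 0 \<noteq> 0"
  for f g :: "complex fps"
  by (simp_all add: fps_nth_E_0 fps_power_zeroth)

lemma ee_shift: "ee 25 \<noteq> 0" "ee 50 \<noteq> 0" "sig (ee 1) = ee 5" "sig (ee 2) = ee 10" "sig (ee 5) = ee 25" "sig (ee 10) = ee 50"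
  by (simp_all add: ee_nonzero sig_ee)

lemma fl_psi_pow4: "fl psi ^ 4 = t ^ 12 * sig (fl psi5) ^ 4 * psh ^ 4" "sig (fl psi5) \<noteq> 0"
proof -
  show nz: "sig (fl psi5) \<noteq> 0" using ee_nz by (simp add: sig_eq_0_iff fl_psi)
  have "fl psi = t ^ 3 * sig (fl psi5) * psh" using nz xx_yy_nz by (simp add: psh_def)
  then have "fl psi ^ 4 = (t ^ 3 * sig (fl psi5) * psh) ^ 4" by (rule arg_cong)
  then show "fl psi ^ 4 = t ^ 12 * sig (fl psi5) ^ 4 * psh ^ 4" by (simp add: power_mult_distrib power_mult [symmetric])
qed

lemma ee_1_eta: "ee 1 = t * ee 25 * eta"
  using xx_yy_nz ee_shift by (simp add: eta_def)

section \<open>The two arithmetic progressions\<close>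

definition spt_odd :: "complex fps" where "spt_odd = sec 2 1 spt_gf"

lemma fl_spt_10n_3:
  "fl (sec 5 1 spt_odd) = 5 * (ee 1 ^ 2 * ee 5 + 6 * t * ((ee 2 * ee 10 ^ 3) / ee 1) + 25 * t * ((ee 2 ^ 8 * ee 5 ^ 5) / ee 1 ^ 10))"
proof -
  have "fl spt_odd * ee 1 ^ 5 = ee 2 ^ 8"
    using arg_cong[OF spt_omega_odd, of fl] unfolding fl_simps spt_odd_def .
  then have "fl spt_odd = ee 2 ^ 8 / ee 1 ^ 5" using ee_nz by (simp add: nonzero_eq_divide_eq)
  also have "\<dots> = fl psi ^ 4 / ee 1"
    unfolding fl_psi using ee_nz by (simp add: divide_simps; algebra)
  \<comment> \<open>psi^4 carries t^12 and E_1 carries t, so the exponent is 11: class 1, with a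
    shift by 2.\<close>
  also have "\<dots> = t ^ (5 * 2 + 1) * sig (fl psi5 ^ 4 / ee 5) * H (- 1)"
  proof -
    have "H (- 1) = psh ^ 4 / eta" by (simp add: H_def power_int_minus divide_inverse)
    then show ?thesis unfolding fl_psi_pow4 ee_1_eta sig_divide sig_simps ee_shift
      using ee_shift eta_nz xx_yy_nz by (simp add: field_simps eval_nat_numeral)
  qed
  finally have "fl (sec 5 1 spt_odd) = t ^ 2 * (fl psi5 ^ 4 / ee 5) * (R1 aa / (aa - 4) ^ 2)"
    by (rule sec_extract[OF _ rep_H(1)]) simp
  also have "\<dots> = 5 * (t ^ 2 * ((ee 10 ^ 2 / ee 5) ^ 4 / ee 5) * (aa * (aa - 4)) + 6 * (t ^ 2 * ((ee 10 ^ 2 / ee 5) ^ 4 / ee 5) * aa)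
      + 25 * (t ^ 2 * ((ee 10 ^ 2 / ee 5) ^ 4 / ee 5) * (aa ^ 2 * (aa + 1) / (aa - 4) ^ 2)))"
  proof -
    have "K * (5 * (x + 6 * y + 25 * z)) = 5 * (K * x + 6 * (K * y) + 25 * (K * z))" for K x y z :: "complex fls"
      by (simp add: algebra_simps)
    then show ?thesis unfolding R1_identity[OF TT_nz(4)] fl_psi by (simp only:)
  qed
  also have "\<dots> = 5 * (ee 1 ^ 2 * ee 5 + 6 * t * ((ee 2 * ee 10 ^ 3) / ee 1) + 25 * t * ((ee 2 ^ 8 * ee 5 ^ 5) / ee 1 ^ 10))"
    unfolding ee_quotients(1-3)
    by (simp only: mult.assoc)
  finally show ?thesis .
qed

lemma fl_spt_50n_23:
  "fl (sec 5 2 (sec 5 1 spt_odd)) = 5 * (ee 1 * ee 5 ^ 2 * (- 1 + 6 * ((aa + 1) / (aa - 4)) + 25 * ((aa + 1) * (aa - 4) / aa ^ 3) * (R6 aa / (aa - 4) ^ 12)))"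
proof -
  \<comment> \<open>The first formula divided by t^2. Its terms supply eta^2,
    \<open>e2h / eta\<close> and psi^4 / eta^6, all with the same power of t, so class 0 of
    \<open>F\<close> becomes class 2.\<close>
  define F where "F = 5 * (sig (ee 1 * ee 5 ^ 2) * eta ^ 2 + 6 * (sig (ee 2 ^ 3 * (ee 10 / ee 5)) * (e2h / eta))
     + 25 * (sig (t * ee 1 ^ 5 * fl psi5 ^ 4 / ee 5 ^ 6) * H (- 6)))"
  have "rep (eta ^ 2) (- 1)" unfolding eta_powers by (rule rep_dis)
  then have rF: "rep F (5 * (ee 1 * ee 5 ^ 2 * (- 1) + 6 * (ee 2 ^ 3 * (ee 10 / ee 5) * (aa / (aa - 4)))
     + 25 * ((t * ee 1 ^ 5 * fl psi5 ^ 4 / ee 5 ^ 6) * (R6 aa / (aa - 4) ^ 12))))"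
    unfolding F_def by (intro rep_numeral_mult rep_add rep_sig_mult rep_e2h_eta rep_H(2))
  have "fl (sec 5 1 spt_odd) = t ^ (5 * 0 + 2) * sig 1 * F"
  proof -
    have 1: "ee 1 ^ 2 * ee 5 = t ^ 2 * (sig (ee 1 * ee 5 ^ 2) * eta ^ 2)"
      unfolding sig_simps ee_shift by (subst ee_1_eta) (simp add: power_mult_distrib ac_simps)
    have 2: "t * ((ee 2 * ee 10 ^ 3) / ee 1) = t ^ 2 * (sig (ee 2 ^ 3 * (ee 10 / ee 5)) * (e2h / eta))"
    proof -
      have "ee 2 = t ^ 2 * ee 50 * e2h" using xx_yy_nz ee_shift by (simp add: e2h_def)
      then have "t * ((ee 2 * ee 10 ^ 3) / ee 1) = t * ((t ^ 2 * ee 50 * e2h * ee 10 ^ 3) / (t * ee 25 * eta))"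
        using ee_1_eta by simp
      then show ?thesis unfolding sig_simps sig_divide ee_shift
        using xx_yy_nz ee_shift eta_nz by (simp add: field_simps eval_nat_numeral)
    qed
    \<comment> \<open>Here the power of t is 1 + 12 - 6 = 7; the surplus t^5 is \<open>sig t\<close>
      and joins the scalar.\<close>
    have 3: "t * ((ee 2 ^ 8 * ee 5 ^ 5) / ee 1 ^ 10) = t ^ 2 * (sig (t * ee 1 ^ 5 * fl psi5 ^ 4 / ee 5 ^ 6) * H (- 6))"
    proof -
      have cancel: "u * (u ^ 12 * S * P * E' / (u * e * h) ^ 6) = u ^ 2 * (u ^ 5 * E' * S / e ^ 6 * (P / h ^ 6))"
        if "u \<noteq> 0" "e \<noteq> 0" "h \<noteq> 0" for u e h S P E' :: "complex fls"
        using that by (simp add: divide_simps; algebra)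
      have "H (- 6) = psh ^ 4 / eta ^ 6" by (simp add: H_def power_int_minus divide_inverse)
      have "t * ((ee 2 ^ 8 * ee 5 ^ 5) / ee 1 ^ 10) = t * (fl psi ^ 4 * ee 5 ^ 5 / ee 1 ^ 6)"
        unfolding fl_psi using ee_nz by (simp add: divide_simps; algebra)
      also have "\<dots> = t * (t ^ 12 * sig (fl psi5) ^ 4 * psh ^ 4 * ee 5 ^ 5 / (t * ee 25 * eta) ^ 6)"
        unfolding fl_psi_pow4 ee_1_eta [symmetric] ..
      also have "\<dots> = t ^ 2 * (t ^ 5 * ee 5 ^ 5 * sig (fl psi5) ^ 4 / ee 25 ^ 6 * (psh ^ 4 / eta ^ 6))"
        by (rule cancel) (use xx_yy_nz ee_shift eta_nz in simp_all)
      finally show ?thesis unfolding \<open>H (- 6) = _\<close> sig_simps sig_divide ee_shift .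
    qed
    have "5 * (t ^ 2 * x + 6 * (t ^ 2 * y) + 25 * (t ^ 2 * z)) = t ^ (5 * 0 + 2) * sig 1 * (5 * (x + 6 * y + 25 * z))" for x y z
      by (simp add: sig_simps algebra_simps power2_eq_square)
    then show ?thesis unfolding fl_spt_10n_3 mult.assoc[of 6 t] mult.assoc[of 25 t] 1 2 3 F_def .
  qed
  then have "fl (sec 5 2 (sec 5 1 spt_odd)) = t ^ 0 * 1 * (5 * (ee 1 * ee 5 ^ 2 * (- 1) + 6 * (ee 2 ^ 3 * (ee 10 / ee 5) * (aa / (aa - 4)))
     + 25 * ((t * ee 1 ^ 5 * fl psi5 ^ 4 / ee 5 ^ 6) * (R6 aa / (aa - 4) ^ 12))))"
    by (rule sec_extract[OF _ rF]) simp
  also have "\<dots> = 5 * (ee 1 * ee 5 ^ 2 * (- 1) + 6 * (ee 1 * ee 5 ^ 2 * ((aa + 1) / (aa - 4)))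
     + 25 * ((ee 1 * ee 5 ^ 2 * ((aa + 1) * (aa - 4) / aa ^ 3)) * (R6 aa / (aa - 4) ^ 12)))"
    unfolding fl_psi ee_quotients(4-5) by simp
  also have "\<dots> = 5 * (ee 1 * ee 5 ^ 2 * (- 1 + 6 * ((aa + 1) / (aa - 4)) + 25 * ((aa + 1) * (aa - 4) / aa ^ 3) * (R6 aa / (aa - 4) ^ 12)))"
    by (simp only: distrib_left mult.assoc mult.left_commute)
  finally show ?thesis .
qed

text \<open>Only common factors are extracted, such as 7500 = 50 * 150 and 39375 = 625 * 63, in the
  arrangement of the final formula.\<close>

lemma regroup:
  fixes u :: "'a :: field_char_0"
  shows "25 * (
      x0
    + 6 * (u * x1)
    + 50 * (u * x2)
    + 625 * (u ^ 3 * x3)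
    + 50 * (x4)
    + 7500 * (u * x5)
    + 282500 * (u ^ 2 * x6)
    + 5091250 * (u ^ 3 * x7)
    + 53406250 * (u ^ 4 * x8)
    + 352125000 * (u ^ 5 * x9)
    + 1490000000 * (u ^ 6 * x10)
    + 3950000000 * (u ^ 7 * x11)
    + 6000000000 * (u ^ 8 * x12)
    + 4000000000 * (u ^ 9 * x13)
    + 39375 * (u * x14)
    + 4062500 * (u ^ 2 * x15)
    + 123046875 * (u ^ 3 * x16)
    + 1464843750 * (u ^ 4 * x17)
    + 6103515625 * (u ^ 5 * x18))
    = 25 * (x0 + 6 * u * x1
        + 25 * (2 * u * x2 + 25 * u ^ 3 * x3)
        + 50 * (
            x4
          + 150 * u * x5
          + 5650 * u ^ 2 * x6
          + 101825 * u ^ 3 * x7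
          + 1068125 * u ^ 4 * x8
          + 7042500 * u ^ 5 * x9
          + 29800000 * u ^ 6 * x10
          + 79000000 * u ^ 7 * x11
          + 120000000 * u ^ 8 * x12
          + 80000000 * u ^ 9 * x13)
        + 625 * u * (
            63 * x14
          + 6500 * u * x15
          + 196875 * u ^ 2 * x16
          + 2343750 * u ^ 3 * x17
          + 9765625 * u ^ 4 * x18))"
  by algebra

theorem theorem1p7:
  shows "Abs_fps (\<lambda>n. of_nat (spt_omega (10 * n + 3))) =
      5 * (E 1 ^ 2 * E 5 + 6 * q * ((E 2 * E 10 ^ 3) / E 1) + 25 * q * ((E 2 ^ 8 * E 5 ^ 5) / E 1 ^ 10))
    \<and> Abs_fps (\<lambda>n. of_nat (spt_omega (50 * n + 23))) =
      25 * (E 1 * E 5 ^ 2 + 6 * q * ((E 2 * E 5 * E 10 ^ 3) / E 1 ^ 2)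
        + 25 * (2 * q * ((E 1 ^ 3 * E 10 ^ 4) / E 2 ^ 4) + 25 * q ^ 3 * ((E 1 ^ 3 * E 10 ^ 10) / E 2 ^ 10))
        + 50 * (
            ((E 1 ^ 16 * E 10 ^ 3) / (E 2 ^ 15 * E 5))
          + 150 * q * ((E 1 ^ 13 * E 10 ^ 6) / (E 2 ^ 14 * E 5 ^ 2))
          + 5650 * q ^ 2 * ((E 1 ^ 10 * E 10 ^ 9) / (E 2 ^ 13 * E 5 ^ 3))
          + 101825 * q ^ 3 * ((E 1 ^ 7 * E 10 ^ 12) / (E 2 ^ 12 * E 5 ^ 4))
          + 1068125 * q ^ 4 * ((E 1 ^ 4 * E 10 ^ 15) / (E 2 ^ 11 * E 5 ^ 5))
          + 7042500 * q ^ 5 * ((E 1 * E 10 ^ 18) / (E 2 ^ 10 * E 5 ^ 6))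
          + 29800000 * q ^ 6 * (E 10 ^ 21 / (E 1 ^ 2 * E 2 ^ 9 * E 5 ^ 7))
          + 79000000 * q ^ 7 * (E 10 ^ 24 / (E 1 ^ 5 * E 2 ^ 8 * E 5 ^ 8))
          + 120000000 * q ^ 8 * (E 10 ^ 27 / (E 1 ^ 8 * E 2 ^ 7 * E 5 ^ 9))
          + 80000000 * q ^ 9 * (E 10 ^ 30 / (E 1 ^ 11 * E 2 ^ 6 * E 5 ^ 10)))
        + 625 * q * (
            63 * ((E 2 ^ 8 * E 5 ^ 6) / E 1 ^ 11)
          + 6500 * q * ((E 2 ^ 8 * E 5 ^ 12) / E 1 ^ 17)
          + 196875 * q ^ 2 * ((E 2 ^ 8 * E 5 ^ 18) / E 1 ^ 23)
          + 2343750 * q ^ 3 * ((E 2 ^ 8 * E 5 ^ 24) / E 1 ^ 29)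
          + 9765625 * q ^ 4 * ((E 2 ^ 8 * E 5 ^ 30) / E 1 ^ 35)))"
proof -
  have eq: "2 * (5 * n + 1) + 1 = 10 * n + 3" "10 * (5 * n + 2) + 3 = 50 * n + 23" for n :: nat
    by simp_all
  have sections: "Abs_fps (\<lambda>n. of_nat (spt_omega (10 * n + 3))) = sec 5 1 spt_odd"
    "Abs_fps (\<lambda>n. of_nat (spt_omega (50 * n + 23))) = sec 5 2 (sec 5 1 spt_odd)"
    by (simp_all only: sec_def spt_odd_def spt_gf_def fps_nth_Abs_fps eq)
  have assoc: "5 * (x * (5 * y)) = 25 * (x * y)" for x y :: "complex fls" by simp
  note second = fl_spt_50n_23[unfolded R6_identity[OF refl refl TT_a(3) TT_nz(3,4)] assoc,
    unfolded distrib_left[of "ee 1 * ee 5 ^ 2"] ee_quotients(6-) mult_1_right]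
  \<comment> \<open>The embedding into Laurent series is injective and respects these quotients
    because every denominator has nonzero constant coefficient.\<close>
  show ?thesis
    unfolding sections
    by (intro conjI; simp only: fps_to_fls_eq_iff [symmetric] trans[OF second regroup] fl_spt_10n_3 fl_simps fl_divide E_unit one_le_numeral order_refl not_False_eq_True)
qed

end
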